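(* For every $\alpha$ with $0<\alpha\le 0.46$, the map $G_\alpha$ admits an absolutely continuous invariant probability measure (with respect to two-dimensional Lebesgue measure on $[0,1]^2$).
   Context: Let $\tau:[0,1]\to[0,1]$ be the symmetric tent map, $\tau(x)=2x$ for $0\le x<1/2$ and $\tau(x)=2-2x$ for $1/2\le x\le 1$. For $0<\alpha<1$ define $G_\alpha:[0,1]^2\to[0,1]^2$ by $G_\alpha(x,y)=(y,\tau(\alpha y+(1-\alpha)x))$. *)

theory Defs
  imports "HOL-Probability.Probability"
begin

text \<open>Symmetric tent map on [0,1] (formula extended to all reals; only its values on [0,1] matter).\<close>
definition tent :: "real \<Rightarrow> real" where
  "tent x = (if x < 1/2 then 2 * x else 2 - 2 * x)"

definition Gmap :: "real \<Rightarrow> real \<times> real \<Rightarrow> real \<times> real" where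
  "Gmap \<alpha> p = (snd p, tent (\<alpha> * snd p + (1 - \<alpha>) * fst p))"

definition unit_square :: "(real \<times> real) set" where
  "unit_square = {0..1} \<times> {0..1}"

definition leb_square :: "(real \<times> real) measure" where
  "leb_square = restrict_space lborel unit_square"

end

theory Submission
  imports Defs "HOL-Probability.Probability"
begin

text \<open>The map is piecewise affine with two branches whose linear parts have determinant of modulus
  \<open>J = 2 (1 - \<alpha>) > 1\<close>. If the branches expand uniformly along the orbits of an open set of initial
  points, push the uniform density on that set forward. The mass near the fold line obeys a recursion:
  a convex image of a cell meets a thin strip in small mass unless its chords are short, chords of
  cells of bounded depth are short only near finitely many points, and there a two-dimensional Hardy
  inequality gains over the kernel \<open>1 / dist\<close>. This bounds the mass near the boundaries of the images
  uniformly in time, so the averaged push-forwards are uniformly absolutely continuous and every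
  cluster point is an absolutely continuous invariant measure.

  Expansion is measured by \<open>J x\<^sup>2 + y\<^sup>2\<close>, for which the two branches differ by an isometry, so only
  the lengths of the runs between increasing branches matter. Most runs expand because
  \<open>J x\<^sup>2 + 2 \<alpha> x y + y\<^sup>2\<close> is multiplied exactly by \<open>J\<close> under the decreasing branch, and some do since
  the cube of this branch expands. The other runs either cannot occur in the forward invariant polygon
  \<open>x + y \<ge> 2 \<alpha>\<close> of the square, or are compensated by the runs that must follow them. On each of eleven
  parameter intervals this is a finite check with certificates that are polynomial in \<open>\<alpha>\<close>.\<close>

section \<open>Traces of convex sets\<close>

text \<open>Cells may crowd at a point faster than the branches expand, and this shapes the
  recursion. Its escape term has coefficient one whatever the depth \<open>k\<close> of the cells,
  and its scale shrinks like \<theta>^k, so \<open>k\<close> can be fixed to make it small. The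
  vertices and chord constants of the polygons of depth \<open>k\<close> are then fixed but
  uncontrolled. The kernels at the vertices are therefore pulled back over a second depth
  \<open>M\<close>, chosen after \<open>k\<close>, and a factor \<theta>^M absorbs those constants.
  Expansion degenerates at \<alpha> = 1/2: the linear part of the decreasing branch has
  characteristic polynomial z^2 + 2 \<alpha> z + 2 (1 - \<alpha>), which tends to z^2 + z + 1, so
  its cube tends to the identity while J tends to 1. Runs whose length is not a multiple of three
  may then lose a bounded factor, which J^m makes up for only when m is large. More and more of the
  lengths 1, 2, 4, 5, 7, 8, 10, 11 have to be excluded or compensated as \<alpha> grows, and the
  parameter intervals near 1/2 become short.\<close>

lemma interval_end_right:
  fixes I K :: "real set"
  assumes "convex I" "convex K" "I \<in> sets borel" "K \<in> sets borel"
    and z: "z \<in> K" "\<And>y. y \<in> I \<Longrightarrow> y < z" and s: "0 < s"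
  shows "min (emeasure lborel (I \<inter> K)) (ennreal s) \<le> emeasure lborel {y \<in> I \<inter> K. y + s \<notin> I}"
proof (cases "I \<inter> K = {}")
  case True
  then show ?thesis by simp
next
  case ne: False
  define J where "J = I \<inter> K"
  have J: "convex J" "J \<noteq> {}" "J \<in> sets borel"
    using assms ne by (auto simp: J_def convex_Int)
  have bdd: "bdd_above J"
    using z(2) by (intro bdd_aboveI[of _ z]) (auto simp: J_def less_imp_le)
  define M where "M = Sup J"
  have upM: "y \<le> M" if "y \<in> J" for y
    using cSup_upper[OF that bdd] by (simp add: M_def)
  define E where "E = {y \<in> I \<inter> K. y + s \<notin> I}"
  have Emeas: "E \<in> sets borel"
  proof -
    have "E = (I \<inter> K) \<inter> (\<lambda>y. y + s) -` (- I)"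
      by (auto simp: E_def)
    moreover have "(\<lambda>y. y + s) -` (- I) \<in> sets borel"
      by (rule measurable_sets_borel[where M=borel]) (use assms in auto)
    ultimately show ?thesis using assms by auto
  qed
  \<comment> \<open>Points within \<open>s\<close> of the right end \<open>M\<close> leave
    \<open>I\<close>: a shifted point still in \<open>I\<close> would lie between \<open>y\<close>
    and \<open>z\<close>, hence in the interval \<open>K\<close> as well, beyond the supremum of
    \<open>I \<inter> K\<close>.\<close>
  have sub: "{y \<in> J. M - s < y} \<subseteq> E"
  proof
    fix y assume "y \<in> {y \<in> J. M - s < y}"
    then have y: "y \<in> I" "y \<in> K" "M < y + s" by (auto simp: J_def)
    have "y + s \<notin> I"
    proof
      assume i: "y + s \<in> I"
      have "y + s \<in> K"
      proof (rule connectedD_interval[OF convex_connected[OF assms(2)] y(2) z(1)])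
        show "y \<le> y + s" "y + s \<le> z" using s z(2)[OF i] by auto
      qed
      then have "y + s \<in> J" using i by (simp add: J_def)
      from upM[OF this] y(3) show False by simp
    qed
    then show "y \<in> E" using y by (simp add: E_def)
  qed
  show ?thesis
  \<comment> \<open>Either \<open>J\<close> reaches down to \<open>M - s\<close> and contains the
    open interval of length \<open>s\<close> below \<open>M\<close>, or all of \<open>J\<close> lies
    within \<open>s\<close> of \<open>M\<close>.\<close>
  proof (cases "\<exists>y0 \<in> J. y0 \<le> M - s")
    case True
    then obtain y0 where y0: "y0 \<in> J" "y0 \<le> M - s" by auto
    have "{M - s<..<M} \<subseteq> {y \<in> J. M - s < y}"
    proof
      fix y assume y: "y \<in> {M - s<..<M}"
      then have "y < Sup J" by (simp add: M_def)
      then obtain x where x: "x \<in> J" "y < x" using less_cSup_iff[OF J(2) bdd] by auto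
      have "y \<in> J"
        by (rule connectedD_interval[OF convex_connected[OF J(1)] y0(1) x(1)]) (use y y0 x in auto)
      then show "y \<in> {y \<in> J. M - s < y}" using y by auto
    qed
    then have "emeasure lborel {M - s<..<M} \<le> emeasure lborel E"
      using sub Emeas by (intro emeasure_mono) auto
    moreover have "emeasure lborel {M - s<..<M} = ennreal s" using s by simp
    ultimately show ?thesis by (simp add: E_def min.coboundedI2)
  next
    case False
    then have "{y \<in> J. M - s < y} = J" by force
    then have "emeasure lborel J \<le> emeasure lborel E"
      using sub Emeas by (intro emeasure_mono) auto
    then show ?thesis by (simp add: E_def J_def min.coboundedI1)
  qed
qed

lemma emeasure_lborel_uminus:
  fixes A :: "real set"
  assumes "A \<in> sets borel"
  shows "emeasure lborel (uminus ` A) = emeasure lborel A"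
proof -
  have im: "uminus ` A = uminus -` A" by force
  have "emeasure (distr lborel borel uminus) A = emeasure lborel (uminus -` A \<inter> space lborel)"
    by (rule emeasure_distr) (use assms in auto)
  then show ?thesis using lborel_distr_uminus im by simp
qed

lemma interval_end_left:
  fixes I K :: "real set"
  assumes "convex I" "convex K" "I \<in> sets borel" "K \<in> sets borel"
    and z: "z \<in> K" "\<And>y. y \<in> I \<Longrightarrow> z < y" and s: "0 < s"
  shows "min (emeasure lborel (I \<inter> K)) (ennreal s) \<le> emeasure lborel {y \<in> I \<inter> K. y - s \<notin> I}"
proof -
  have mb: "uminus ` A \<in> sets borel" if "A \<in> sets borel" for A :: "real set"
  proof -
    have "uminus ` A = uminus -` A" by force
    moreover have "uminus -` A \<in> sets borel"
      by (rule measurable_sets_borel[where M=borel]) (use that in auto)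
    ultimately show ?thesis by simp
  qed
  have un: "uminus ` A = {y. - y \<in> A}" for A :: "real set" by force
  have 1: "min (emeasure lborel (uminus ` I \<inter> uminus ` K)) (ennreal s)
      \<le> emeasure lborel {y \<in> uminus ` I \<inter> uminus ` K. y + s \<notin> uminus ` I}"
    by (rule interval_end_right[where z="-z"])
      (use assms in \<open>auto simp: mb intro!: convex_negations\<close>)
  have 2: "uminus ` I \<inter> uminus ` K = uminus ` (I \<inter> K)" by auto
  have 3: "{y \<in> uminus ` I \<inter> uminus ` K. y + s \<notin> uminus ` I} = uminus ` {y \<in> I \<inter> K. y - s \<notin> I}"
    unfolding un by auto
  have 4: "{y \<in> I \<inter> K. y - s \<notin> I} \<in> sets borel"
  proof -
    have "{y \<in> I \<inter> K. y - s \<notin> I} = (I \<inter> K) \<inter> (\<lambda>y. y - s) -` (- I)" by auto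
    moreover have "(\<lambda>y. y - s) -` (- I) \<in> sets borel"
      by (rule measurable_sets_borel[where M=borel]) (use assms in auto)
    ultimately show ?thesis using assms by auto
  qed
  show ?thesis
    using 1[unfolded 3, unfolded 2] assms(3,4) 4 by (simp add: emeasure_lborel_uminus del: Collect_mem_eq)
qed

text \<open>Two mechanisms bound the trace of \<open>I\<close> on a set of length at most
  \<open>b\<close>. If \<open>I\<close> fills \<open>K\<close>, the trace is at most the fraction
  \<open>b / l\<close> of \<open>I \<inter> K\<close>. Otherwise \<open>I\<close> ends inside
  \<open>K\<close>, and the part of \<open>I\<close> pushed out by a shift of \<open>s\<close> is at
  least the smaller of \<open>s\<close> and the length of \<open>I \<inter> K\<close>, which
  controls the trace up to the factor \<open>b / s\<close>.\<close>

lemma interval_trace: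
  fixes I K S :: "real set"
  assumes I: "convex I" "I \<in> sets borel" and K: "convex K" "K \<in> sets borel"
    and S: "S \<subseteq> K" "emeasure lborel S \<le> ennreal b" "S \<in> sets borel"
    and s: "0 < s" "s \<le> b" and l: "0 < l" "ennreal l \<le> emeasure lborel K"
  shows "emeasure lborel (I \<inter> S) \<le>
      ennreal (b / s) * emeasure lborel {y \<in> I \<inter> K. y + s \<notin> I \<or> y - s \<notin> I}
      + ennreal (b / l) * emeasure lborel (I \<inter> K)"
proof -
  define E where "E = {y \<in> I \<inter> K. y + s \<notin> I \<or> y - s \<notin> I}"
  have Emeas: "E \<in> sets borel"
  proof -
    have "E = (I \<inter> K) \<inter> ((\<lambda>y. y + s) -` (- I) \<union> (\<lambda>y. y - s) -` (- I))" by (auto simp: E_def)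
    moreover have "(\<lambda>y. y + s) -` (- I) \<in> sets borel" "(\<lambda>y. y - s) -` (- I) \<in> sets borel"
      by (rule measurable_sets_borel[where M=borel]; use I in auto)+
    ultimately show ?thesis using I K by auto
  qed
  have b0: "0 < b" using s by simp
  have leb: "emeasure lborel (I \<inter> S) \<le> ennreal b"
    using emeasure_mono[of "I \<inter> S" S lborel] S by (auto intro: order_trans)
  have leJ: "emeasure lborel (I \<inter> S) \<le> emeasure lborel (I \<inter> K)"
    using S I K by (intro emeasure_mono) auto
  show ?thesis
  proof (cases "K \<subseteq> I")
    case True
    then have "I \<inter> K = K" by auto
    have "ennreal b = ennreal (b / l) * ennreal l"
      using l b0 by (simp add: ennreal_mult[symmetric])
    also have "\<dots> \<le> ennreal (b / l) * emeasure lborel (I \<inter> K)"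
      using l \<open>I \<inter> K = K\<close> by (intro mult_left_mono) auto
    finally show ?thesis using leb by (meson add_increasing order_trans zero_le)
  next
    case False
    then obtain z where z: "z \<in> K" "z \<notin> I" by auto
    \<comment> \<open>By convexity the missing point \<open>z\<close> has all of \<open>I\<close> on
      one side, which decides the end of \<open>I\<close> to be used.\<close>
    have key: "min (emeasure lborel (I \<inter> K)) (ennreal s) \<le> emeasure lborel E"
    proof (cases "\<forall>y\<in>I. y < z")
      case True
      have "min (emeasure lborel (I \<inter> K)) (ennreal s) \<le> emeasure lborel {y \<in> I \<inter> K. y + s \<notin> I}"
        by (rule interval_end_right[where z=z]) (use I K z True s in auto)
      also have "\<dots> \<le> emeasure lborel E"
        by (rule emeasure_mono) (use Emeas in \<open>auto simp: E_def\<close>)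
      finally show ?thesis .
    next
      case False
      have "\<forall>y\<in>I. z < y"
      proof (rule ccontr)
        assume "\<not> (\<forall>y\<in>I. z < y)"
        then obtain y where y: "y \<in> I" "y \<le> z" by force
        from False obtain y' where y': "y' \<in> I" "z \<le> y'" by force
        have "z \<in> I"
          by (rule connectedD_interval[OF convex_connected[OF I(1)] y(1) y'(1)]) (use y y' in auto)
        with z show False by simp
      qed
      then have "min (emeasure lborel (I \<inter> K)) (ennreal s) \<le> emeasure lborel {y \<in> I \<inter> K. y - s \<notin> I}"
        by (intro interval_end_left[where z=z]) (use I K z s in auto)
      also have "\<dots> \<le> emeasure lborel E"
        by (rule emeasure_mono) (use Emeas in \<open>auto simp: E_def\<close>)
      finally show ?thesis .
    qed
    have bs: "1 \<le> ennreal (b / s)" using s by (simp add: ennreal_ge_1)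
    have "emeasure lborel (I \<inter> S) \<le> ennreal (b / s) * min (emeasure lborel (I \<inter> K)) (ennreal s)"
    proof (cases "emeasure lborel (I \<inter> K) \<le> ennreal s")
      case True
      have "emeasure lborel (I \<inter> S) \<le> 1 * emeasure lborel (I \<inter> K)" using leJ by simp
      also have "\<dots> \<le> ennreal (b / s) * emeasure lborel (I \<inter> K)" by (intro mult_right_mono bs) auto
      finally show ?thesis using True by (simp add: min_def)
    next
      case False
      have "ennreal b = ennreal (b / s) * ennreal s"
        using s b0 by (simp add: ennreal_mult[symmetric])
      then show ?thesis using False leb by (simp add: min_def)
    qed
    also have "\<dots> \<le> ennreal (b / s) * emeasure lborel E" by (intro mult_left_mono key) auto
    finally show ?thesis by (simp add: E_def add_increasing2)
  qed
qed

section \<open>Cluster points of averaged push-forwards\<close>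

text \<open>Tychonoff's theorem for the product of copies of [0,1] over all sets. Such a product may
  be too large for convergent subsequences, so the limit is described by the one property used
  later: closed conditions that hold eventually are inherited.\<close>

lemma cluster_set_function:
  fixes a :: "nat \<Rightarrow> 'a set \<Rightarrow> real"
  assumes "\<And>n A. 0 \<le> a n A" "\<And>n A. a n A \<le> 1"
  obtains f :: "'a set \<Rightarrow> real" where
    "\<And>P N. closed P \<Longrightarrow> (\<And>n. n \<ge> N \<Longrightarrow> a n \<in> P) \<Longrightarrow> f \<in> P"
proof -
  define K :: "('a set \<Rightarrow> real) set" where "K = (\<Pi>\<^sub>E A\<in>UNIV. {0..1})"
  have "compactin (product_topology (\<lambda>_. euclidean) UNIV) K"
    unfolding K_def compactin_PiE by (auto simp: compactin_euclidean_iff)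
  then have K: "compact K"
    by (simp add: euclidean_product_topology compactin_euclidean_iff)
  define F where "F N = closure (a ` {N..})" for N
  have aK: "a n \<in> K" for n using assms by (auto simp: K_def)
  have "K \<inter> \<Inter> (range F) \<noteq> {}"
  proof (rule compact_imp_fip[OF K])
    show "closed T" if "T \<in> range F" for T using that by (auto simp: F_def)
    fix F' assume F': "finite F'" "F' \<subseteq> range F"
    then obtain I where I: "finite I" "F' = F ` I" by (meson finite_subset_image)
    obtain N where N: "\<And>i. i \<in> I \<Longrightarrow> i \<le> N" using I(1) by (meson finite_nat_set_iff_bounded_le)
    have "a N \<in> K \<inter> \<Inter> F'"
      using aK N closure_subset by (fastforce simp: I F_def)
    then show "K \<inter> \<Inter> F' \<noteq> {}" by blast
  qed
  then obtain f where f: "\<And>N. f \<in> F N" by blast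
  show ?thesis
  proof (rule that[of f])
    fix P :: "('a set \<Rightarrow> real) set" and N assume P: "closed P" "\<And>n. n \<ge> N \<Longrightarrow> a n \<in> P"
    have "F N \<subseteq> P" unfolding F_def by (rule closure_minimal) (use P in auto)
    then show "f \<in> P" using f by auto
  qed
qed

text \<open>Finite additivity and invariance are closed conditions on set functions, so a cluster
  point of the Cesaro averages inherits them; uniform absolute continuity upgrades it to a measure.
  Working setwise rather than with weak limits lets a merely measurable \<open>T\<close> pass to the
  limit.\<close>

lemma acim_of_uniformly_ac:
  fixes M :: "'a measure" and \<nu> :: "nat \<Rightarrow> 'a measure"
  assumes fin: "finite_measure M" and T: "T \<in> measurable M M"
    and sets: "\<And>n. sets (\<nu> n) = sets M" and prob: "\<And>n. prob_space (\<nu> n)"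
    and step: "\<And>n. \<nu> (Suc n) = distr (\<nu> n) M T"
    and uac: "\<And>e. e > 0 \<Longrightarrow> \<exists>d>0. \<forall>n. \<forall>A\<in>sets M. measure M A < d \<longrightarrow> measure (\<nu> n) A \<le> e"
  shows "\<exists>\<mu>. sets \<mu> = sets M \<and> prob_space \<mu> \<and> absolutely_continuous M \<mu> \<and>
     T \<in> measurable \<mu> \<mu> \<and> distr \<mu> \<mu> T = \<mu>"
proof -
  interpret M: finite_measure M by fact
  have space: "space (\<nu> n) = space M" for n using sets_eq_imp_space_eq[OF sets] .
  define a where "a n A = (\<Sum>k\<le>n. measure (\<nu> k) A) / (real n + 1)" for n A
  have m1: "measure (\<nu> k) A \<le> 1" for k A using prob_space.prob_le_1[OF prob] .
  have a0: "0 \<le> a n A" for n A by (auto simp: a_def intro!: sum_nonneg divide_nonneg_pos)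
  have a1: "a n A \<le> 1" for n A
  proof -
    have "(\<Sum>k\<le>n. measure (\<nu> k) A) \<le> (\<Sum>k\<le>n. 1)" by (intro sum_mono m1)
    then show ?thesis by (simp add: a_def field_simps)
  qed
  obtain f where f: "\<And>P N. closed P \<Longrightarrow> (\<And>n. n \<ge> N \<Longrightarrow> a n \<in> P) \<Longrightarrow> f \<in> P"
    using cluster_set_function[of a] a0 a1 by blast
  have co: "continuous_on UNIV (\<lambda>g::'a set \<Rightarrow> real. g A)" for A
    by (rule continuous_on_product_coordinates)
  have f0: "0 \<le> f A" for A
  proof -
    have "closed {g::'a set \<Rightarrow> real. 0 \<le> g A}" by (intro closed_Collect_le co continuous_on_const)
    from f[OF this, of 0] a0 show ?thesis by auto
  qed
  have fadd: "f (A \<union> B) = f A + f B" if "A \<in> sets M" "B \<in> sets M" "A \<inter> B = {}" for A B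
  proof -
    have "a n (A \<union> B) = a n A + a n B" for n
      using that by (simp add: a_def sets add_divide_distrib[symmetric] sum.distrib[symmetric]
          finite_measure.finite_measure_Union[OF prob_space.finite_measure[OF prob]])
    moreover have "closed {g::'a set \<Rightarrow> real. g (A \<union> B) = g A + g B}"
      by (intro closed_Collect_eq continuous_on_add co)
    ultimately show ?thesis using f[of _ 0] by blast
  qed
  have fsp: "f (space M) = 1"
  proof -
    have "a n (space M) = 1" for n
      using prob_space.prob_space[OF prob] by (simp add: a_def space)
    moreover have "closed {g::'a set \<Rightarrow> real. g (space M) = 1}"
      by (intro closed_Collect_eq continuous_on_const co)
    ultimately show ?thesis using f[of _ 0] by blast
  qed
  have fac: "\<exists>d>0. \<forall>A\<in>sets M. measure M A < d \<longrightarrow> f A \<le> e" if "e > 0" for e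
  proof -
    from uac[OF that] obtain d where d: "d > 0"
      "\<And>n A. A \<in> sets M \<Longrightarrow> measure M A < d \<Longrightarrow> measure (\<nu> n) A \<le> e" by blast
    have "f A \<le> e" if A: "A \<in> sets M" "measure M A < d" for A
    proof -
      have "a n A \<le> e" for n
      proof -
        have "(\<Sum>k\<le>n. measure (\<nu> k) A) \<le> (\<Sum>k\<le>n. e)" by (intro sum_mono d A)
        then show ?thesis by (simp add: a_def field_simps)
      qed
      moreover have "closed {g::'a set \<Rightarrow> real. g A \<le> e}"
        by (intro closed_Collect_le continuous_on_const co)
      ultimately show ?thesis using f[of _ 0] by blast
    qed
    then show ?thesis using d(1) by blast
  qed
  have finv: "f (T -` A \<inter> space M) = f A" if A: "A \<in> sets M" for A
  proof -
    have TA: "measure (\<nu> k) (T -` A \<inter> space M) = measure (\<nu> (Suc k)) A" for k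
      unfolding step[of k] by (subst measure_distr)
        (use A T space in \<open>auto simp: measurable_cong_sets[OF sets refl]\<close>)
    \<comment> \<open>The sums telescope; only the masses at times 0 and \<open>n + 1\<close>
      survive.\<close>
    have b: "\<bar>a n (T -` A \<inter> space M) - a n A\<bar> \<le> 1 / (real n + 1)" for n
    proof -
      have "(\<Sum>k\<le>n. measure (\<nu> (Suc k)) A) - (\<Sum>k\<le>n. measure (\<nu> k) A)
          = measure (\<nu> (Suc n)) A - measure (\<nu> 0) A"
        using sum_lessThan_telescope[of "\<lambda>k. measure (\<nu> k) A" "Suc n"]
        by (simp add: sum_subtractf lessThan_Suc_atMost del: sum.lessThan_Suc)
      moreover have "\<bar>measure (\<nu> (Suc n)) A - measure (\<nu> 0) A\<bar> \<le> 1"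
        using m1[of "Suc n" A] m1[of 0 A] by (smt (verit) measure_nonneg)
      ultimately show ?thesis
        by (simp add: a_def TA diff_divide_distrib[symmetric] divide_right_mono)
    qed
    have "\<bar>f (T -` A \<inter> space M) - f A\<bar> \<le> 1 / (real N + 1)" for N
    proof -
      have "closed {g::'a set \<Rightarrow> real. \<bar>g (T -` A \<inter> space M) - g A\<bar> \<le> 1 / (real N + 1)}"
        by (intro closed_Collect_le continuous_intros co)
      moreover have "\<bar>a n (T -` A \<inter> space M) - a n A\<bar> \<le> 1 / (real N + 1)" if "n \<ge> N" for n
        using b[of n] that by (smt (verit) frac_le of_nat_0_le_iff of_nat_mono)
      ultimately show ?thesis using f[of _ N] by blast
    qed
    moreover have "(\<lambda>N. 1 / (real N + 1)) \<longlonglongrightarrow> 0"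
      using LIMSEQ_inverse_real_of_nat by (simp add: inverse_eq_divide add.commute)
    ultimately have "\<bar>f (T -` A \<inter> space M) - f A\<bar> \<le> 0"
      by (meson LIMSEQ_le_const)
    then show ?thesis by simp
  qed
  have fmono: "f A \<le> f B" if "A \<subseteq> B" "A \<in> sets M" "B \<in> sets M" for A B
    using fadd[of A "B - A"] f0[of "B - A"] that by (auto simp: Un_absorb1 Un_absorb2 Un_Diff_cancel)
  have fe: "f {} = 0" using fadd[of "{}" "{}"] by simp
  have ca: "countably_additive (sets M) (\<lambda>A. ennreal (f A))"
  proof (rule sets.empty_continuous_imp_countably_additive)
    show "positive (sets M) (\<lambda>A. ennreal (f A))" by (simp add: positive_def fe)
    show "additive (sets M) (\<lambda>A. ennreal (f A))"
      by (auto simp: additive_def fadd f0 ennreal_plus[symmetric] simp del: ennreal_plus)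
    show "\<forall>A\<in>sets M. ennreal (f A) \<noteq> \<infinity>" by simp
    fix A :: "nat \<Rightarrow> 'a set" assume A: "range A \<subseteq> sets M" "decseq A" "(\<Inter>i. A i) = {}"
    have "(\<lambda>i. measure M (A i)) \<longlonglongrightarrow> measure M (\<Inter>i. A i)"
      by (rule M.finite_Lim_measure_decseq) (use A in auto)
    then have mA: "(\<lambda>i. measure M (A i)) \<longlonglongrightarrow> 0" using A by simp
    \<comment> \<open>Finite additivity becomes countable additivity here: \<open>M\<close> of a
      sequence decreasing to the empty set tends to 0, and absolute continuity carries this over to
      \<open>f\<close>.\<close>
    have "(\<lambda>i. f (A i)) \<longlonglongrightarrow> 0"
    proof (rule LIMSEQ_I)
      fix r :: real assume r: "0 < r"
      from fac[of "r/2"] r obtain d where d: "d > 0" "\<And>A. A \<in> sets M \<Longrightarrow> measure M A < d \<Longrightarrow> f A \<le> r/2"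
        by auto
      from LIMSEQ_D[OF mA d(1)] obtain N where N: "\<And>n. n \<ge> N \<Longrightarrow> measure M (A n) < d" by auto
      show "\<exists>no. \<forall>n\<ge>no. norm (f (A n) - 0) < r"
      proof (intro exI allI impI)
        fix n assume "n \<ge> N"
        then have "f (A n) \<le> r/2" using d(2)[of "A n"] N A by auto
        then show "norm (f (A n) - 0) < r" using f0[of "A n"] r by simp
      qed
    qed
    then show "(\<lambda>i. ennreal (f (A i))) \<longlonglongrightarrow> 0"
      using tendsto_ennrealI[of "\<lambda>i. f (A i)" 0] by simp
  qed
  define \<mu> where "\<mu> = measure_of (space M) (sets M) (\<lambda>A. ennreal (f A))"
  have s\<mu>: "sets \<mu> = sets M" "space \<mu> = space M" by (simp_all add: \<mu>_def)
  have e\<mu>: "emeasure \<mu> A = ennreal (f A)" if "A \<in> sets M" for A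
    unfolding \<mu>_def using that
    by (intro emeasure_measure_of_sigma sets.sigma_algebra_axioms ca)
      (simp_all add: positive_def fe)
  have "prob_space \<mu>"
    by (rule prob_spaceI) (simp add: s\<mu> e\<mu> fsp)
  moreover have "absolutely_continuous M \<mu>"
    unfolding absolutely_continuous_def
  proof
    fix N assume N: "N \<in> null_sets M"
    have "f N \<le> e" if "e > 0" for e
      using fac[OF that] N by (auto simp: null_sets_def measure_def)
    then have "f N \<le> 0" by (meson field_le_epsilon add_0 dense_ge)
    then show "N \<in> null_sets \<mu>" using N by (auto simp: null_sets_def s\<mu> e\<mu> ennreal_neg)
  qed
  moreover have T\<mu>: "T \<in> measurable \<mu> \<mu>"
    using T by (simp add: measurable_cong_sets[OF s\<mu>(1) s\<mu>(1)])
  moreover have "distr \<mu> \<mu> T = \<mu>"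
  proof (rule measure_eqI)
    fix A assume "A \<in> sets (distr \<mu> \<mu> T)"
    then have A: "A \<in> sets M" by (simp add: s\<mu>)
    have "T -` A \<inter> space M \<in> sets M" using T A by (rule measurable_sets)
    then show "emeasure (distr \<mu> \<mu> T) A = emeasure \<mu> A"
      by (simp add: emeasure_distr[OF T\<mu>] s\<mu> A e\<mu> finv)
  qed simp
  ultimately show ?thesis using s\<mu>(1) by blast
qed

section \<open>Traces in the plane\<close>

lemma borel_slice1: "A \<in> sets borel \<Longrightarrow> {x. (x, t) \<in> A} \<in> sets borel"
  for A :: "(real \<times> real) set"
proof -
  assume "A \<in> sets borel"
  then have "(\<lambda>x. (x, t)) -` A \<in> sets borel"
    by (intro measurable_sets_borel[where M=borel]) (auto intro!: borel_measurable_Pair)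
  then show ?thesis by (simp add: vimage_def)
qed

lemma convex_slice1: "convex A \<Longrightarrow> convex {x. (x, t) \<in> A}"
  for A :: "(real \<times> real) set"
proof (rule convexI)
  fix x y u v :: real
  assume A: "convex A" "x \<in> {x. (x, t) \<in> A}" "y \<in> {x. (x, t) \<in> A}" "0 \<le> u" "0 \<le> v" "u + v = 1"
  have "u *\<^sub>R (x, t) + v *\<^sub>R (y, t) \<in> A" by (rule convexD) (use A in auto)
  moreover have "u *\<^sub>R (x, t) + v *\<^sub>R (y, t) = (u *\<^sub>R x + v *\<^sub>R y, t)"
    using A by (simp add: distrib_right[symmetric])
  ultimately show "u *\<^sub>R x + v *\<^sub>R y \<in> {x. (x, t) \<in> A}" by simp
qed

lemma translate_borel: "A \<in> sets borel \<Longrightarrow> {y. y + v \<in> A} \<in> sets borel"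
  for A :: "(real \<times> real) set"
proof -
  assume "A \<in> sets borel"
  then have "(\<lambda>x. x + v) -` A \<in> sets borel"
    by (intro measurable_sets_borel[where M=borel]) auto
  then show ?thesis by (simp add: vimage_def)
qed

lemma borel_escape:
  fixes W D :: "(real \<times> real) set"
  assumes "W \<in> sets borel" "D \<in> sets borel"
  shows "{y \<in> W \<inter> D. y + v \<notin> W \<or> y - v \<notin> W} \<in> sets borel"
proof -
  have "{y \<in> W \<inter> D. y + v \<notin> W \<or> y - v \<notin> W}
      = W \<inter> D - ({y. y + v \<in> W} \<inter> {y. y + (- v) \<in> W})" by auto
  then show ?thesis using assms by (auto simp del: add_uminus_conv_diff intro!: translate_borel sets.Diff)
qed

lemma nn_integral_lborel_pair:
  fixes f :: "real \<times> real \<Rightarrow> ennreal"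
  assumes "f \<in> borel_measurable borel"
  shows "(\<integral>\<^sup>+y. f y \<partial>lborel) = (\<integral>\<^sup>+t. (\<integral>\<^sup>+x. f (x, t) \<partial>lborel) \<partial>lborel)"
  using lborel_pair.nn_integral_snd[of f] assms by (simp add: lborel_prod case_prod_beta' split_beta')

text \<open>This is \<open>interval_trace\<close> on every horizontal line, divided by
  \<open>b t\<close> and integrated by Fubini. The division lets the width \<open>b\<close> vary
  with the height while the escape term keeps the constant weight \<open>1 / s\<close>. The chord
  length of \<open>D\<close> enters only through a majorant \<open>h\<close> of its reciprocal,
  which may depend on the point.\<close>

lemma plane_trace:
  fixes W D S :: "(real \<times> real) set" and b l :: "real \<Rightarrow> real" and h :: "real \<times> real \<Rightarrow> real"
  assumes W: "convex W" "W \<in> sets borel" and D: "\<And>t. convex {x. (x, t) \<in> D}" "D \<in> sets borel"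
    and S: "S \<subseteq> D" "S \<in> sets borel" "\<And>t. emeasure lborel {x. (x, t) \<in> S} \<le> ennreal (b t)"
    and s: "0 < s" "\<And>t. s \<le> b t" and [measurable]: "b \<in> borel_measurable borel" "h \<in> borel_measurable borel"
    and l: "\<And>x t. (x, t) \<in> D \<Longrightarrow> 0 < l t \<and> ennreal (l t) \<le> emeasure lborel {x. (x, t) \<in> D} \<and> 1 / l t \<le> h (x, t)"
  shows "(\<integral>\<^sup>+y. indicator (W \<inter> S) y * ennreal (1 / b (snd y)) \<partial>lborel) \<le>
      ennreal (1 / s) * emeasure lborel {y \<in> W \<inter> D. y + (s, 0) \<notin> W \<or> y - (s, 0) \<notin> W}
      + (\<integral>\<^sup>+y. indicator (W \<inter> D) y * ennreal (h y) \<partial>lborel)"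
proof -
  define E where "E = {y \<in> W \<inter> D. y + (s, 0) \<notin> W \<or> y - (s, 0) \<notin> W}"
  have E[measurable]: "E \<in> sets borel" unfolding E_def by (rule borel_escape) fact+
  note W(2)[measurable] D(2)[measurable] S(2)[measurable]
  have snd_m[measurable]: "(snd :: real \<times> real \<Rightarrow> real) \<in> borel_measurable borel"
    by (intro borel_measurable_continuous_onI continuous_on_snd continuous_on_id)
  have pw: "(\<integral>\<^sup>+x. indicator (W \<inter> S) (x, t) * ennreal (1 / b t) \<partial>lborel) \<le>
      ennreal (1 / s) * (\<integral>\<^sup>+x. indicator E (x, t) \<partial>lborel)
      + (\<integral>\<^sup>+x. indicator (W \<inter> D) (x, t) * ennreal (h (x, t)) \<partial>lborel)" for t
  proof (cases "\<exists>x. (x, t) \<in> W \<inter> D")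
    case False
    then have "indicator (W \<inter> S) (x, t) = (0::ennreal)" for x
      using S(1) by (auto simp: indicator_def)
    then show ?thesis by simp
  next
    case True
    then obtain x0 where x0: "(x0, t) \<in> D" by auto
    define I where "I = {x. (x, t) \<in> W}"
    define K where "K = {x. (x, t) \<in> D}"
    define R where "R = {x. (x, t) \<in> S}"
    have meas: "I \<in> sets borel" "K \<in> sets borel" "R \<in> sets borel"
      using W D S by (auto simp: I_def K_def R_def intro!: borel_slice1)
    have b0: "0 < b t" using s(1) s(2)[of t] by simp
    have lt: "0 < l t" "ennreal (l t) \<le> emeasure lborel K" using l[OF x0] by (auto simp: K_def)
    have 1: "emeasure lborel (I \<inter> R) \<le>
      ennreal (b t / s) * emeasure lborel {y \<in> I \<inter> K. y + s \<notin> I \<or> y - s \<notin> I}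
      + ennreal (b t / l t) * emeasure lborel (I \<inter> K)"
      by (rule interval_trace) (use W D S s meas lt in \<open>auto simp: I_def K_def R_def convex_slice1\<close>)
    have Eslice: "{y \<in> I \<inter> K. y + s \<notin> I \<or> y - s \<notin> I} = {x. (x, t) \<in> E}"
      by (auto simp: I_def K_def E_def)
    have "(\<integral>\<^sup>+x. indicator (W \<inter> S) (x, t) * ennreal (1 / b t) \<partial>lborel)
        = (\<integral>\<^sup>+x. ennreal (1 / b t) * indicator (I \<inter> R) x \<partial>lborel)"
      by (intro nn_integral_cong) (auto simp: I_def R_def indicator_def)
    also have "\<dots> = ennreal (1 / b t) * emeasure lborel (I \<inter> R)"
      by (rule nn_integral_cmult_indicator) (use meas in auto)
    also have "\<dots> \<le> ennreal (1 / b t) * (ennreal (b t / s) * emeasure lborel {x. (x, t) \<in> E}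
      + ennreal (b t / l t) * emeasure lborel (I \<inter> K))"
      using 1 unfolding Eslice by (intro mult_left_mono) auto
    also have "\<dots> = ennreal (1 / s) * emeasure lborel {x. (x, t) \<in> E}
      + ennreal (1 / l t) * emeasure lborel (I \<inter> K)"
      using b0 s lt by (simp add: distrib_left mult.assoc[symmetric] ennreal_mult[symmetric])
    also have "\<dots> \<le> ennreal (1 / s) * (\<integral>\<^sup>+x. indicator E (x, t) \<partial>lborel)
      + (\<integral>\<^sup>+x. indicator (W \<inter> D) (x, t) * ennreal (h (x, t)) \<partial>lborel)"
    proof (rule add_mono)
      have "(\<integral>\<^sup>+x. indicator E (x, t) \<partial>lborel) = (\<integral>\<^sup>+x. indicator {x. (x, t) \<in> E} x \<partial>lborel)"
        by (intro nn_integral_cong) (auto simp: indicator_def)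
      also have "\<dots> = emeasure lborel {x. (x, t) \<in> E}"
        using borel_slice1[OF E] by simp
      finally show "ennreal (1 / s) * emeasure lborel {x. (x, t) \<in> E} \<le> ennreal (1 / s) * (\<integral>\<^sup>+x. indicator E (x, t) \<partial>lborel)"
        by simp
      have "ennreal (1 / l t) * emeasure lborel (I \<inter> K) = (\<integral>\<^sup>+x. ennreal (1 / l t) * indicator (I \<inter> K) x \<partial>lborel)"
        by (rule nn_integral_cmult_indicator[symmetric]) (use meas in auto)
      also have "\<dots> \<le> (\<integral>\<^sup>+x. indicator (W \<inter> D) (x, t) * ennreal (h (x, t)) \<partial>lborel)"
        using l by (intro nn_integral_mono) (auto simp: I_def K_def indicator_def ennreal_leI)
      finally show "ennreal (1 / l t) * emeasure lborel (I \<inter> K) \<le> (\<integral>\<^sup>+x. indicator (W \<inter> D) (x, t) * ennreal (h (x, t)) \<partial>lborel)" .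
    qed
    finally show ?thesis .
  qed
  have mE: "(\<lambda>y. indicator E y :: ennreal) \<in> borel_measurable borel" by simp
  have mh: "(\<lambda>y. indicator (W \<inter> D) y * ennreal (h y)) \<in> borel_measurable borel" by simp
  have "(\<integral>\<^sup>+y. indicator (W \<inter> S) y * ennreal (1 / b (snd y)) \<partial>lborel)
      = (\<integral>\<^sup>+t. (\<integral>\<^sup>+x. indicator (W \<inter> S) (x, t) * ennreal (1 / b t) \<partial>lborel) \<partial>lborel)"
    by (subst nn_integral_lborel_pair) simp_all
  also have "\<dots> \<le> (\<integral>\<^sup>+t. ennreal (1 / s) * (\<integral>\<^sup>+x. indicator E (x, t) \<partial>lborel)
      + (\<integral>\<^sup>+x. indicator (W \<inter> D) (x, t) * ennreal (h (x, t)) \<partial>lborel) \<partial>lborel)"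
    by (intro nn_integral_mono pw)
  also have "\<dots> = ennreal (1 / s) * (\<integral>\<^sup>+t. (\<integral>\<^sup>+x. indicator E (x, t) \<partial>lborel) \<partial>lborel)
      + (\<integral>\<^sup>+t. (\<integral>\<^sup>+x. indicator (W \<inter> D) (x, t) * ennreal (h (x, t)) \<partial>lborel) \<partial>lborel)"
  proof -
    have pm: "(\<lambda>t. \<integral>\<^sup>+x. f (x, t) \<partial>lborel) \<in> borel_measurable lborel"
      if "f \<in> borel_measurable borel" for f :: "real \<times> real \<Rightarrow> ennreal"
    proof -
      have "f \<in> borel_measurable (lborel \<Otimes>\<^sub>M lborel)" using that by (simp add: lborel_prod)
      then show ?thesis by measurable
    qed
    show ?thesis
      by (subst nn_integral_add) (use pm[OF mE] pm[OF mh] in \<open>auto simp: nn_integral_cmult\<close>)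
  qed
  also have "\<dots> = ennreal (1 / s) * (\<integral>\<^sup>+y. indicator E y \<partial>lborel)
      + (\<integral>\<^sup>+y. indicator (W \<inter> D) y * ennreal (h y) \<partial>lborel)"
    by (simp only: nn_integral_lborel_pair[OF mE] nn_integral_lborel_pair[OF mh])
  also have "(\<integral>\<^sup>+y. indicator E y \<partial>lborel) = emeasure lborel E" by simp
  finally show ?thesis unfolding E_def .
qed

section \<open>Vertical traces by exchange of the coordinates\<close>

lemma nn_integral_lborel_swap:
  fixes f :: "real \<times> real \<Rightarrow> ennreal"
  assumes "f \<in> borel_measurable borel"
  shows "(\<integral>\<^sup>+y. f (prod.swap y) \<partial>lborel) = (\<integral>\<^sup>+y. f y \<partial>lborel)"
proof -
  have "(\<integral>\<^sup>+y. f y \<partial>(lborel \<Otimes>\<^sub>M lborel))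
      = (\<integral>\<^sup>+y. f y \<partial>(distr (lborel \<Otimes>\<^sub>M lborel) (lborel \<Otimes>\<^sub>M lborel) (\<lambda>(x, y). (y, x))))"
    using lborel_pair.distr_pair_swap by metis
  also have "\<dots> = (\<integral>\<^sup>+y. f (case y of (x, y) \<Rightarrow> (y, x)) \<partial>(lborel \<Otimes>\<^sub>M lborel))"
    by (rule nn_integral_distr[OF measurable_pair_swap']) (use assms in \<open>simp add: lborel_prod\<close>)
  finally show ?thesis by (simp add: lborel_prod case_prod_beta' prod.swap_def)
qed

lemma swap_borel: "A \<in> sets borel \<Longrightarrow> prod.swap -` A \<in> sets borel"
  for A :: "(real \<times> real) set"
proof -
  assume A: "A \<in> sets borel"
  have "continuous_on UNIV (prod.swap :: real \<times> real \<Rightarrow> real \<times> real)"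
    by (rule continuous_on_swap)
  then show ?thesis
    by (intro measurable_sets_borel[where M=borel] A borel_measurable_continuous_onI)
qed

lemma emeasure_swap:
  fixes A :: "(real \<times> real) set"
  assumes "A \<in> sets borel"
  shows "emeasure lborel (prod.swap -` A) = emeasure lborel A"
proof -
  have "(\<integral>\<^sup>+y. indicator A (prod.swap y) \<partial>lborel) = (\<integral>\<^sup>+y. indicator A y \<partial>lborel)"
    by (rule nn_integral_lborel_swap) (use assms in simp)
  moreover have "(\<integral>\<^sup>+y. indicator A (prod.swap y) \<partial>lborel) = (\<integral>\<^sup>+y. indicator (prod.swap -` A) y \<partial>lborel)"
    by (intro nn_integral_cong) (auto simp: indicator_def)
  ultimately show ?thesis using assms swap_borel[OF assms] by simp
qed

lemma convex_swap: "convex A \<Longrightarrow> convex (prod.swap -` A)"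
  for A :: "(real \<times> real) set"
  by (rule convex_linear_vimage) (auto simp: linear_iff)

lemma plane_trace_swap:
  fixes W D S :: "(real \<times> real) set" and b l :: "real \<Rightarrow> real" and h :: "real \<times> real \<Rightarrow> real"
  assumes W: "convex W" "W \<in> sets borel" and D: "\<And>t. convex {x. (t, x) \<in> D}" "D \<in> sets borel"
    and S: "S \<subseteq> D" "S \<in> sets borel" "\<And>t. emeasure lborel {x. (t, x) \<in> S} \<le> ennreal (b t)"
    and s: "0 < s" "\<And>t. s \<le> b t" and m: "b \<in> borel_measurable borel" "h \<in> borel_measurable borel"
    and l: "\<And>x t. (t, x) \<in> D \<Longrightarrow> 0 < l t \<and> ennreal (l t) \<le> emeasure lborel {x. (t, x) \<in> D} \<and> 1 / l t \<le> h (t, x)"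
  shows "(\<integral>\<^sup>+y. indicator (W \<inter> S) y * ennreal (1 / b (fst y)) \<partial>lborel) \<le>
      ennreal (1 / s) * emeasure lborel {y \<in> W \<inter> D. y + (0, s) \<notin> W \<or> y - (0, s) \<notin> W}
      + (\<integral>\<^sup>+y. indicator (W \<inter> D) y * ennreal (h y) \<partial>lborel)"
proof -
  note [measurable] = m W(2) D(2) S(2)
  have fst_m[measurable]: "(fst :: real \<times> real \<Rightarrow> real) \<in> borel_measurable borel"
    by (intro borel_measurable_continuous_onI continuous_on_fst continuous_on_id)
  have sw_m[measurable]: "(prod.swap :: real \<times> real \<Rightarrow> real \<times> real) \<in> borel_measurable borel"
    by (intro borel_measurable_continuous_onI continuous_on_swap)
  let ?s = "prod.swap :: real \<times> real \<Rightarrow> real \<times> real"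
  have "(\<integral>\<^sup>+y. indicator (?s -` W \<inter> ?s -` S) y * ennreal (1 / b (snd y)) \<partial>lborel) \<le>
      ennreal (1 / s) * emeasure lborel {y \<in> ?s -` W \<inter> ?s -` D. y + (s, 0) \<notin> ?s -` W \<or> y - (s, 0) \<notin> ?s -` W}
      + (\<integral>\<^sup>+y. indicator (?s -` W \<inter> ?s -` D) y * ennreal ((h \<circ> ?s) y) \<partial>lborel)"
    by (rule plane_trace[where l=l]) (use assms in \<open>auto simp: convex_swap swap_borel\<close>)
  moreover have "{y \<in> ?s -` W \<inter> ?s -` D. y + (s, 0) \<notin> ?s -` W \<or> y - (s, 0) \<notin> ?s -` W}
      = ?s -` {y \<in> W \<inter> D. y + (0, s) \<notin> W \<or> y - (0, s) \<notin> W}"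
    by (auto simp: prod.swap_def)
  moreover have "(\<integral>\<^sup>+y. indicator (?s -` W \<inter> ?s -` S) y * ennreal (1 / b (snd y)) \<partial>lborel)
     = (\<integral>\<^sup>+y. indicator (W \<inter> S) y * ennreal (1 / b (fst y)) \<partial>lborel)"
    by (subst nn_integral_lborel_swap[symmetric]) (auto simp: indicator_def intro!: nn_integral_cong)
  moreover have "(\<integral>\<^sup>+y. indicator (?s -` W \<inter> ?s -` D) y * ennreal ((h \<circ> ?s) y) \<partial>lborel)
     = (\<integral>\<^sup>+y. indicator (W \<inter> D) y * ennreal (h y) \<partial>lborel)"
    by (subst nn_integral_lborel_swap[symmetric]) (auto simp: indicator_def intro!: nn_integral_cong)
  moreover have "emeasure lborel (?s -` {y \<in> W \<inter> D. y + (0, s) \<notin> W \<or> y - (0, s) \<notin> W})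
      = emeasure lborel {y \<in> W \<inter> D. y + (0, s) \<notin> W \<or> y - (0, s) \<notin> W}"
    by (intro emeasure_swap borel_escape W D)
  ultimately show ?thesis by simp
qed

section \<open>A Hardy inequality and chords of polygons\<close>

text \<open>The maximum distance is convenient because its balls have axis-parallel slices of
  constant length, and because on each of two complementary double cones it depends on one
  coordinate only.\<close>

definition supd :: "real \<times> real \<Rightarrow> real \<times> real \<Rightarrow> real" where
  "supd p q = max \<bar>fst p - fst q\<bar> \<bar>snd p - snd q\<bar>"

lemma borel_fst_snd [measurable]:
  "(fst :: real \<times> real \<Rightarrow> real) \<in> borel_measurable borel"
  "(snd :: real \<times> real \<Rightarrow> real) \<in> borel_measurable borel"
  by (intro borel_measurable_continuous_onI continuous_on_fst continuous_on_snd continuous_on_id)+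

lemma supd_measurable [measurable]: "(\<lambda>y. supd y p) \<in> borel_measurable borel"
  unfolding supd_def by measurable

lemma supd_nonneg: "0 \<le> supd p q" by (simp add: supd_def le_max_iff_disj)

text \<open>An inner boundary layer of \<open>W\<close> tested along the axes only. Being defined
  through finitely many vectors, it can be pulled back through an affine branch vector by
  vector.\<close>

definition escape :: "(real \<times> real) set \<Rightarrow> real \<Rightarrow> (real \<times> real) set" where
  "escape W s = {y \<in> W. \<exists>v \<in> {(s, 0), (-s, 0), (0, s), (0, -s)}. y + v \<notin> W}"

lemma escape_borel: "W \<in> sets borel \<Longrightarrow> escape W s \<in> sets borel"
proof -
  assume W: "W \<in> sets borel"
  have "escape W s = {y \<in> W \<inter> UNIV. y + (s, 0) \<notin> W \<or> y - (s, 0) \<notin> W}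
      \<union> {y \<in> W \<inter> UNIV. y + (0, s) \<notin> W \<or> y - (0, s) \<notin> W}"
    by (auto simp: escape_def minus_prod_def plus_prod_def)
  then show ?thesis using borel_escape[OF W, of UNIV] by simp
qed

definition supball :: "real \<times> real \<Rightarrow> real \<Rightarrow> (real \<times> real) set" where
  "supball p \<rho> = {y. supd y p < \<rho>}"

lemma supball_borel [measurable]: "supball p \<rho> \<in> sets borel"
proof -
  have "supball p \<rho> = (\<lambda>y. supd y p) -` {..<\<rho>}" by (auto simp: supball_def)
  then show ?thesis using supd_measurable[of p] by (auto intro!: measurable_sets_borel[where M=borel])
qed

text \<open>A two-dimensional Hardy inequality: the kernel is the divergence of a bounded vector field
  which is horizontal on one double cone and vertical on the complementary one.\<close>
lemma hardy_convex:
  assumes W: "convex W" "W \<in> sets borel" and s: "0 < s" and \<rho>: "0 < \<rho>"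
  shows "(\<integral>\<^sup>+y. indicator (W \<inter> supball p \<rho>) y * ennreal (1 / max (supd y p) s) \<partial>lborel)
    \<le> ennreal (4 / s) * emeasure lborel (escape W s \<inter> supball p \<rho>)
      + ennreal (2 / \<rho>) * emeasure lborel (W \<inter> supball p \<rho>)"
proof -
  note [measurable] = W(2)
  obtain p1 p2 where p: "p = (p1, p2)" by (cases p)
  let ?B = "supball p \<rho>"
  have iv: "(x, t) \<in> ?B \<longleftrightarrow> x \<in> {p1 - \<rho><..<p1 + \<rho>} \<and> t \<in> {p2 - \<rho><..<p2 + \<rho>}" for x t
    by (auto simp: supball_def supd_def p abs_less_iff)
  define S1 where "S1 = {y \<in> ?B. \<bar>fst y - p1\<bar> \<le> \<bar>snd y - p2\<bar>}"
  define S2 where "S2 = {y \<in> ?B. \<bar>snd y - p2\<bar> \<le> \<bar>fst y - p1\<bar>}"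
  have S[measurable]: "S1 \<in> sets borel" "S2 \<in> sets borel"
    unfolding S1_def S2_def by measurable
  \<comment> \<open>The horizontal slice of the cone \<open>S1\<close> at height \<open>t\<close>
    has length at most twice the height difference to \<open>p2\<close>, and on \<open>S1\<close>
    the weight \<open>1 / b1\<close> is exactly half of the kernel. The truncation at
    \<open>s\<close> keeps the width above the shift.\<close>
  define b1 where "b1 t = 2 * max \<bar>t - p2\<bar> s" for t
  define b2 where "b2 t = 2 * max \<bar>t - p1\<bar> s" for t
  have bm[measurable]: "b1 \<in> borel_measurable borel" "b2 \<in> borel_measurable borel"
    unfolding b1_def b2_def by measurable
  have sb: "s \<le> b1 t" "s \<le> b2 t" for t
  proof -
    have m: "s \<le> m \<Longrightarrow> s \<le> 2 * m" for m using s by simp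
    show "s \<le> b1 t" "s \<le> b2 t" unfolding b1_def b2_def by (rule m[OF max.cobounded2])+
  qed
  have sl: "emeasure lborel {c - \<bar>r\<bar>..c + \<bar>r\<bar>} = ennreal (2 * \<bar>r\<bar>)" for c r :: real
    by simp
  have p1: "(\<integral>\<^sup>+y. indicator (W \<inter> S1) y * ennreal (1 / b1 (snd y)) \<partial>lborel) \<le>
      ennreal (1 / s) * emeasure lborel {y \<in> W \<inter> ?B. y + (s, 0) \<notin> W \<or> y - (s, 0) \<notin> W}
      + (\<integral>\<^sup>+y. indicator (W \<inter> ?B) y * ennreal (1 / (2 * \<rho>)) \<partial>lborel)"
  proof (rule plane_trace[where l="\<lambda>_. 2 * \<rho>"])
    have "{x. (x, t) \<in> ?B} = (if t \<in> {p2 - \<rho><..<p2 + \<rho>} then {p1 - \<rho><..<p1 + \<rho>} else {})" for t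
      by (auto simp: iv)
    then show "convex {x. (x, t) \<in> ?B}" for t by simp
    show "emeasure lborel {x. (x, t) \<in> S1} \<le> ennreal (b1 t)" for t
    proof -
      have "{x. (x, t) \<in> S1} \<subseteq> {p1 - \<bar>t - p2\<bar>..p1 + \<bar>t - p2\<bar>}"
        by (auto simp: S1_def)
      then have "emeasure lborel {x. (x, t) \<in> S1} \<le> emeasure lborel {p1 - \<bar>t - p2\<bar>..p1 + \<bar>t - p2\<bar>}"
        by (intro emeasure_mono) auto
      also have "\<dots> \<le> ennreal (b1 t)" unfolding sl by (intro ennreal_leI) (auto simp: b1_def)
      finally show ?thesis .
    qed
    show "0 < 2 * \<rho> \<and> ennreal (2 * \<rho>) \<le> emeasure lborel {x. (x, t) \<in> ?B} \<and> 1 / (2 * \<rho>) \<le> 1 / (2 * \<rho>)"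
      if "(x, t) \<in> ?B" for x t
    proof -
      have "{x. (x, t) \<in> ?B} = {p1 - \<rho><..<p1 + \<rho>}" using that iv by auto
      then show ?thesis using \<rho> by simp
    qed
  qed (rule s S W sb bm supball_borel borel_measurable_const | (force simp: S1_def))+
  have p2: "(\<integral>\<^sup>+y. indicator (W \<inter> S2) y * ennreal (1 / b2 (fst y)) \<partial>lborel) \<le>
      ennreal (1 / s) * emeasure lborel {y \<in> W \<inter> ?B. y + (0, s) \<notin> W \<or> y - (0, s) \<notin> W}
      + (\<integral>\<^sup>+y. indicator (W \<inter> ?B) y * ennreal (1 / (2 * \<rho>)) \<partial>lborel)"
  proof (rule plane_trace_swap[where l="\<lambda>_. 2 * \<rho>"])
    have "{x. (t, x) \<in> ?B} = (if t \<in> {p1 - \<rho><..<p1 + \<rho>} then {p2 - \<rho><..<p2 + \<rho>} else {})" for t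
      by (auto simp: iv)
    then show "convex {x. (t, x) \<in> ?B}" for t by simp
    show "emeasure lborel {x. (t, x) \<in> S2} \<le> ennreal (b2 t)" for t
    proof -
      have "{x. (t, x) \<in> S2} \<subseteq> {p2 - \<bar>t - p1\<bar>..p2 + \<bar>t - p1\<bar>}"
        by (auto simp: S2_def)
      then have "emeasure lborel {x. (t, x) \<in> S2} \<le> emeasure lborel {p2 - \<bar>t - p1\<bar>..p2 + \<bar>t - p1\<bar>}"
        by (intro emeasure_mono) auto
      also have "\<dots> \<le> ennreal (b2 t)" unfolding sl by (intro ennreal_leI) (auto simp: b2_def)
      finally show ?thesis .
    qed
    show "0 < 2 * \<rho> \<and> ennreal (2 * \<rho>) \<le> emeasure lborel {x. (t, x) \<in> ?B} \<and> 1 / (2 * \<rho>) \<le> 1 / (2 * \<rho>)"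
      if "(t, x) \<in> ?B" for x t
    proof -
      have "{x. (t, x) \<in> ?B} = {p2 - \<rho><..<p2 + \<rho>}" using that iv by auto
      then show ?thesis using \<rho> by simp
    qed
  qed (rule s S W sb bm supball_borel borel_measurable_const | (force simp: S2_def))+
  have p3: "(\<integral>\<^sup>+y. indicator (W \<inter> ?B) y * ennreal (1 / max (supd y p) s) \<partial>lborel)
     \<le> (\<integral>\<^sup>+y. 2 * (indicator (W \<inter> S1) y * ennreal (1 / b1 (snd y)))
        + 2 * (indicator (W \<inter> S2) y * ennreal (1 / b2 (fst y))) \<partial>lborel)"
  proof (rule nn_integral_mono)
    fix y :: "real \<times> real"
    have e: "2 * ennreal (1 / (2 * c)) = ennreal (1 / c)" if "c > 0" for c
      using ennreal_mult[of 2 "1 / (2 * c)"] that by simp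
    show "indicator (W \<inter> ?B) y * ennreal (1 / max (supd y p) s) \<le>
       2 * (indicator (W \<inter> S1) y * ennreal (1 / b1 (snd y)))
        + 2 * (indicator (W \<inter> S2) y * ennreal (1 / b2 (fst y)))"
    proof (cases "y \<in> W \<inter> ?B")
      case True
      show ?thesis
      proof (cases "\<bar>fst y - p1\<bar> \<le> \<bar>snd y - p2\<bar>")
        case le: True
        then have "y \<in> W \<inter> S1" "supd y p = \<bar>snd y - p2\<bar>" using True by (auto simp: S1_def supd_def p)
        then show ?thesis using True s by (simp add: b1_def e add_increasing2)
      next
        case le: False
        then have "y \<in> W \<inter> S2" "supd y p = \<bar>fst y - p1\<bar>" using True by (auto simp: S2_def supd_def p)
        then show ?thesis using True s by (simp add: b2_def e add_increasing)
      qed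
    qed simp
  qed
  have p4: "(\<integral>\<^sup>+y. 2 * (indicator (W \<inter> S1) y * ennreal (1 / b1 (snd y)))
        + 2 * (indicator (W \<inter> S2) y * ennreal (1 / b2 (fst y))) \<partial>lborel) = 2 * (\<integral>\<^sup>+y. indicator (W \<inter> S1) y * ennreal (1 / b1 (snd y)) \<partial>lborel)
        + 2 * (\<integral>\<^sup>+y. indicator (W \<inter> S2) y * ennreal (1 / b2 (fst y)) \<partial>lborel)"
    by (subst nn_integral_add) (simp_all add: nn_integral_cmult)
  have p5: "emeasure lborel {y \<in> W \<inter> ?B. y + (s, 0) \<notin> W \<or> y - (s, 0) \<notin> W} \<le> emeasure lborel (escape W s \<inter> ?B)"
    by (rule emeasure_mono) (auto simp: escape_def escape_borel W)
  have p6: "emeasure lborel {y \<in> W \<inter> ?B. y + (0, s) \<notin> W \<or> y - (0, s) \<notin> W} \<le> emeasure lborel (escape W s \<inter> ?B)"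
    by (rule emeasure_mono) (auto simp: escape_def escape_borel W)
  have p7: "(\<integral>\<^sup>+y. indicator (W \<inter> ?B) y * ennreal (1 / (2 * \<rho>)) \<partial>lborel) = ennreal (1 / (2 * \<rho>)) * emeasure lborel (W \<inter> ?B)"
    by (subst mult.commute, rule nn_integral_cmult_indicator) simp
  \<comment> \<open>Each of the two cones contributes with a factor 2, so both constants are
    multiplied by 4.\<close>
  have comb: "X \<le> 4 * c * e + 4 * c' * w"
    if "X \<le> Y" "Y = 2 * A + 2 * B" "A \<le> c * e1 + c' * w" "B \<le> c * e2 + c' * w" "e1 \<le> e" "e2 \<le> e"
    for X Y A B c c' e e1 e2 w :: ennreal
  proof -
    have "A \<le> c * e + c' * w" "B \<le> c * e + c' * w"
      using that by (meson add_right_mono mult_left_mono order_trans zero_le)+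
    then have "2 * A + 2 * B \<le> 2 * (c * e + c' * w) + 2 * (c * e + c' * w)"
      by (intro add_mono mult_left_mono) auto
    also have "\<dots> = (2 + 2) * (c * e + c' * w)" by (simp only: distrib_right)
    also have "\<dots> = 4 * c * e + 4 * c' * w" by (simp add: distrib_left mult.assoc)
    finally show ?thesis using that by simp
  qed
  have "(\<integral>\<^sup>+y. indicator (W \<inter> ?B) y * ennreal (1 / max (supd y p) s) \<partial>lborel)
    \<le> 4 * ennreal (1 / s) * emeasure lborel (escape W s \<inter> ?B) + 4 * ennreal (1 / (2 * \<rho>)) * emeasure lborel (W \<inter> ?B)"
    by (rule comb[OF p3 p4 p1[unfolded p7] p2[unfolded p7] p5 p6])
  also have "4 * ennreal (1 / s) = ennreal (4 / s)" using ennreal_mult[of 4 "1 / s"] s by simp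
  also have "4 * ennreal (1 / (2 * \<rho>)) = ennreal (2 / \<rho>)" using ennreal_mult[of 4 "1 / (2 * \<rho>)"] \<rho> by simp
  finally show ?thesis .
qed

section \<open>Chord lengths of convex polygons and traces on thin sets\<close>

definition poly_set :: "(real \<times> real \<times> real) set \<Rightarrow> (real \<times> real) set" where
  "poly_set F = {y. \<forall>f\<in>F. fst f * fst y + fst (snd f) * snd y + snd (snd f) < 0}"

text \<open>The two lines are read as functions of the height \<open>t\<close>. If they cross at
  \<open>p\<close>, the gap is proportional to the height difference to \<open>p\<close>, and a
  point between the lines is within the gap of either line, so both coordinates of its offset from
  \<open>p\<close> are at most a multiple of the gap. Between parallel lines the gap is constant,
  which the minimum with 1 takes care of.\<close>

lemma affine_pair_gap:
  fixes \<alpha> \<beta> \<alpha>' \<beta>' :: real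
  shows "\<exists>c>0. \<exists>p. \<forall>x t. \<alpha>' * t + \<beta>' < x \<and> x < \<alpha> * t + \<beta> \<longrightarrow>
     c * min 1 (supd (x, t) p) \<le> (\<alpha> * t + \<beta>) - (\<alpha>' * t + \<beta>')"
proof (cases "\<alpha> = \<alpha>'")
  case True
  show ?thesis
  proof (cases "\<beta> - \<beta>' > 0")
    case pos: True
    show ?thesis
    proof (intro exI[of _ "\<beta> - \<beta>'"] conjI exI[of _ 0] allI impI)
      fix x t
      have "(\<beta> - \<beta>') * min 1 (supd (x, t) 0) \<le> (\<beta> - \<beta>') * 1"
        using pos by (intro mult_left_mono) auto
      then show "(\<beta> - \<beta>') * min 1 (supd (x, t) 0) \<le> \<alpha> * t + \<beta> - (\<alpha>' * t + \<beta>')"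
        using True by simp
    qed (use pos in auto)
  next
    case False
    then show ?thesis using True by (intro exI[of _ 1]) auto
  qed
next
  case False
  define d where "d = \<alpha> - \<alpha>'"
  have d0: "\<bar>d\<bar> > 0" using False by (simp add: d_def)
  define t0 where "t0 = (\<beta>' - \<beta>) / d"
  define p where "p = (\<alpha> * t0 + \<beta>, t0)"
  define K where "K = 1 + (\<bar>\<alpha>\<bar> + 1) / \<bar>d\<bar>"
  have K0: "K > 0" using d0 by (simp add: K_def add_pos_nonneg)
  show ?thesis
  proof (intro exI[of _ "1 / K"] conjI exI[of _ p] allI impI)
    show "0 < 1 / K" using K0 by simp
    fix x t assume H: "\<alpha>' * t + \<beta>' < x \<and> x < \<alpha> * t + \<beta>"
    define g where "g = (\<alpha> * t + \<beta>) - (\<alpha>' * t + \<beta>')"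
    have g0: "g > 0" using H by (simp add: g_def)
    have "g = d * (t - t0)" using d0 by (simp add: g_def t0_def d_def field_simps)
    then have tt: "\<bar>t - t0\<bar> = g / \<bar>d\<bar>" using d0 g0 by (metis abs_mult abs_of_pos nonzero_mult_div_cancel_left less_irrefl)
    have "\<bar>x - (\<alpha> * t0 + \<beta>)\<bar> \<le> g + \<bar>\<alpha> * (t - t0)\<bar>"
      using H by (simp add: g_def algebra_simps abs_if split: if_splits)
    also have "\<bar>\<alpha> * (t - t0)\<bar> = \<bar>\<alpha>\<bar> * (g / \<bar>d\<bar>)" by (simp only: abs_mult tt)
    also have "g + \<bar>\<alpha>\<bar> * (g / \<bar>d\<bar>) = g * (1 + \<bar>\<alpha>\<bar> / \<bar>d\<bar>)" by (simp add: algebra_simps)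
    also have "\<dots> \<le> g * K" using g0 d0 by (intro mult_left_mono) (auto simp: K_def divide_right_mono)
    finally have 1: "\<bar>x - (\<alpha> * t0 + \<beta>)\<bar> \<le> g * K" .
    have "\<bar>t - t0\<bar> = g * (1 / \<bar>d\<bar>)" by (simp add: tt)
    also have "\<dots> \<le> g * K" 
      using g0 d0 by (intro mult_left_mono) (auto simp: K_def add_divide_distrib add_nonneg_nonneg add_increasing)
    finally have 2: "\<bar>t - t0\<bar> \<le> g * K" .
    have "min 1 (supd (x, t) p) \<le> g * K" using 1 2 by (simp add: supd_def p_def min.coboundedI2)
    then have "1 / K * min 1 (supd (x, t) p) \<le> g" using K0 by (simp add: field_simps)
    then show "1 / K * min 1 (supd (x, t) p) \<le> \<alpha> * t + \<beta> - (\<alpha>' * t + \<beta>')"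
      unfolding g_def .
  qed
qed

lemma poly_set_borel: "finite F \<Longrightarrow> poly_set F \<in> sets borel"
proof -
  assume F: "finite F"
  have "poly_set F = (\<Inter>f\<in>F. {y. fst f * fst y + fst (snd f) * snd y + snd (snd f) < 0})"
    by (auto simp: poly_set_def)
  also have "\<dots> \<in> sets borel"
  proof (cases "F = {}")
    case False
    then show ?thesis using F by (intro sets.finite_INT) auto
  qed auto
  finally show ?thesis .
qed

lemma poly_set_slice_convex: "convex {x. (x, t) \<in> poly_set F}"
proof -
  have "{x. (x, t) \<in> poly_set F} = (\<Inter>f\<in>F. {x. fst f * x < - (fst (snd f) * t + snd (snd f))})"
  proof -
    have e: "(fst f * x < - (fst (snd f) * t + snd (snd f))) = (fst f * x + fst (snd f) * t + snd (snd f) < 0)" 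
      for f :: "real \<times> real \<times> real" and x by auto
    show ?thesis unfolding poly_set_def by (intro set_eqI) (simp only: mem_Collect_eq INT_iff fst_conv snd_conv e)
  qed
  also have "convex \<dots>"
  proof (intro convex_INT ballI)
    fix f assume "f \<in> F"
    have "is_interval {x. fst f * x < - (fst (snd f) * t + snd (snd f))}"
      using convex_halfspace_lt[of "fst f" "- (fst (snd f) * t + snd (snd f))"]
      by (simp add: is_interval_convex_1 inner_real_def mult.commute)
    then show "convex {x. fst f * x < - (fst (snd f) * t + snd (snd f))}"
      by (simp add: is_interval_convex_1)
  qed
  finally show ?thesis .
qed

text \<open>A chord runs between the innermost right and the innermost left side at its height, so
  the gap estimate for this pair of sides applies. \<open>V\<close> collects the points attached to
  all such pairs, whether or not they are vertices, and thus does not depend on the height. The two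
  bounding half-planes make both families of sides nonempty and the chord finite.\<close>

lemma poly_chord:
  assumes F: "finite F" and R: "(1, 0, r1) \<in> F" and L: "(-1, 0, r2) \<in> F"
  shows "\<exists>c>0. \<exists>V. finite V \<and> (\<forall>x t. (x, t) \<in> poly_set F \<longrightarrow>
     0 < measure lborel {x. (x, t) \<in> poly_set F} \<and>
     ennreal (measure lborel {x. (x, t) \<in> poly_set F}) = emeasure lborel {x. (x, t) \<in> poly_set F} \<and>
     (\<exists>p\<in>V. c * min 1 (supd (x, t) p) \<le> measure lborel {x. (x, t) \<in> poly_set F}))"
proof -
  define rr where "rr f t = (- fst (snd f) / fst f) * t + (- snd (snd f) / fst f)" for f :: "real \<times> real \<times> real" and t
  define Rs where "Rs = {f \<in> F. fst f > 0}"
  define Ls where "Ls = {f \<in> F. fst f < 0}"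
  have fin: "finite Rs" "finite Ls" "Rs \<noteq> {}" "Ls \<noteq> {}"
    using F R L by (force simp: Rs_def Ls_def)+
  have "\<forall>i j. \<exists>c p. c > 0 \<and> (\<forall>x t. rr j t < x \<and> x < rr i t \<longrightarrow> c * min 1 (supd (x, t) p) \<le> rr i t - rr j t)"
    unfolding rr_def using affine_pair_gap by meson
  then obtain cc pp where cp: "\<And>i j. cc i j > 0"
     "\<And>i j x t. rr j t < x \<Longrightarrow> x < rr i t \<Longrightarrow> cc i j * min 1 (supd (x, t) (pp i j)) \<le> rr i t - rr j t"
    by metis
  define V where "V = (\<lambda>(i, j). pp i j) ` (Rs \<times> Ls)"
  define c where "c = Min ((\<lambda>(i, j). cc i j) ` (Rs \<times> Ls))"
  have c: "c > 0" unfolding c_def using fin cp by (subst Min_gr_iff) auto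
  have cle: "c \<le> cc i j" if "i \<in> Rs" "j \<in> Ls" for i j
    unfolding c_def by (rule Min_le) (use fin that in force)+
  show ?thesis
  proof (intro exI[of _ c] exI[of _ V] conjI allI impI)
    show "c > 0" "finite V" using c fin by (auto simp: V_def)
    fix x t assume y: "(x, t) \<in> poly_set F"
    define K where "K = {x. (x, t) \<in> poly_set F}"
    have rs: "x' < rr i t \<longleftrightarrow> fst i * x' + fst (snd i) * t + snd (snd i) < 0" if "i \<in> Rs" for i x'
      using that by (auto simp: Rs_def rr_def field_simps)
    have ls: "rr i t < x' \<longleftrightarrow> fst i * x' + fst (snd i) * t + snd (snd i) < 0" if "i \<in> Ls" for i x'
      using that by (auto simp: Ls_def rr_def field_simps)
    obtain i where i: "i \<in> Rs" "\<And>k. k \<in> Rs \<Longrightarrow> rr i t \<le> rr k t"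
      using ex_min_if_finite[of "(\<lambda>k. rr k t) ` Rs"] fin by (metis arg_min_if_finite(1) arg_min_least)
    obtain j where j: "j \<in> Ls" "\<And>k. k \<in> Ls \<Longrightarrow> rr k t \<le> rr j t"
      using fin arg_min_if_finite(1)[of Ls "\<lambda>k. - rr k t"] arg_min_least[of Ls _ "\<lambda>k. - rr k t"]
      by (metis neg_le_iff_le)
    have xi: "x < rr i t" using rs[OF i(1)] i(1) y by (auto simp: poly_set_def Rs_def)
    have xj: "rr j t < x" using ls[OF j(1)] j(1) y by (auto simp: poly_set_def Ls_def)
    have sub: "{rr j t<..<rr i t} \<subseteq> K"
    proof
      fix x' assume x': "x' \<in> {rr j t<..<rr i t}"
      have "fst f * x' + fst (snd f) * t + snd (snd f) < 0" if f: "f \<in> F" for f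
      proof -
        consider "f \<in> Rs" | "f \<in> Ls" | "fst f = 0" using f by (force simp: Rs_def Ls_def)
        then show ?thesis
        proof cases
          case 1 then show ?thesis using rs[OF 1, of x'] i(2)[OF 1] x' by auto
        next
          case 2 then show ?thesis using ls[OF 2, of x'] j(2)[OF 2] x' by auto
        next
          case 3 then show ?thesis using y f by (auto simp: poly_set_def)
        qed
      qed
      then show "x' \<in> K" by (auto simp: K_def poly_set_def)
    qed
    have "K \<subseteq> {r2..-r1}"
      using R L by (force simp: K_def poly_set_def)
    then have "emeasure lborel K \<le> emeasure lborel {r2..-r1}" by (intro emeasure_mono) auto
    then have finK: "emeasure lborel K < \<infinity>" 
      by (rule le_less_trans) (simp add: emeasure_lborel_Icc_eq)
    then have eK: "ennreal (measure lborel K) = emeasure lborel K"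
      by (simp add: emeasure_eq_ennreal_measure)
    have Kb: "K \<in> sets lborel" using borel_slice1[OF poly_set_borel[OF F]] by (simp add: K_def)
    have "ennreal (rr i t - rr j t) = emeasure lborel {rr j t<..<rr i t}" using xi xj by simp
    also have "\<dots> \<le> emeasure lborel K" using sub Kb by (intro emeasure_mono) auto
    finally have gap: "rr i t - rr j t \<le> measure lborel K"
      using eK xi xj by (metis ennreal_le_iff measure_nonneg)
    show "0 < measure lborel {x. (x, t) \<in> poly_set F}" using gap xi xj by (simp add: K_def)
    show "ennreal (measure lborel {x. (x, t) \<in> poly_set F}) = emeasure lborel {x. (x, t) \<in> poly_set F}"
      using eK by (simp add: K_def)
    have "c * min 1 (supd (x, t) (pp i j)) \<le> cc i j * min 1 (supd (x, t) (pp i j))"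
      by (intro mult_right_mono cle i j) (simp add: supd_nonneg)
    also have "\<dots> \<le> rr i t - rr j t" by (rule cp(2)[OF xj xi])
    finally have "c * min 1 (supd (x, t) (pp i j)) \<le> measure lborel {x. (x, t) \<in> poly_set F}"
      using gap by (simp add: K_def)
    moreover have "pp i j \<in> V" using i j unfolding V_def by blast
    ultimately show "\<exists>p\<in>V. c * min 1 (supd (x, t) p) \<le> measure lborel {x. (x, t) \<in> poly_set F}"
      by blast
  qed
qed

text \<open>Where the chord has length at least \<open>c * \<tau>\<close>, the plane trace
  inequality with width and shift both equal to \<tau> applies, and the reciprocal chord length is
  dominated by the kernels at \<open>V\<close>. Where the chord is shorter, the point is within
  \<tau> of \<open>V\<close>, a truncated kernel is \<open>1 / \<tau>\<close> there, and the trivial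
  bound is good enough. Since width and shift agree, the escape term has coefficient one; only
  \<open>C\<close> and \<open>V\<close> depend on the polygon.\<close>

lemma poly_trace:
  assumes F: "finite F" and R: "(1, 0, r1) \<in> F" and L: "(-1, 0, r2) \<in> F"
  shows "\<exists>C>0. \<exists>V. finite V \<and> (\<forall>W S \<tau>. convex W \<longrightarrow> W \<in> sets borel \<longrightarrow> S \<subseteq> poly_set F \<longrightarrow> S \<in> sets borel \<longrightarrow>
     (\<forall>t. emeasure lborel {x. (x, t) \<in> S} \<le> ennreal \<tau>) \<longrightarrow> 0 < \<tau> \<longrightarrow> \<tau> \<le> 1 \<longrightarrow>
     emeasure lborel (W \<inter> S) \<le> emeasure lborel (escape W \<tau> \<inter> poly_set F) + ennreal (C * \<tau>) *
       (\<integral>\<^sup>+y. indicator (W \<inter> poly_set F) y * ennreal (1 + (\<Sum>p\<in>V. 1 / max (supd y p) \<tau>)) \<partial>lborel))"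
proof -
  define D where "D = poly_set F"
  define l where "l t = measure lborel {x. (x, t) \<in> D}" for t
  have D[measurable]: "D \<in> sets borel" using poly_set_borel[OF F] by (simp add: D_def)
  have lm[measurable]: "l \<in> borel_measurable borel"
  proof -
    have "D \<in> sets (lborel \<Otimes>\<^sub>M lborel)" using D by (metis lborel_prod sets_lborel)
    then have "(\<lambda>t. emeasure lborel ((\<lambda>x. (x, t)) -` D)) \<in> borel_measurable lborel"
      by (rule lborel_pair.measurable_emeasure_Pair2)
    then show ?thesis by (simp add: l_def[abs_def] measure_def vimage_def)
  qed
  from poly_chord[OF assms] obtain c V where cV: "c > 0" "finite V"
    "\<And>x t. (x, t) \<in> D \<Longrightarrow> 0 < l t \<and> ennreal (l t) = emeasure lborel {x. (x, t) \<in> D} \<and>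
        (\<exists>p\<in>V. c * min 1 (supd (x, t) p) \<le> l t)"
    unfolding D_def[symmetric] l_def[symmetric] by blast
  show ?thesis unfolding D_def[symmetric]
  proof (intro exI[of _ "1 / c + 1"] exI[of _ V] conjI allI impI)
    show "1 / c + 1 > 0" "finite V" using cV by (auto simp: add_pos_pos)
    fix W S :: "(real \<times> real) set" and \<tau> :: real
    assume W: "convex W" "W \<in> sets borel" and S: "S \<subseteq> D" "S \<in> sets borel"
      and Sl: "\<forall>t. emeasure lborel {x. (x, t) \<in> S} \<le> ennreal \<tau>" and \<tau>: "0 < \<tau>" "\<tau> \<le> 1"
    note [measurable] = W(2) S(2)
    define h where "h y = 1 + (\<Sum>p\<in>V. 1 / max (supd y p) \<tau>)" for y
    have hm[measurable]: "h \<in> borel_measurable borel" unfolding h_def by measurable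
    have hp: "1 / max (supd y p) \<tau> \<le> h y" if "p \<in> V" for y p
    proof -
      have "1 / max (supd y p) \<tau> \<le> (\<Sum>p\<in>V. 1 / max (supd y p) \<tau>)"
        using \<tau> cV(2) that by (intro member_le_sum) (auto simp: supd_nonneg less_max_iff_disj divide_nonneg_nonneg le_max_iff_disj)
      then show ?thesis by (simp add: h_def)
    qed
    have h1: "1 \<le> h y" for y
      unfolding h_def using \<tau> by (auto intro!: sum_nonneg divide_nonneg_nonneg simp: le_max_iff_disj)
    define Dt where "Dt = {y \<in> D. c * \<tau> \<le> l (snd y)}"
    have Dt[measurable]: "Dt \<in> sets borel" unfolding Dt_def by measurable
    have near: "\<tau> * h y \<ge> 1" if yD: "y \<in> D" and yn: "y \<notin> Dt" for y
    proof -
      obtain x t where y: "y = (x, t)" by (cases y)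
      obtain p where p: "p \<in> V" "c * min 1 (supd (x, t) p) \<le> l t" using cV(3)[of x t] yD y by blast
      have "c * min 1 (supd (x, t) p) < c * \<tau>" using p yD yn y by (auto simp: Dt_def)
      then have "supd y p < \<tau>" using cV(1) \<tau> y by (auto simp: min_def split: if_splits)
      then have "1 / \<tau> \<le> h y" using hp[OF p(1), of y] by (simp add: max_def)
      then show ?thesis using \<tau> by (simp add: field_simps)
    qed
    have far: "1 / l t \<le> (1 / c) * h (x, t)" if y: "(x, t) \<in> Dt" for x t
    proof -
      have yD: "(x, t) \<in> D" and lt: "c * \<tau> \<le> l t" using y by (auto simp: Dt_def)
      obtain p where p: "p \<in> V" "c * min 1 (supd (x, t) p) \<le> l t" using cV(3)[OF yD] by auto
      have "c / h (x, t) \<le> l t"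
      proof (cases "supd (x, t) p \<ge> 1")
        case True
        then have "c \<le> l t" using p by simp
        moreover have "c / h (x, t) \<le> c / 1" using cV(1) h1[of "(x, t)"] by (intro divide_left_mono) auto
        ultimately show ?thesis by simp
      next
        case False
        then have "c * supd (x, t) p \<le> l t" using p by simp
        with lt have m: "c * max (supd (x, t) p) \<tau> \<le> l t" by (simp add: max_def)
        have mp: "max (supd (x, t) p) \<tau> > 0" using \<tau> by simp
        have "c / h (x, t) \<le> c / (1 / max (supd (x, t) p) \<tau>)"
          using cV(1) hp[OF p(1), of "(x, t)"] h1[of "(x, t)"] mp
          by (intro divide_left_mono) (auto intro!: mult_pos_pos)
        also have "\<dots> \<le> l t" using m by simp
        finally show ?thesis .
      qed
      moreover have "h (x, t) > 0" using h1[of "(x, t)"] by simp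
      moreover have "l t > 0" using cV(3)[OF yD] by simp
      ultimately show ?thesis using cV(1) by (simp add: field_simps)
    qed
    have slDt: "{x. (x, t) \<in> Dt} = (if c * \<tau> \<le> l t then {x. (x, t) \<in> D} else {})" for t
      by (auto simp: Dt_def)
    define Q where "Q = (\<integral>\<^sup>+y. indicator (W \<inter> D) y * ennreal (h y) \<partial>lborel)"
    have "(\<integral>\<^sup>+y. indicator (W \<inter> (S \<inter> Dt)) y * ennreal (1 / \<tau>) \<partial>lborel) \<le>
      ennreal (1 / \<tau>) * emeasure lborel {y \<in> W \<inter> Dt. y + (\<tau>, 0) \<notin> W \<or> y - (\<tau>, 0) \<notin> W}
      + (\<integral>\<^sup>+y. indicator (W \<inter> Dt) y * ennreal ((1 / c) * h y) \<partial>lborel)"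
    proof (rule plane_trace[where l=l and b="\<lambda>_. \<tau>"])
      show "convex {x. (x, t) \<in> Dt}" for t
        unfolding slDt using poly_set_slice_convex[of t F] by (simp add: D_def)
      show "emeasure lborel {x. (x, t) \<in> S \<inter> Dt} \<le> ennreal \<tau>" for t
        by (rule order_trans[OF emeasure_mono Sl[rule_format]]) (use S borel_slice1[OF S(2)] in auto)
      show "0 < l t \<and> ennreal (l t) \<le> emeasure lborel {x. (x, t) \<in> Dt} \<and> 1 / l t \<le> (1 / c) * h (x, t)"
        if "(x, t) \<in> Dt" for x t
        using far[OF that] cV(3)[of x t] that unfolding slDt by (auto simp: Dt_def)
    qed (use W \<tau> in auto)
    then have "ennreal \<tau> * (\<integral>\<^sup>+y. indicator (W \<inter> (S \<inter> Dt)) y * ennreal (1 / \<tau>) \<partial>lborel) \<le>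
      ennreal \<tau> * (ennreal (1 / \<tau>) * emeasure lborel {y \<in> W \<inter> Dt. y + (\<tau>, 0) \<notin> W \<or> y - (\<tau>, 0) \<notin> W}
      + (\<integral>\<^sup>+y. indicator (W \<inter> Dt) y * ennreal ((1 / c) * h y) \<partial>lborel))"
      by (intro mult_left_mono) auto
    also have "ennreal \<tau> * (\<integral>\<^sup>+y. indicator (W \<inter> (S \<inter> Dt)) y * ennreal (1 / \<tau>) \<partial>lborel)
        = emeasure lborel (W \<inter> (S \<inter> Dt))"
      using \<tau> by (subst nn_integral_multc) (simp_all add: mult.commute mult.assoc[symmetric] ennreal_mult[symmetric])
    also have "ennreal \<tau> * (ennreal (1 / \<tau>) * emeasure lborel {y \<in> W \<inter> Dt. y + (\<tau>, 0) \<notin> W \<or> y - (\<tau>, 0) \<notin> W}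
      + (\<integral>\<^sup>+y. indicator (W \<inter> Dt) y * ennreal ((1 / c) * h y) \<partial>lborel))
      = emeasure lborel {y \<in> W \<inter> Dt. y + (\<tau>, 0) \<notin> W \<or> y - (\<tau>, 0) \<notin> W}
      + ennreal \<tau> * (\<integral>\<^sup>+y. indicator (W \<inter> Dt) y * ennreal ((1 / c) * h y) \<partial>lborel)"
      using \<tau> by (simp add: distrib_left mult.assoc[symmetric] ennreal_mult[symmetric])
    also have "\<dots> \<le> emeasure lborel (escape W \<tau> \<inter> D) + ennreal \<tau> * (ennreal (1 / c) * Q)"
    proof (intro add_mono mult_left_mono)
      show "emeasure lborel {y \<in> W \<inter> Dt. y + (\<tau>, 0) \<notin> W \<or> y - (\<tau>, 0) \<notin> W} \<le> emeasure lborel (escape W \<tau> \<inter> D)"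
        by (rule emeasure_mono) (auto simp: escape_def Dt_def escape_borel W)
      have "(\<integral>\<^sup>+y. indicator (W \<inter> Dt) y * ennreal ((1 / c) * h y) \<partial>lborel)
         \<le> (\<integral>\<^sup>+y. ennreal (1 / c) * (indicator (W \<inter> D) y * ennreal (h y)) \<partial>lborel)"
        using cV(1) h1 by (intro nn_integral_mono)
          (auto simp: indicator_def Dt_def ennreal_mult[symmetric] order_trans[OF zero_le_one])
      also have "\<dots> = ennreal (1 / c) * Q" unfolding Q_def by (rule nn_integral_cmult) measurable
      finally show "(\<integral>\<^sup>+y. indicator (W \<inter> Dt) y * ennreal ((1 / c) * h y) \<partial>lborel) \<le> ennreal (1 / c) * Q" .
    qed auto
    finally have A: "emeasure lborel (W \<inter> (S \<inter> Dt)) \<le> emeasure lborel (escape W \<tau> \<inter> D) + ennreal \<tau> * (ennreal (1 / c) * Q)" .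
    have B: "emeasure lborel (W \<inter> (S - Dt)) \<le> ennreal \<tau> * Q"
    proof -
      have "emeasure lborel (W \<inter> (S - Dt)) = (\<integral>\<^sup>+y. indicator (W \<inter> (S - Dt)) y \<partial>lborel)" by simp
      also have "\<dots> \<le> (\<integral>\<^sup>+y. ennreal \<tau> * (indicator (W \<inter> D) y * ennreal (h y)) \<partial>lborel)"
      proof (rule nn_integral_mono)
        fix y
        show "indicator (W \<inter> (S - Dt)) y \<le> ennreal \<tau> * (indicator (W \<inter> D) y * ennreal (h y))"
        proof (cases "y \<in> W \<inter> (S - Dt)")
          case True
          then have "1 \<le> ennreal (\<tau> * h y)" using near[of y] S(1) by (auto simp: ennreal_ge_1)
          then show ?thesis using True S(1) \<tau> h1[of y] by (auto simp: ennreal_mult indicator_def)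
        qed simp
      qed
      also have "\<dots> = ennreal \<tau> * Q" unfolding Q_def by (rule nn_integral_cmult) measurable
      finally show ?thesis .
    qed
    have "emeasure lborel (W \<inter> S) \<le> emeasure lborel (W \<inter> (S \<inter> Dt)) + emeasure lborel (W \<inter> (S - Dt))"
    proof -
      have "W \<inter> S = (W \<inter> (S \<inter> Dt)) \<union> (W \<inter> (S - Dt))" by auto
      then show ?thesis by (metis (no_types, lifting) emeasure_subadditive Dt S(2) W(2) sets.Diff sets.Int sets_lborel)
    qed
    also have "\<dots> \<le> (emeasure lborel (escape W \<tau> \<inter> D) + ennreal \<tau> * (ennreal (1 / c) * Q)) + ennreal \<tau> * Q"
      by (rule add_mono[OF A B])
    also have "\<dots> = emeasure lborel (escape W \<tau> \<inter> D) + ennreal ((1 / c + 1) * \<tau>) * Q"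
    proof -
      have "ennreal ((1 / c + 1) * \<tau>) = ennreal \<tau> * ennreal (1 / c) + ennreal \<tau>"
        using \<tau> cV(1) by (simp add: ennreal_mult[symmetric] ennreal_plus[symmetric] distrib_right del: ennreal_plus)
      then show ?thesis by (simp only: distrib_right mult.assoc add.assoc)
    qed
    finally show "emeasure lborel (W \<inter> S) \<le> emeasure lborel (escape W \<tau> \<inter> D) + ennreal ((1 / c + 1) * \<tau>) *
       (\<integral>\<^sup>+y. indicator (W \<inter> D) y * ennreal (1 + (\<Sum>p\<in>V. 1 / max (supd y p) \<tau>)) \<partial>lborel)"
      by (simp add: Q_def h_def)
  qed
qed

section \<open>Branches, words and cells\<close>

lemma hyperplane_null:
  fixes a b c :: real
  assumes "(a, b) \<noteq> (0, 0)"
  shows "{x :: real \<times> real. a * fst x + b * snd x + c = 0} \<in> null_sets lborel"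
proof -
  have e: "{x :: real \<times> real. a * fst x + b * snd x + c = 0} = {x. (a, b) \<bullet> x = - c}"
    by (auto simp: inner_prod_def)
  have "negligible {x. (a, b) \<bullet> x = - c}"
    by (rule negligible_hyperplane) (use assms in \<open>auto simp: zero_prod_def\<close>)
  moreover have "{x :: real \<times> real. (a, b) \<bullet> x = - c} \<in> sets lborel"
    by (simp add: closed_hyperplane)
  ultimately show ?thesis
    unfolding e by (simp add: negligible_iff_null_sets null_sets_completion_iff)
qed

context
  fixes \<alpha> :: real
begin

text \<open>The argument of the tent, recentred so that the zero set is the fold line of the map;
  \<open>oml\<close> below is its linear part.\<close>

definition om :: "real \<times> real \<Rightarrow> real" where
  "om p = \<alpha> * snd p + (1 - \<alpha>) * fst p - 1/2"

definition oml :: "real \<times> real \<Rightarrow> real" where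
  "oml p = \<alpha> * snd p + (1 - \<alpha>) * fst p"

text \<open>The symbol True stands for the branch on the side of the increasing part of the tent.\<close>

definition br :: "bool \<Rightarrow> real \<times> real \<Rightarrow> real \<times> real" where
  "br b p = (snd p, if b then 1 + 2 * om p else 1 - 2 * om p)"

definition lb :: "bool \<Rightarrow> real \<times> real \<Rightarrow> real \<times> real" where
  "lb b v = (snd v, if b then 2 * oml v else - 2 * oml v)"

definition ilb :: "bool \<Rightarrow> real \<times> real \<Rightarrow> real \<times> real" where
  "ilb b v = (((if b then snd v / 2 else - snd v / 2) - \<alpha> * fst v) / (1 - \<alpha>), fst v)"

text \<open>Words are read along orbits, the first letter acting first. The inverse
  \<open>ilbs\<close> accordingly undoes the last letter first and uses
  \<open>foldr\<close>.\<close>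

definition brs :: "bool list \<Rightarrow> real \<times> real \<Rightarrow> real \<times> real" where
  "brs w = fold br w"

definition lbs :: "bool list \<Rightarrow> real \<times> real \<Rightarrow> real \<times> real" where
  "lbs w = fold lb w"

definition ilbs :: "bool list \<Rightarrow> real \<times> real \<Rightarrow> real \<times> real" where
  "ilbs w = foldr ilb w"

definition half :: "bool \<Rightarrow> (real \<times> real) set" where
  "half b = {p. if b then om p < 0 else 0 < om p}"

text \<open>The cylinder of the itinerary \<open>w\<close> in \<open>C\<close>. Points that hit the
  fold line before time \<open>length w\<close> are dropped, so the cylinders of one length cover
  \<open>C\<close> only up to a null set.\<close>

definition cell :: "(real \<times> real) set \<Rightarrow> bool list \<Rightarrow> (real \<times> real) set" where
  "cell C w = {x \<in> C. \<forall>i < length w. brs (take i w) x \<in> half (w ! i)}"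

definition words :: "nat \<Rightarrow> bool list set" where
  "words n = {w. length w = n}"

lemma finite_words: "finite (words n)"
  using finite_lists_length_eq[of "UNIV :: bool set" n] by (simp add: words_def)

lemma brs_Nil [simp]: "brs [] x = x" and lbs_Nil [simp]: "lbs [] x = x" and ilbs_Nil [simp]: "ilbs [] x = x"
  by (simp_all add: brs_def lbs_def ilbs_def)

lemma brs_append: "brs (w @ v) x = brs v (brs w x)" by (simp add: brs_def)
lemma lbs_append: "lbs (w @ v) x = lbs v (lbs w x)" by (simp add: lbs_def)
lemma ilbs_append: "ilbs (w @ v) x = ilbs w (ilbs v x)" by (simp add: ilbs_def)
lemma brs_snoc: "brs (w @ [b]) x = br b (brs w x)" by (simp add: brs_def)
lemma lbs_snoc: "lbs (w @ [b]) x = lb b (lbs w x)" by (simp add: lbs_def)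

lemma om_add: "om (x + v) = om x + oml v"
  by (simp add: om_def oml_def algebra_simps)

lemma br_add: "br b (x + v) = br b x + lb b v"
  by (simp add: br_def lb_def om_add)

lemma brs_add: "brs w (x + v) = brs w x + lbs w v"
  by (induction w rule: rev_induct) (simp_all add: brs_snoc lbs_snoc br_add)

lemma linear_oml: "linear oml"
  by (rule linearI) (simp_all add: oml_def algebra_simps)

lemma linear_lb: "linear (lb b)"
  by (rule linearI) (simp_all add: lb_def oml_def algebra_simps)

lemma linear_ilb: "linear (ilb b)"
  by (rule linearI) (simp_all add: ilb_def algebra_simps add_divide_distrib diff_divide_distrib)

lemma linear_lbs: "linear (lbs w)"
proof (induction w rule: rev_induct)
  case Nil then show ?case by (simp add: lbs_def linear_id[unfolded id_def] id_def)
next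
  case (snoc b w)
  have "lbs (w @ [b]) = lb b \<circ> lbs w" by (simp add: fun_eq_iff lbs_snoc)
  then show ?case using linear_compose[OF snoc linear_lb, of b] by (simp only:)
qed

lemma linear_ilbs: "linear (ilbs w)"
proof (induction w)
  case Nil then show ?case by (simp add: ilbs_def linear_id[unfolded id_def] id_def)
next
  case (Cons b w)
  have "ilbs (b # w) = ilb b \<circ> ilbs w" by (simp add: fun_eq_iff ilbs_def)
  then show ?case using linear_compose[OF Cons linear_ilb, of b] by (simp only:)
qed

lemma brs_convex_comb:
  assumes "u + v = 1"
  shows "brs w (u *\<^sub>R x + v *\<^sub>R y) = u *\<^sub>R brs w x + v *\<^sub>R brs w y"
proof -
  have v: "u = 1 - v" using assms by simp
  have "brs w (u *\<^sub>R x + v *\<^sub>R y) = brs w (x + v *\<^sub>R (y - x))"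
    by (simp add: v algebra_simps)
  also have "\<dots> = brs w x + v *\<^sub>R lbs w (y - x)"
    by (simp add: brs_add linear_scale[OF linear_lbs])
  also have "lbs w (y - x) = brs w y - brs w x"
    using brs_add[of w x "y - x"] by simp
  finally show ?thesis by (simp add: v algebra_simps)
qed

lemma continuous_om: "continuous_on UNIV om"
  unfolding om_def[abs_def] by (intro continuous_intros)

lemma om_measurable [measurable]: "om \<in> borel_measurable borel"
  using continuous_om by (rule borel_measurable_continuous_onI)

lemma continuous_brs: "continuous_on UNIV (brs w)"
proof -
  have "continuous_on UNIV (\<lambda>x. brs w 0 + lbs w x)"
    by (intro continuous_intros linear_continuous_on linear_lbs bounded_linear.linear
        linear_conv_bounded_linear[THEN iffD1])
  moreover have "brs w 0 + lbs w x = brs w x" for x using brs_add[of w 0 x] by simp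
  ultimately show ?thesis by simp
qed

lemma brs_measurable [measurable]: "brs w \<in> borel_measurable borel"
  using continuous_brs by (rule borel_measurable_continuous_onI)

lemma half_borel: "half b \<in> sets borel"
  unfolding half_def by (cases b) simp_all

lemma half_convex: "convex (half b)"
proof (rule convexI)
  fix x y u v assume xy: "x \<in> half b" "y \<in> half b" and uv: "0 \<le> u" "0 \<le> v" "u + v = (1::real)"
  have e: "om (u *\<^sub>R x + v *\<^sub>R y) = u * om x + v * om y"
  proof -
    have v: "v = 1 - u" using uv(3) by simp
    show ?thesis unfolding v by (simp add: om_def field_simps)
  qed
  show "u *\<^sub>R x + v *\<^sub>R y \<in> half b"
    using xy uv convex_bound_lt[of "om x" 0 "om y" u v] convex_bound_lt[of "- om x" 0 "- om y" u v]
    by (auto simp: half_def e split: if_splits)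
qed

lemma cell_Nil [simp]: "cell C [] = C" by (simp add: cell_def)

lemma cell_append: "cell C (w @ v) = cell C w \<inter> brs w -` cell UNIV v"
proof -
  have "(\<forall>i<length (w @ v). brs (take i (w @ v)) x \<in> half ((w @ v) ! i)) \<longleftrightarrow>
    (\<forall>i<length w. brs (take i w) x \<in> half (w ! i)) \<and> (\<forall>i<length v. brs (take i v) (brs w x) \<in> half (v ! i))" for x
  proof (intro iffI conjI allI impI)
    fix i assume H: "\<forall>i<length (w @ v). brs (take i (w @ v)) x \<in> half ((w @ v) ! i)"
    { assume "i < length w"
      then show "brs (take i w) x \<in> half (w ! i)" using H[rule_format, of i] by (simp add: nth_append) }
    { assume "i < length v"
      then show "brs (take i v) (brs w x) \<in> half (v ! i)"
        using H[rule_format, of "length w + i"] by (simp add: nth_append brs_append) }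
  next
    fix i assume H: "(\<forall>i<length w. brs (take i w) x \<in> half (w ! i)) \<and> (\<forall>i<length v. brs (take i v) (brs w x) \<in> half (v ! i))"
      and i: "i < length (w @ v)"
    show "brs (take i (w @ v)) x \<in> half ((w @ v) ! i)"
    proof (cases "i < length w")
      case True then show ?thesis using H by (simp add: nth_append)
    next
      case False
      then have "brs (take (i - length w) v) (brs w x) \<in> half (v ! (i - length w))" using H i by auto
      then show ?thesis using False by (simp add: nth_append brs_append)
    qed
  qed
  then show ?thesis by (auto simp: cell_def)
qed

lemma cell_single: "cell UNIV [b] = half b" by (simp add: cell_def)

lemma cell_snoc: "cell C (w @ [b]) = cell C w \<inter> brs w -` half b"
  by (simp add: cell_append cell_single)

lemma cell_borel: "C \<in> sets borel \<Longrightarrow> cell C w \<in> sets borel"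
proof (induction w rule: rev_induct)
  case (snoc b w)
  have "brs w -` half b \<in> sets borel"
    by (rule measurable_sets_borel[OF brs_measurable half_borel])
  then show ?case using snoc by (simp add: cell_snoc)
qed simp

lemma convex_vimage_brs: "convex A \<Longrightarrow> convex (brs w -` A)"
  by (auto simp: convex_def brs_convex_comb)

lemma convex_cell: "convex C \<Longrightarrow> convex (cell C w)"
  by (induction w rule: rev_induct) (auto simp: cell_snoc intro!: convex_Int convex_vimage_brs half_convex)

lemma cell_disjoint: "w \<noteq> v \<Longrightarrow> length w = length v \<Longrightarrow> cell C w \<inter> cell C v = {}"
proof (induction w arbitrary: v rule: rev_induct)
  case (snoc b w)
  then obtain v' c where v: "v = v' @ [c]" by (metis append_Nil2 length_0_conv rev_exhaust snoc_eq_iff_butlast)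
  show ?case
  proof (cases "w = v'")
    case True
    then have "b \<noteq> c" using snoc v by simp
    then have "half b \<inter> half c = {}" by (auto simp: half_def split: if_splits)
    then show ?thesis unfolding v cell_snoc True by auto
  next
    case False
    then show ?thesis using snoc.IH[of v'] snoc.prems unfolding v cell_snoc by auto
  qed
qed simp

lemma cell_subset: "cell C w \<subseteq> C" by (auto simp: cell_def)

context
  assumes \<alpha>: "0 < \<alpha>" "\<alpha> < 1/2"
begin

section \<open>Invertibility of the branches and their Jacobian\<close>

lemma lb_ilb: "lb b (ilb b v) = v" and ilb_lb: "ilb b (lb b v) = v"
  using \<alpha> by (cases v; simp add: lb_def ilb_def oml_def field_simps)+

lemma lbs_ilbs: "lbs w (ilbs w v) = v"
  by (induction w) (simp_all add: lbs_def ilbs_def lb_ilb)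

lemma ilbs_lbs: "ilbs w (lbs w v) = v"
  by (induction w arbitrary: v) (simp_all add: lbs_def ilbs_def ilb_lb)

lemma brs_ilbs: "brs w (x + ilbs w v) = brs w x + v"
  by (simp add: brs_add lbs_ilbs)

lemma brs_preimage: "brs w (ilbs w (y - brs w 0)) = y"
  using brs_ilbs[of w 0 "y - brs w 0"] by simp

lemma inj_brs: "brs w x = brs w y \<Longrightarrow> x = y"
proof -
  assume e: "brs w x = brs w y"
  have "lbs w (y - x) = 0" using brs_add[of w x "y - x"] e by simp
  then have "ilbs w (lbs w (y - x)) = 0" using linear_0[OF linear_ilbs] by simp
  then show ?thesis by (simp add: ilbs_lbs)
qed

lemma image_brs: "brs w ` A = (\<lambda>y. ilbs w (y - brs w 0)) -` A"
proof (intro set_eqI iffI)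
  fix y assume "y \<in> brs w ` A"
  then obtain x where x: "x \<in> A" "y = brs w x" by auto
  have "x = ilbs w (y - brs w 0)" by (rule inj_brs[of w]) (simp add: brs_preimage x)
  then show "y \<in> (\<lambda>y. ilbs w (y - brs w 0)) -` A" using x by simp
next
  fix y assume "y \<in> (\<lambda>y. ilbs w (y - brs w 0)) -` A"
  then show "y \<in> brs w ` A" by (auto intro!: image_eqI[of _ _ "ilbs w (y - brs w 0)"] simp: brs_preimage)
qed

lemma image_brs_borel: "A \<in> sets borel \<Longrightarrow> brs w ` A \<in> sets borel"
proof -
  assume A: "A \<in> sets borel"
  have "continuous_on UNIV (\<lambda>y. ilbs w (y - brs w 0))"
    by (intro continuous_on_compose2[OF linear_continuous_on[OF linear_conv_bounded_linear[THEN iffD1, OF linear_ilbs]]]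
        continuous_intros) auto
  then show ?thesis unfolding image_brs
    by (intro measurable_sets_borel[OF borel_measurable_continuous_onI A])
qed

lemma convex_image_brs: "convex A \<Longrightarrow> convex (brs w ` A)"
proof (rule convexI)
  fix x y u v assume A: "convex A" "x \<in> brs w ` A" "y \<in> brs w ` A" "0 \<le> u" "0 \<le> v" "u + v = (1::real)"
  then obtain x' y' where "x' \<in> A" "y' \<in> A" "x = brs w x'" "y = brs w y'" by auto
  then have "u *\<^sub>R x + v *\<^sub>R y = brs w (u *\<^sub>R x' + v *\<^sub>R y')" "u *\<^sub>R x' + v *\<^sub>R y' \<in> A"
    using A by (auto simp: brs_convex_comb convexD)
  then show "u *\<^sub>R x + v *\<^sub>R y \<in> brs w ` A" by simp
qed

text \<open>A branch copies the second coordinate into the first and, with it fixed, is affine of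
  slope plus or minus J in the remaining variable. Slicing the image along its first coordinate
  therefore reduces the claim to one-dimensional substitution.\<close>

lemma emeasure_image_br:
  assumes A: "A \<in> sets borel"
  shows "emeasure lborel (brs [b] ` A) = ennreal (2 * (1 - \<alpha>)) * emeasure lborel A"
proof -
  let ?J = "2 * (1 - \<alpha>)"
  define k where "k = (if b then 1 / ?J else - 1 / ?J)"
  have k: "k \<noteq> 0" "\<bar>k\<bar> * ?J = 1" using \<alpha> by (auto simp: k_def)
  define d where "d y = (if b then - (\<alpha> * y) / (1 - \<alpha>) else (1 - \<alpha> * y) / (1 - \<alpha>))" for y
  have B: "brs [b] ` A \<in> sets borel" by (rule image_brs_borel[OF A])
  have iff: "(y, z) \<in> brs [b] ` A \<longleftrightarrow> (d y + k * z, y) \<in> A" for y z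
  proof -
    have e: "ilbs [b] ((y, z) - brs [b] 0) = (d y + k * z, y)"
      proof -
      define u where "u = 1 / (1 - \<alpha>)"
      have ku: "k = (if b then u / 2 else - u / 2)" by (simp add: k_def u_def)
      have du: "d y = (if b then - (\<alpha> * y) * u else (1 - \<alpha> * y) * u)" by (simp add: d_def u_def)
      have "ilb b v = (((if b then snd v / 2 else - snd v / 2) - \<alpha> * fst v) * u, fst v)" for v
        by (simp add: ilb_def u_def)
      then show ?thesis
        by (cases b) (auto simp: brs_def ilbs_def br_def om_def ku du field_simps)
    qed
    show ?thesis unfolding image_brs by (simp add: e)
  qed
  have Am: "(\<lambda>y. indicator A y :: ennreal) \<in> borel_measurable borel" using A by simp
  have "emeasure lborel (brs [b] ` A) = (\<integral>\<^sup>+p. indicator (brs [b] ` A) p \<partial>lborel)" using B by simp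
  also have "\<dots> = (\<integral>\<^sup>+p. indicator (brs [b] ` A) (prod.swap p) \<partial>lborel)"
    by (rule nn_integral_lborel_swap[symmetric]) (use B in simp)
  also have "\<dots> = (\<integral>\<^sup>+y. (\<integral>\<^sup>+z. indicator (brs [b] ` A) (prod.swap (z, y)) \<partial>lborel) \<partial>lborel)"
  proof (rule nn_integral_lborel_pair)
    have "prod.swap \<in> borel_measurable (borel :: (real \<times> real) measure)"
      by (intro borel_measurable_continuous_onI continuous_on_swap)
    then show "(\<lambda>p. indicator (brs [b] ` A) (prod.swap p) :: ennreal) \<in> borel_measurable borel"
      by (rule measurable_compose) (use B in simp)
  qed
  also have "\<dots> = (\<integral>\<^sup>+y. (\<integral>\<^sup>+z. indicator A (d y + k * z, y) \<partial>lborel) \<partial>lborel)"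
    by (intro nn_integral_cong) (simp add: iff indicator_def)
  also have "\<dots> = (\<integral>\<^sup>+y. ennreal ?J * (\<integral>\<^sup>+x. indicator A (x, y) \<partial>lborel) \<partial>lborel)"
  proof (rule nn_integral_cong)
    fix y :: real
    have m: "(\<lambda>x. indicator A (x, y) :: ennreal) \<in> borel_measurable borel"
    proof -
      have "(\<lambda>x. indicator A (x, y) :: ennreal) = indicator {x. (x, y) \<in> A}" by (auto simp: indicator_def)
      then show ?thesis using borel_slice1[OF A] by simp
    qed
    have "(\<integral>\<^sup>+x. indicator A (x, y) \<partial>lborel) = ennreal \<bar>k\<bar> * (\<integral>\<^sup>+z. indicator A (d y + k * z, y) \<partial>lborel)"
      by (rule nn_integral_real_affine[OF m k(1)])
    then show "(\<integral>\<^sup>+z. indicator A (d y + k * z, y) \<partial>lborel) = ennreal ?J * (\<integral>\<^sup>+x. indicator A (x, y) \<partial>lborel)"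
    proof -
      have "ennreal ?J * ennreal \<bar>k\<bar> = 1" using k(2) \<alpha> by (simp add: ennreal_mult[symmetric] mult.commute)
      then show ?thesis
        unfolding \<open>(\<integral>\<^sup>+x. indicator A (x, y) \<partial>lborel) = _\<close> by (simp add: mult.assoc[symmetric])
    qed
  qed
  also have "\<dots> = ennreal ?J * (\<integral>\<^sup>+y. (\<integral>\<^sup>+x. indicator A (x, y) \<partial>lborel) \<partial>lborel)"
  proof (rule nn_integral_cmult)
    have "(indicator A :: _ \<Rightarrow> ennreal) \<in> borel_measurable (lborel \<Otimes>\<^sub>M lborel)" using Am by (simp add: lborel_prod)
    then show "(\<lambda>y. \<integral>\<^sup>+x. indicator A (x, y) \<partial>lborel) \<in> borel_measurable lborel" by measurable
  qed
  also have "(\<integral>\<^sup>+y. (\<integral>\<^sup>+x. indicator A (x, y) \<partial>lborel) \<partial>lborel) = (\<integral>\<^sup>+y. indicator A y \<partial>lborel)"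
    by (rule nn_integral_lborel_pair[OF Am, symmetric])
  also have "\<dots> = emeasure lborel A" using A by simp
  finally show ?thesis .
qed

lemma emeasure_image_brs:
  assumes A: "A \<in> sets borel"
  shows "emeasure lborel (brs w ` A) = ennreal ((2 * (1 - \<alpha>)) ^ length w) * emeasure lborel A"
proof (induction w rule: rev_induct)
  case Nil
  then show ?case by (simp add: brs_def)
next
  case (snoc b w)
  have "brs (w @ [b]) ` A = brs [b] ` (brs w ` A)" by (simp add: image_image brs_append)
  then show ?case using \<alpha>
    by (simp add: emeasure_image_br image_brs_borel A snoc mult.assoc[symmetric] ennreal_mult[symmetric])
qed

lemma oml_lbs: "oml (lbs w x) = oml (lbs w (1, 0)) * fst x + oml (lbs w (0, 1)) * snd x"
proof -
  have lin: "linear (oml \<circ> lbs w)" by (rule linear_compose[OF linear_lbs linear_oml])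
  have x: "fst x *\<^sub>R (1, 0) + snd x *\<^sub>R (0, 1) = x" by (cases x) simp
  have "(oml \<circ> lbs w) (fst x *\<^sub>R (1, 0) + snd x *\<^sub>R (0, 1))
      = fst x *\<^sub>R (oml \<circ> lbs w) (1, 0) + snd x *\<^sub>R (oml \<circ> lbs w) (0, 1)"
    by (simp only: linear_add[OF lin] linear_scale[OF lin])
  then show ?thesis unfolding x by simp
qed

lemma om_brs: "om (brs w x) = oml (lbs w (1, 0)) * fst x + oml (lbs w (0, 1)) * snd x + om (brs w 0)"
  using brs_add[of w 0 x] oml_lbs[of w x] by (simp add: om_add)

text \<open>The composed function is affine and not constant: \<open>oml\<close> takes the value 1
  at (1, 1), which has a preimage under the invertible linear part of the word.\<close>

lemma fold_line_null: "{x. om (brs w x) = 0} \<in> null_sets lborel"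
proof -
  have "oml (lbs w (ilbs w (1, 1))) = 1" by (simp add: lbs_ilbs oml_def)
  then have ab: "(oml (lbs w (1, 0)), oml (lbs w (0, 1))) \<noteq> (0, 0)"
    using oml_lbs[of w "ilbs w (1, 1)"] by auto
  have "{x. om (brs w x) = 0} = {x. oml (lbs w (1, 0)) * fst x + oml (lbs w (0, 1)) * snd x + om (brs w 0) = 0}"
    by (intro Collect_cong) (subst om_brs, rule refl)
  then show ?thesis using hyperplane_null[OF ab, of "om (brs w 0)"] by simp
qed

lemma cells_cover: "AE x in lborel. x \<in> C \<longrightarrow> (\<exists>w \<in> words n. x \<in> cell C w)"
proof (induction n)
  case 0
  then show ?case by (auto simp: words_def)
next
  case (Suc n)
  have "AE x in lborel. \<forall>w \<in> words n. om (brs w x) \<noteq> 0"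
    using finite_words[of n]
  proof (rule AE_finite_allI)
    fix w show "AE x in lborel. om (brs w x) \<noteq> 0"
      by (rule AE_I'[OF fold_line_null[of w]]) auto
  qed
  with Suc show ?case
  proof eventually_elim
    case (elim x)
    show ?case
    proof
      assume "x \<in> C"
      then obtain w where w: "w \<in> words n" "x \<in> cell C w" using elim by auto
      then have "om (brs w x) \<noteq> 0" using elim by auto
      then have "x \<in> cell C (w @ [om (brs w x) < 0])" using w by (auto simp: cell_snoc half_def)
      then show "\<exists>w \<in> words (Suc n). x \<in> cell C w" using w(1)
        by (intro bexI[of _ "w @ [om (brs w x) < 0]"]) (auto simp: words_def)
    qed
  qed
qed

lemma om_Gmap: "x \<in> half b \<Longrightarrow> Gmap \<alpha> x = br b x"
  by (auto simp: half_def Gmap_def br_def om_def tent_def split: if_splits)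

lemma Gmap_cell: "x \<in> cell C w \<Longrightarrow> (Gmap \<alpha> ^^ length w) x = brs w x"
  by (induction w rule: rev_induct) (auto simp: cell_snoc brs_snoc om_Gmap)

end

end

section \<open>Mass near the fold line\<close>

lemma nn_integral_brs:
  fixes f :: "real \<times> real \<Rightarrow> ennreal"
  assumes \<alpha>: "0 < \<alpha>" "\<alpha> < 1/2" and f: "f \<in> borel_measurable borel"
  shows "(\<integral>\<^sup>+y. f y \<partial>lborel) = ennreal ((2 * (1 - \<alpha>)) ^ length v) * (\<integral>\<^sup>+y. f (brs \<alpha> v y) \<partial>lborel)"
proof -
  let ?c = "ennreal ((2 * (1 - \<alpha>)) ^ length v)"
  have "lborel = scale_measure ?c (distr lborel borel (brs \<alpha> v))"
  proof (rule measure_eqI)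
    fix A :: "(real \<times> real) set" assume "A \<in> sets lborel"
    then have A: "A \<in> sets borel" by simp
    have pre: "brs \<alpha> v -` A \<in> sets borel" by (rule measurable_sets_borel[OF brs_measurable A])
    have "brs \<alpha> v ` (brs \<alpha> v -` A) = A"
    proof -
      have "y \<in> brs \<alpha> v ` (brs \<alpha> v -` A)" if "y \<in> A" for y
        by (rule image_eqI[of _ _ "ilbs \<alpha> v (y - brs \<alpha> v 0)"]) (use that in \<open>simp_all add: brs_preimage[OF \<alpha>]\<close>)
      then show ?thesis by auto
    qed
    then have "emeasure lborel A = ?c * emeasure lborel (brs \<alpha> v -` A)"
      using emeasure_image_brs[OF \<alpha> pre, of v] by simp
    then show "emeasure lborel A = emeasure (scale_measure ?c (distr lborel borel (brs \<alpha> v))) A"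
      using A by (simp add: emeasure_distr)
  qed simp
  then have "(\<integral>\<^sup>+y. f y \<partial>lborel) = (\<integral>\<^sup>+y. f y \<partial>(scale_measure ?c (distr lborel borel (brs \<alpha> v))))"
    by simp
  also have "\<dots> = ?c * (\<integral>\<^sup>+y. f y \<partial>(distr lborel borel (brs \<alpha> v)))"
    by (rule nn_integral_scale_measure) (use f in simp)
  also have "(\<integral>\<^sup>+y. f y \<partial>(distr lborel borel (brs \<alpha> v))) = (\<integral>\<^sup>+y. f (brs \<alpha> v y) \<partial>lborel)"
    by (rule nn_integral_distr) (use f in auto)
  finally show ?thesis .
qed

lemma sum_words_add:
  "(\<Sum>u\<in>words (n + m). f u) = (\<Sum>w\<in>words n. \<Sum>v\<in>words m. f (w @ v))"
  for f :: "bool list \<Rightarrow> 'a::comm_monoid_add"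
proof -
  have im: "words (n + m) = (\<lambda>(w, v). w @ v) ` (words n \<times> words m)"
  proof
    show "words (n + m) \<subseteq> (\<lambda>(w, v). w @ v) ` (words n \<times> words m)"
    proof
      fix u assume "u \<in> words (n + m)"
      then show "u \<in> (\<lambda>(w, v). w @ v) ` (words n \<times> words m)"
        by (intro image_eqI[of _ _ "(take n u, drop n u)"]) (auto simp: words_def)
    qed
  qed (auto simp: words_def)
  have inj: "inj_on (\<lambda>(w, v). w @ v) (words n \<times> words m)"
    by (auto simp: inj_on_def words_def)
  show ?thesis unfolding im sum.reindex[OF inj] by (simp add: sum.cartesian_product case_prod_beta' comp_def)
qed

lemma supd_triangle: "supd x z \<le> supd x y + supd y z"
  unfolding supd_def by (auto simp: max_def)

lemma supd_commute: "supd x y = supd y x"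
  by (simp add: supd_def abs_minus_commute)

lemma supd_eq_0: "supd x y = 0 \<Longrightarrow> x = y"
  by (auto simp: supd_def max_def prod_eq_iff split: if_splits)

lemma supd_le_norm: "supd x y \<le> norm (x - y)"
proof -
  have "\<bar>fst (x - y)\<bar> \<le> norm (x - y)" "\<bar>snd (x - y)\<bar> \<le> norm (x - y)"
    using norm_fst_le[of "fst (x - y)" "snd (x - y)"] norm_snd_le[of "snd (x - y)" "fst (x - y)"]
    unfolding prod.collapse by simp_all
  then show ?thesis by (simp add: supd_def)
qed

lemma norm_le_supd: "norm (x - y) \<le> 2 * supd x y"
proof -
  have "norm (x - y) \<le> norm (fst (x - y)) + norm (snd (x - y))"
    using norm_Pair_le[of "fst (x - y)" "snd (x - y)"] unfolding prod.collapse .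
  then show ?thesis by (simp add: supd_def max_def)
qed

text \<open>Disjoint balls around the singularities of several kernels let the corresponding Hardy
  inequalities be added without multiplicity. The radius may be tiny, since it enters only constants
  that do not depend on time.\<close>

lemma separated_supballs:
  assumes "finite P"
  obtains \<rho> where "\<rho> > 0" "disjoint_family_on (\<lambda>q. supball q \<rho>) P"
proof -
  define S where "S = insert 1 ((\<lambda>(p, q). supd p q) ` {(p, q) \<in> P \<times> P. p \<noteq> q})"
  have fS: "finite S" unfolding S_def using assms by (auto intro: finite_subset[of _ "P \<times> P"])
  have pos: "Min S > 0"
  proof (subst Min_gr_iff)
    show "\<forall>x\<in>S. 0 < x"
    proof
      fix x assume "x \<in> S"
      then consider "x = 1" | p q where "p \<noteq> q" "x = supd p q" by (auto simp: S_def)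
      then show "0 < x"
      proof cases
        case 2
        then show ?thesis using supd_eq_0[of p q] supd_nonneg[of p q] by linarith
      qed simp
    qed
  qed (use fS in \<open>auto simp: S_def\<close>)
  have "disjoint_family_on (\<lambda>q. supball q (Min S / 2)) P"
    unfolding disjoint_family_on_def
  proof (intro ballI impI)
    fix p q assume pq: "p \<in> P" "q \<in> P" "p \<noteq> q"
    then have "Min S \<le> supd p q" by (intro Min_le fS) (force simp: S_def)
    then show "supball p (Min S / 2) \<inter> supball q (Min S / 2) = {}"
    proof -
      have "False" if "supd y p < Min S / 2" "supd y q < Min S / 2" for y
        using supd_triangle[of p q y] that \<open>Min S \<le> supd p q\<close> supd_commute[of y p] by linarith
      then show ?thesis by (auto simp: supball_def)
    qed
  qed
  then show ?thesis using that[of "Min S / 2"] pos by simp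
qed

text \<open>\<open>Bd r\<close> is a layer of \<open>C\<close> along its boundary, of width
  \<open>r\<close> and of measure linear in \<open>r\<close>. Contraction is demanded only for words
  \<open>v\<close> that occur on an orbit starting in \<open>C\<close>, after an arbitrary prefix
  \<open>w\<close>; this is what makes words that never occur harmless.\<close>

locale expanding_branches =
  fixes \<alpha> K \<theta> cB :: real and C :: "(real \<times> real) set" and Bd :: "real \<Rightarrow> (real \<times> real) set"
  assumes \<alpha>: "0 < \<alpha>" "\<alpha> < 1/2"
    and C: "convex C" "C \<in> sets borel" "C \<subseteq> unit_square"
    and Bd: "\<And>r. 0 < r \<Longrightarrow> Bd r \<in> sets borel" "\<And>r. 0 < r \<Longrightarrow> emeasure lborel (Bd r) \<le> ennreal (cB * r)"
      "\<And>r x u. 0 < r \<Longrightarrow> x \<in> C \<Longrightarrow> norm u \<le> r \<Longrightarrow> x + u \<notin> C \<Longrightarrow> x \<in> Bd r"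
    and K: "0 < K" and \<theta>: "0 < \<theta>" "\<theta> < 1" and cB: "0 \<le> cB"
    and contr: "\<And>w v u. cell \<alpha> C (w @ v) \<noteq> {} \<Longrightarrow> norm (ilbs \<alpha> v u) \<le> K * \<theta> ^ length v * norm u"
begin

abbreviation "J \<equiv> 2 * (1 - \<alpha>)"

lemma J: "1 < J" using \<alpha> by simp

section \<open>Image pieces and the points near their boundaries\<close>

definition Wi :: "bool list \<Rightarrow> (real \<times> real) set" where
  "Wi w = brs \<alpha> w ` cell \<alpha> C w"

definition Dset :: "nat \<Rightarrow> real \<Rightarrow> (real \<times> real) set" where
  "Dset n s = (\<Union>w\<in>words n. {x \<in> cell \<alpha> C w. \<bar>om \<alpha> (brs \<alpha> w x)\<bar> \<le> s})"

text \<open>Points whose image at time \<open>n\<close> lies in the boundary layer of its own image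
  piece. The set is taken in \<open>C\<close>, where the cells of different words are disjoint,
  although the images overlap.\<close>

definition Esc :: "nat \<Rightarrow> real \<Rightarrow> (real \<times> real) set" where
  "Esc n \<tau> = (\<Union>w\<in>words n. cell \<alpha> C w \<inter> brs \<alpha> w -` escape (Wi w) \<tau>)"

lemma cell_bo [measurable]: "cell \<alpha> C w \<in> sets borel" by (rule cell_borel[OF C(2)])

lemma Wi_borel [measurable]: "Wi w \<in> sets borel"
  unfolding Wi_def by (rule image_brs_borel[OF \<alpha> cell_bo])

lemma Wi_convex: "convex (Wi w)"
  unfolding Wi_def by (rule convex_image_brs[OF \<alpha> convex_cell[OF C(1)]])

lemma vimage_brs_borel [measurable]: "S \<in> sets borel \<Longrightarrow> brs \<alpha> w -` S \<in> sets borel"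
  by (rule measurable_sets_borel[OF brs_measurable])

lemma Dpiece_borel [measurable]: "{x \<in> cell \<alpha> C w. \<bar>om \<alpha> (brs \<alpha> v x)\<bar> \<le> s} \<in> sets borel"
  by measurable

lemma Dset_borel [measurable]: "Dset n s \<in> sets borel"
  unfolding Dset_def using finite_words by (intro sets.finite_UN Dpiece_borel) auto

lemma Esc_borel [measurable]: "Esc n s \<in> sets borel"
  unfolding Esc_def using finite_words
  by (intro sets.finite_UN sets.Int cell_bo vimage_brs_borel escape_borel Wi_borel) auto

lemma emeasure_piece:
  assumes "S \<in> sets borel"
  shows "emeasure lborel (cell \<alpha> C w \<inter> brs \<alpha> w -` S) = ennreal (1 / J ^ length w) * emeasure lborel (Wi w \<inter> S)"
proof -
  have "Wi w \<inter> S = brs \<alpha> w ` (cell \<alpha> C w \<inter> brs \<alpha> w -` S)" by (auto simp: Wi_def)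
  then have "emeasure lborel (Wi w \<inter> S) = ennreal (J ^ length w) * emeasure lborel (cell \<alpha> C w \<inter> brs \<alpha> w -` S)"
    using assms by (simp add: emeasure_image_brs[OF \<alpha>] sets.Int)
  moreover have "ennreal (1 / J ^ length w) * ennreal (J ^ length w) = 1"
    using J by (simp add: ennreal_mult[symmetric])
  ultimately show ?thesis by (simp add: mult.assoc[symmetric])
qed

lemma C_emeasure_le: "emeasure lborel C \<le> 1"
proof -
  have "emeasure lborel C \<le> emeasure lborel (cbox (0::real \<times> real) (1, 1))"
  proof (rule emeasure_mono)
    show "C \<subseteq> cbox 0 (1, 1)" using C(3) by (auto simp: unit_square_def cbox_Pair_eq zero_prod_def cbox_interval)
  qed simp
  also have "\<dots> = 1"
    by (subst emeasure_lborel_cbox) (auto simp: Basis_prod_def zero_prod_def prod.union_disjoint)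
  finally show ?thesis .
qed

text \<open>The weights \<open>1 / J ^ n\<close> turn areas in the images into areas of subsets of
  disjoint cells, so overlaps of the images cost nothing.\<close>

lemma sum_pieces_le:
  assumes "\<And>w. w \<in> words n \<Longrightarrow> S w \<in> sets borel"
    and "\<And>w. w \<in> words n \<Longrightarrow> cell \<alpha> C w \<inter> brs \<alpha> w -` S w \<subseteq> T" and "T \<in> sets borel"
  shows "(\<Sum>w\<in>words n. ennreal (1 / J ^ n) * emeasure lborel (Wi w \<inter> S w)) \<le> emeasure lborel T"
proof -
  have "(\<Sum>w\<in>words n. ennreal (1 / J ^ n) * emeasure lborel (Wi w \<inter> S w))
     = (\<Sum>w\<in>words n. emeasure lborel (cell \<alpha> C w \<inter> brs \<alpha> w -` S w))"
    by (intro sum.cong refl) (simp add: emeasure_piece assms(1) words_def)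
  also have "\<dots> = emeasure lborel (\<Union>w\<in>words n. cell \<alpha> C w \<inter> brs \<alpha> w -` S w)"
  proof (rule sum_emeasure)
    show "disjoint_family_on (\<lambda>w. cell \<alpha> C w \<inter> brs \<alpha> w -` S w) (words n)"
      unfolding disjoint_family_on_def using cell_disjoint[of _ _ \<alpha> C] by (fastforce simp: words_def)
  qed (use assms(1) finite_words in \<open>auto intro!: sets.Int vimage_brs_borel\<close>)
  also have "\<dots> \<le> emeasure lborel T" by (rule emeasure_mono) (use assms in auto)
  finally show ?thesis .
qed

lemma sum_escape_le:
  "(\<Sum>w\<in>words n. ennreal (1 / J ^ n) * emeasure lborel (escape (Wi w) \<tau>)) \<le> emeasure lborel (Esc n \<tau>)"
proof -
  have "escape (Wi w) \<tau> = Wi w \<inter> escape (Wi w) \<tau>" for w by (auto simp: escape_def)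
  then show ?thesis
    using sum_pieces_le[of n "\<lambda>w. escape (Wi w) \<tau>" "Esc n \<tau>"] by (auto simp: Esc_def escape_borel Esc_borel[unfolded Esc_def])
qed

lemma sum_Wi_le: "(\<Sum>w\<in>words n. ennreal (1 / J ^ n) * emeasure lborel (Wi w)) \<le> 1"
  using sum_pieces_le[of n "\<lambda>_. UNIV" C] C cell_subset[of \<alpha> C] C_emeasure_le
  by (auto intro: order_trans)

lemma abs_oml_le: "\<bar>oml \<alpha> u\<bar> \<le> norm u"
proof -
  have "\<bar>oml \<alpha> u\<bar> \<le> \<alpha> * \<bar>snd u\<bar> + (1 - \<alpha>) * \<bar>fst u\<bar>"
    using \<alpha> abs_triangle_ineq[of "\<alpha> * snd u" "(1 - \<alpha>) * fst u"] by (simp add: oml_def abs_mult)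
  also have "\<dots> \<le> \<alpha> * norm u + (1 - \<alpha>) * norm u"
    using \<alpha> norm_fst_le[of "fst u" "snd u"] norm_snd_le[of "snd u" "fst u"]
    by (intro add_mono mult_left_mono) auto
  finally show ?thesis by (simp add: algebra_simps)
qed

lemma half_separate:
  assumes "p \<in> half \<alpha> b" "p + u \<notin> half \<alpha> b"
  shows "\<bar>om \<alpha> p\<bar> \<le> norm u"
proof -
  have "\<bar>om \<alpha> p\<bar> \<le> \<bar>oml \<alpha> u\<bar>"
    using assms by (auto simp: half_def om_add split: if_splits)
  then show ?thesis using abs_oml_le[of u] by linarith
qed

text \<open>The shift is pulled back through the word to a vector \<open>u\<close> with
  \<open>x + u\<close> outside the cell. Either \<open>x + u\<close> has left \<open>C\<close>, or
  the fold line separates the two orbits at an earlier time \<open>i\<close>. There the displacement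
  is the shift pulled back over the \<open>n - i\<close> letters from \<open>i\<close> on only, so
  its norm is at most \<open>K * \<theta> ^ (n - i) * \<tau>\<close>.\<close>

lemma Esc_subset:
  assumes \<tau>: "0 < \<tau>"
  shows "Esc n \<tau> \<subseteq> Bd (K * \<theta> ^ n * \<tau>) \<union> (\<Union>j<n. Dset j (K * \<theta> ^ (n - j) * \<tau>))"
proof
  fix x assume "x \<in> Esc n \<tau>"
  then obtain w where w: "length w = n" "x \<in> cell \<alpha> C w" "brs \<alpha> w x \<in> escape (Wi w) \<tau>"
    by (auto simp: Esc_def words_def)
  then obtain v where v: "v \<in> {(\<tau>, 0), (-\<tau>, 0), (0, \<tau>), (0, -\<tau>)}" "brs \<alpha> w x + v \<notin> Wi w"
    by (auto simp: escape_def)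
  have nv: "norm v = \<tau>" using v(1) \<tau> by (auto simp: norm_Pair)
  define u where "u = ilbs \<alpha> w v"
  have "brs \<alpha> w (x + u) = brs \<alpha> w x + v" unfolding u_def by (rule brs_ilbs[OF \<alpha>])
  then have xu: "x + u \<notin> cell \<alpha> C w" using v(2) by (metis Wi_def imageI)
  have nu: "norm u \<le> K * \<theta> ^ n * \<tau>"
    unfolding u_def using contr[of "[]" w v] w nv by auto
  have Kp: "0 < K * \<theta> ^ m * \<tau>" for m using K \<theta> \<tau> by simp
  show "x \<in> Bd (K * \<theta> ^ n * \<tau>) \<union> (\<Union>j<n. Dset j (K * \<theta> ^ (n - j) * \<tau>))"
  proof (cases "x + u \<in> C")
    case False
    have "x \<in> C" using w(2) cell_subset[of \<alpha> C w] by blast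
    from Bd(3)[OF Kp this nu False] show ?thesis by blast
  next
    case True
    with xu obtain i where i: "i < n" "brs \<alpha> (take i w) (x + u) \<notin> half \<alpha> (w ! i)"
      using w(1) by (auto simp: cell_def)
    have xi: "brs \<alpha> (take i w) x \<in> half \<alpha> (w ! i)" using w i by (auto simp: cell_def)
    have split: "take i w @ drop i w = w" by simp
    have "u = ilbs \<alpha> (take i w) (ilbs \<alpha> (drop i w) v)"
      unfolding u_def by (metis split ilbs_append)
    then have "lbs \<alpha> (take i w) u = ilbs \<alpha> (drop i w) v" by (simp add: lbs_ilbs[OF \<alpha>])
    then have "\<bar>om \<alpha> (brs \<alpha> (take i w) x)\<bar> \<le> norm (ilbs \<alpha> (drop i w) v)"
      using half_separate[OF xi, of "lbs \<alpha> (take i w) u"] i(2) by (simp add: brs_add)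
    also have "\<dots> \<le> K * \<theta> ^ length (drop i w) * norm v"
      by (rule contr[of "take i w"]) (use w split in auto)
    finally have b: "\<bar>om \<alpha> (brs \<alpha> (take i w) x)\<bar> \<le> K * \<theta> ^ (n - i) * \<tau>" using w nv by simp
    have "x \<in> cell \<alpha> C (take i w)" using w(2) cell_append[of \<alpha> C "take i w" "drop i w"] by simp
    then have "x \<in> Dset i (K * \<theta> ^ (n - i) * \<tau>)"
    proof -
      have "take i w \<in> words i" using w i by (simp add: words_def)
      then show ?thesis unfolding Dset_def using b \<open>x \<in> cell \<alpha> C (take i w)\<close> by blast
    qed
    then show ?thesis using i by auto
  qed
qed

text \<open>A linear bound on the mass near the fold line at all earlier times is summed
  geometrically, so the result does not deteriorate with \<open>n\<close>.\<close>

lemma Esc_bound: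
  assumes \<tau>: "0 < \<tau>" and A: "0 \<le> A" "\<And>j s. j < n \<Longrightarrow> 0 < s \<Longrightarrow> emeasure lborel (Dset j s) \<le> ennreal (A * s)"
  shows "emeasure lborel (Esc n \<tau>) \<le> ennreal ((cB * K + A * (K / (1 - \<theta>))) * \<tau>)"
proof -
  have Kp: "0 < K * \<theta> ^ m * \<tau>" for m using K \<theta> \<tau> by simp
  have "emeasure lborel (Esc n \<tau>) \<le> emeasure lborel (Bd (K * \<theta> ^ n * \<tau>) \<union> (\<Union>j<n. Dset j (K * \<theta> ^ (n - j) * \<tau>)))"
    using Bd(1)[OF Kp[of n]] by (intro emeasure_mono Esc_subset[OF \<tau>]) auto
  also have "\<dots> \<le> emeasure lborel (Bd (K * \<theta> ^ n * \<tau>)) + emeasure lborel (\<Union>j<n. Dset j (K * \<theta> ^ (n - j) * \<tau>))"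
    using Bd(1)[OF Kp[of n]] by (intro emeasure_subadditive) auto
  also have "\<dots> \<le> ennreal (cB * (K * \<theta> ^ n * \<tau>)) + (\<Sum>j<n. emeasure lborel (Dset j (K * \<theta> ^ (n - j) * \<tau>)))"
    by (intro add_mono Bd(2) Kp emeasure_subadditive_finite) auto
  also have "\<dots> \<le> ennreal (cB * (K * \<theta> ^ n * \<tau>)) + (\<Sum>j<n. ennreal (A * (K * \<theta> ^ (n - j) * \<tau>)))"
    by (intro add_mono order_refl sum_mono A(2) Kp) auto
  also have "\<dots> = ennreal (cB * (K * \<theta> ^ n * \<tau>) + (\<Sum>j<n. A * (K * \<theta> ^ (n - j) * \<tau>)))"
    using A(1) Kp cB by (simp add: sum_nonneg less_imp_le ennreal_plus[symmetric] del: ennreal_plus)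
  also have "\<dots> \<le> ennreal ((cB * K + A * (K / (1 - \<theta>))) * \<tau>)"
  proof (rule ennreal_leI)
    have "(\<Sum>j<n. \<theta> ^ (n - j)) = (\<Sum>j<n. \<theta> ^ Suc j)"
      by (rule sum.reindex_bij_witness[of _ "\<lambda>j. n - Suc j" "\<lambda>j. n - Suc j"]) (auto simp: Suc_diff_Suc)
    also have "\<dots> \<le> (\<Sum>j<n. \<theta> ^ j)" using \<theta> by (intro sum_mono) (simp add: mult_left_le_one_le)
    also have "\<dots> = (1 - \<theta> ^ n) / (1 - \<theta>)" using \<theta> by (simp add: sum_gp_strict)
    also have "\<dots> \<le> 1 / (1 - \<theta>)" using \<theta> by (intro divide_right_mono) auto
    finally have g: "(\<Sum>j<n. \<theta> ^ (n - j)) \<le> 1 / (1 - \<theta>)" .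
    have "(\<Sum>j<n. A * (K * \<theta> ^ (n - j) * \<tau>)) = (A * K * \<tau>) * (\<Sum>j<n. \<theta> ^ (n - j))"
      by (simp add: sum_distrib_left mult_ac)
    also have "\<dots> \<le> (A * K * \<tau>) * (1 / (1 - \<theta>))"
      using A K \<tau> by (intro mult_left_mono g) auto
    finally have 1: "(\<Sum>j<n. A * (K * \<theta> ^ (n - j) * \<tau>)) \<le> (A * K * \<tau>) * (1 / (1 - \<theta>))" .
    have "cB * (K * \<theta> ^ n * \<tau>) \<le> cB * (K * 1 * \<tau>)"
      using cB K \<tau> \<theta> by (intro mult_left_mono mult_right_mono power_le_one) auto
    with 1 show "cB * (K * \<theta> ^ n * \<tau>) + (\<Sum>j<n. A * (K * \<theta> ^ (n - j) * \<tau>)) \<le> (cB * K + A * (K / (1 - \<theta>))) * \<tau>"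
      by (simp add: algebra_simps)
  qed
  finally show ?thesis .
qed

text \<open>The truncated kernel at \<open>p\<close> integrated against the push-forward of Lebesgue
  measure on \<open>C\<close> at time \<open>n\<close>, whose density is the sum over
  \<open>w\<close> of the indicators of \<open>Wi w\<close> divided by \<open>J ^ n\<close>.\<close>

definition Q :: "nat \<Rightarrow> real \<times> real \<Rightarrow> real \<Rightarrow> ennreal" where
  "Q n p \<tau> = (\<Sum>w\<in>words n. ennreal (1 / J ^ n) *
     (\<integral>\<^sup>+y. indicator (Wi w) y * ennreal (1 / max (supd y p) \<tau>) \<partial>lborel))"

lemma brs_in_Wi: "brs \<alpha> v y \<in> Wi (w @ v) \<longleftrightarrow> y \<in> Wi w \<and> y \<in> cell \<alpha> UNIV v"
proof
  assume "brs \<alpha> v y \<in> Wi (w @ v)"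
  then obtain x where x: "x \<in> cell \<alpha> C (w @ v)" "brs \<alpha> v y = brs \<alpha> v (brs \<alpha> w x)"
    by (auto simp: Wi_def brs_append)
  then have "y = brs \<alpha> w x" using inj_brs[OF \<alpha>] by blast
  then show "y \<in> Wi w \<and> y \<in> cell \<alpha> UNIV v" using x(1) by (auto simp: cell_append Wi_def)
next
  assume "y \<in> Wi w \<and> y \<in> cell \<alpha> UNIV v"
  then obtain x where x: "x \<in> cell \<alpha> C w" "y = brs \<alpha> w x" "y \<in> cell \<alpha> UNIV v" by (auto simp: Wi_def)
  then have "x \<in> cell \<alpha> C (w @ v)" by (auto simp: cell_append)
  then show "brs \<alpha> v y \<in> Wi (w @ v)" using x by (auto simp: Wi_def brs_append)
qed

lemma cell_nonempty: "y \<in> Wi w \<Longrightarrow> y \<in> cell \<alpha> UNIV v \<Longrightarrow> cell \<alpha> C (w @ v) \<noteq> {}"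
  using brs_in_Wi[of v y w] by (auto simp: Wi_def)

text \<open>Let \<open>q\<close> be the preimage of \<open>p\<close> under the word. Contraction of
  the inverse bounds the distance of \<open>y\<close> to \<open>q\<close> by
  \<open>2 * K * \<theta> ^ length v\<close> times the distance of the images, where 2 compares the
  norm with the maximum distance. Pulling the kernel back thus gains this factor and lowers the
  truncation scale by it.\<close>

lemma kernel_contr:
  assumes ne: "cell \<alpha> C (w @ v) \<noteq> {}" and \<tau>: "0 < \<tau>"
  shows "1 / max (supd (brs \<alpha> v y) p) \<tau> \<le>
     (2 * K * \<theta> ^ length v) * (1 / max (supd y (ilbs \<alpha> v (p - brs \<alpha> v 0))) (2 * K * \<theta> ^ length v * \<tau>))"
proof -
  define k where "k = 2 * K * \<theta> ^ length v"
  have k: "k > 0" using K \<theta> by (simp add: k_def)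
  define q where "q = ilbs \<alpha> v (p - brs \<alpha> v 0)"
  have q: "brs \<alpha> v q = p" unfolding q_def by (rule brs_preimage[OF \<alpha>])
  have "lbs \<alpha> v (y - q) = brs \<alpha> v y - p" using brs_add[of \<alpha> v q "y - q"] q by simp
  then have "y - q = ilbs \<alpha> v (brs \<alpha> v y - p)" using ilbs_lbs[OF \<alpha>, of v "y - q"] by simp
  then have "norm (y - q) \<le> K * \<theta> ^ length v * norm (brs \<alpha> v y - p)" using contr[OF ne] by simp
  also have "\<dots> \<le> K * \<theta> ^ length v * (2 * supd (brs \<alpha> v y) p)"
    using K \<theta> by (intro mult_left_mono norm_le_supd) auto
  finally have "supd y q \<le> k * supd (brs \<alpha> v y) p"
    using supd_le_norm[of y q] by (simp add: k_def)
  then have "max (supd y q) (k * \<tau>) \<le> k * max (supd (brs \<alpha> v y) p) \<tau>"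
    using k by (auto simp: max_def mult_left_mono intro: order_trans)
  moreover have "0 < max (supd y q) (k * \<tau>)" "0 < max (supd (brs \<alpha> v y) p) \<tau>" using k \<tau> by (auto simp: less_max_iff_disj)
  ultimately show ?thesis using k unfolding k_def[symmetric] q_def[symmetric]
    by (simp add: field_simps)
qed

text \<open>The kernel is pulled back over \<open>M\<close> letters and the Hardy inequality is
  applied at each preimage of \<open>p\<close>. With \<open>k = 2 * K * \<theta> ^ M\<close>, Hardy
  costs \<open>4 / (k * \<tau>)\<close> and the pull-back gains \<open>k\<close>; what is won is the
  smaller shift \<open>k * \<tau>\<close> in the escape set. There may be \<open>2 ^ M\<close>
  preimages, but every \<open>y\<close> lies in at most one cell of depth \<open>M\<close> and the
  Hardy balls are disjoint, so this number does not multiply the escape term.\<close>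

lemma Q_bound:
  "\<exists>R\<ge>0. \<forall>n \<tau>. 0 < \<tau> \<longrightarrow> Q (n + M) p \<tau> \<le>
     ennreal (4 / \<tau>) * emeasure lborel (Esc n (2 * K * \<theta> ^ M * \<tau>)) + ennreal R"
proof -
  define k where "k = 2 * K * \<theta> ^ M"
  have k: "k > 0" using K \<theta> by (simp add: k_def)
  define pv where "pv v = ilbs \<alpha> v (p - brs \<alpha> v 0)" for v
  define P where "P = pv ` words M"
  have fP: "finite P" by (simp add: P_def finite_words)
  obtain \<rho> where \<rho>: "\<rho> > 0" "disjoint_family_on (\<lambda>q. supball q \<rho>) P"
    using separated_supballs[OF fP] by blast
  show ?thesis
  \<comment> \<open>The 3 is made of \<open>1 / \<rho>\<close> for the kernel outside the balls and
    \<open>2 / \<rho>\<close> from the Hardy inequality inside them.\<close>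
  proof (intro exI[of _ "3 * k / \<rho>"] conjI allI impI)
    show "0 \<le> 3 * k / \<rho>" using k \<rho> by simp
    fix n and \<tau> :: real assume \<tau>: "0 < \<tau>"
    define F where "F z = ennreal (1 / max (supd z p) \<tau>)" for z
    have Fm[measurable]: "F \<in> borel_measurable borel" unfolding F_def by measurable
    define G where "G q y = ennreal (1 / max (supd y q) (k * \<tau>))" for q y
    have Gm[measurable]: "G q \<in> borel_measurable borel" for q unfolding G_def by measurable
    have inner: "(\<Sum>v\<in>words M. ennreal (1 / J ^ (n + M)) * (\<integral>\<^sup>+z. indicator (Wi (w @ v)) z * F z \<partial>lborel))
      \<le> ennreal (1 / J ^ n) * (ennreal (4 / \<tau>) * emeasure lborel (escape (Wi w) (k * \<tau>)) + ennreal (3 * k / \<rho>) * emeasure lborel (Wi w))"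
      if w: "w \<in> words n" for w
    proof -
      have cb[measurable]: "cell \<alpha> UNIV v \<in> sets borel" for v by (rule cell_borel) simp
      have "(\<Sum>v\<in>words M. ennreal (1 / J ^ (n + M)) * (\<integral>\<^sup>+z. indicator (Wi (w @ v)) z * F z \<partial>lborel))
         = (\<Sum>v\<in>words M. ennreal (1 / J ^ n) * (\<integral>\<^sup>+y. indicator (Wi w \<inter> cell \<alpha> UNIV v) y * F (brs \<alpha> v y) \<partial>lborel))"
      proof (rule sum.cong[OF refl])
        fix v assume v: "v \<in> words M"
        have "(\<integral>\<^sup>+z. indicator (Wi (w @ v)) z * F z \<partial>lborel)
          = ennreal (J ^ M) * (\<integral>\<^sup>+y. indicator (Wi (w @ v)) (brs \<alpha> v y) * F (brs \<alpha> v y) \<partial>lborel)"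
          using v by (subst nn_integral_brs[OF \<alpha>, where v=v]) (auto simp: words_def)
        also have "(\<lambda>y. indicator (Wi (w @ v)) (brs \<alpha> v y) * F (brs \<alpha> v y)) = (\<lambda>y. indicator (Wi w \<inter> cell \<alpha> UNIV v) y * F (brs \<alpha> v y))"
          by (auto simp: indicator_def brs_in_Wi fun_eq_iff)
        finally have e: "(\<integral>\<^sup>+z. indicator (Wi (w @ v)) z * F z \<partial>lborel)
          = ennreal (J ^ M) * (\<integral>\<^sup>+y. indicator (Wi w \<inter> cell \<alpha> UNIV v) y * F (brs \<alpha> v y) \<partial>lborel)" .
        have "ennreal (1 / J ^ (n + M)) * ennreal (J ^ M) = ennreal (1 / J ^ n)"
          using J by (simp add: ennreal_mult[symmetric] power_add)
        then show "ennreal (1 / J ^ (n + M)) * (\<integral>\<^sup>+z. indicator (Wi (w @ v)) z * F z \<partial>lborel)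
          = ennreal (1 / J ^ n) * (\<integral>\<^sup>+y. indicator (Wi w \<inter> cell \<alpha> UNIV v) y * F (brs \<alpha> v y) \<partial>lborel)"
          unfolding e by (simp only: mult.assoc[symmetric])
      qed
      also have "\<dots> = ennreal (1 / J ^ n) * (\<integral>\<^sup>+y. (\<Sum>v\<in>words M. indicator (Wi w \<inter> cell \<alpha> UNIV v) y * F (brs \<alpha> v y)) \<partial>lborel)"
        by (subst nn_integral_sum) (auto simp: sum_distrib_left)
      also have "\<dots> \<le> ennreal (1 / J ^ n) * (\<integral>\<^sup>+y. ennreal k * (ennreal (1 / \<rho>) * indicator (Wi w) y
          + (\<Sum>q\<in>P. indicator (Wi w \<inter> supball q \<rho>) y * G q y)) \<partial>lborel)"
      proof (intro mult_left_mono nn_integral_mono)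
        fix y
        show "(\<Sum>v\<in>words M. indicator (Wi w \<inter> cell \<alpha> UNIV v) y * F (brs \<alpha> v y))
          \<le> ennreal k * (ennreal (1 / \<rho>) * indicator (Wi w) y + (\<Sum>q\<in>P. indicator (Wi w \<inter> supball q \<rho>) y * G q y))"
        proof (cases "\<exists>v\<in>words M. y \<in> Wi w \<inter> cell \<alpha> UNIV v")
          case False
          then have "(\<Sum>v\<in>words M. indicator (Wi w \<inter> cell \<alpha> UNIV v) y * F (brs \<alpha> v y)) = 0"
            by (intro sum.neutral) (auto simp: indicator_def)
          then show ?thesis by simp
        next
          case True
          then obtain v where v: "v \<in> words M" "y \<in> Wi w" "y \<in> cell \<alpha> UNIV v" by auto
          have oth: "y \<notin> cell \<alpha> UNIV v'" if "v' \<in> words M" "v' \<noteq> v" for v'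
            using cell_disjoint[of v' v \<alpha> UNIV] that v by (auto simp: words_def)
          have "(\<Sum>v\<in>words M. indicator (Wi w \<inter> cell \<alpha> UNIV v) y * F (brs \<alpha> v y))
             = (\<Sum>v'\<in>{v}. indicator (Wi w \<inter> cell \<alpha> UNIV v') y * F (brs \<alpha> v' y))"
            by (rule sum.mono_neutral_right) (use v oth finite_words in \<open>auto simp: indicator_def\<close>)
          also have "\<dots> = F (brs \<alpha> v y)" using v by simp
          also have "\<dots> \<le> ennreal (k * (1 / max (supd y (pv v)) (k * \<tau>)))"
            unfolding F_def using kernel_contr[OF cell_nonempty[OF v(2,3)] \<tau>, of y p] v(1)
            by (intro ennreal_leI) (simp add: words_def k_def pv_def)
          also have "\<dots> = ennreal k * G (pv v) y" using k by (simp add: G_def ennreal_mult[symmetric] le_max_iff_disj \<tau> less_imp_le)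
          also have "G (pv v) y \<le> ennreal (1 / \<rho>) * indicator (Wi w) y + (\<Sum>q\<in>P. indicator (Wi w \<inter> supball q \<rho>) y * G q y)"
          proof (cases "y \<in> supball (pv v) \<rho>")
            case True
            then have "G (pv v) y = indicator (Wi w \<inter> supball (pv v) \<rho>) y * G (pv v) y" using v by simp
            also have "\<dots> \<le> (\<Sum>q\<in>P. indicator (Wi w \<inter> supball q \<rho>) y * G q y)"
              by (rule member_le_sum) (use v fP in \<open>auto simp: P_def\<close>)
            finally show ?thesis by (simp add: add_increasing)
          next
            case False
            then have "\<rho> \<le> max (supd y (pv v)) (k * \<tau>)" by (simp add: supball_def le_max_iff_disj)
            then have "G (pv v) y \<le> ennreal (1 / \<rho>)" unfolding G_def
              using \<rho> by (intro ennreal_leI divide_left_mono) auto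
            then show ?thesis using v by (simp add: add_increasing2)
          qed
          finally show ?thesis by (simp add: mult_left_mono)
        qed
      qed auto
      also have "(\<integral>\<^sup>+y. ennreal k * (ennreal (1 / \<rho>) * indicator (Wi w) y
          + (\<Sum>q\<in>P. indicator (Wi w \<inter> supball q \<rho>) y * G q y)) \<partial>lborel)
          = ennreal k * (ennreal (1 / \<rho>) * emeasure lborel (Wi w)
          + (\<Sum>q\<in>P. (\<integral>\<^sup>+y. indicator (Wi w \<inter> supball q \<rho>) y * G q y \<partial>lborel)))"
        by (simp add: nn_integral_cmult nn_integral_add nn_integral_sum)
      also have "\<dots> \<le> ennreal k * (ennreal (1 / \<rho>) * emeasure lborel (Wi w)
          + (\<Sum>q\<in>P. ennreal (4 / (k * \<tau>)) * emeasure lborel (escape (Wi w) (k * \<tau>) \<inter> supball q \<rho>)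
             + ennreal (2 / \<rho>) * emeasure lborel (Wi w \<inter> supball q \<rho>)))"
        unfolding G_def using k \<tau> \<rho>
        by (intro mult_left_mono add_mono order_refl sum_mono hardy_convex Wi_convex Wi_borel) auto
      also have "\<dots> \<le> ennreal k * (ennreal (1 / \<rho>) * emeasure lborel (Wi w)
          + (ennreal (4 / (k * \<tau>)) * emeasure lborel (escape (Wi w) (k * \<tau>)) + ennreal (2 / \<rho>) * emeasure lborel (Wi w)))"
      proof -
        have dis: "(\<Sum>q\<in>P. emeasure lborel (A \<inter> supball q \<rho>)) \<le> emeasure lborel A" if "A \<in> sets borel" for A
        proof -
          have "(\<Sum>q\<in>P. emeasure lborel (A \<inter> supball q \<rho>)) = emeasure lborel (\<Union>q\<in>P. A \<inter> supball q \<rho>)"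
          proof (rule sum_emeasure)
            show "disjoint_family_on (\<lambda>q. A \<inter> supball q \<rho>) P"
              by (rule disjoint_family_on_bisimulation[OF \<rho>(2)]) auto
          qed (use that fP in auto)
          also have "\<dots> \<le> emeasure lborel A" by (rule emeasure_mono) (use that in auto)
          finally show ?thesis .
        qed
        show ?thesis unfolding sum.distrib sum_distrib_left[symmetric]
          by (intro mult_left_mono add_mono order_refl dis) (auto simp: escape_borel)
      qed
      also have "\<dots> = ennreal (4 / \<tau>) * emeasure lborel (escape (Wi w) (k * \<tau>)) + ennreal (3 * k / \<rho>) * emeasure lborel (Wi w)"
      proof -
        have 1: "ennreal k * ennreal (4 / (k * \<tau>)) = ennreal (4 / \<tau>)"
          using k \<tau> by (simp add: ennreal_mult[symmetric])
        have 2: "ennreal k * (ennreal (1 / \<rho>) + ennreal (2 / \<rho>)) = ennreal (3 * k / \<rho>)"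
          using k \<rho> by (simp add: ennreal_mult[symmetric] ennreal_plus[symmetric] add_divide_distrib[symmetric] del: ennreal_plus)
        have alg: "c * (a * X + (b * Y + d * X)) = (c * b) * Y + (c * (a + d)) * X" for a b c d X Y :: ennreal
          by (simp add: distrib_left distrib_right mult.assoc add_ac)
        show ?thesis unfolding alg 1 2 ..
      qed
      finally show ?thesis by (simp add: mult_left_mono)
    qed
    have "Q (n + M) p \<tau> = (\<Sum>w\<in>words n. \<Sum>v\<in>words M. ennreal (1 / J ^ (n + M)) * (\<integral>\<^sup>+z. indicator (Wi (w @ v)) z * F z \<partial>lborel))"
      unfolding Q_def F_def by (rule sum_words_add)
    also have "\<dots> \<le> (\<Sum>w\<in>words n. ennreal (1 / J ^ n) * (ennreal (4 / \<tau>) * emeasure lborel (escape (Wi w) (k * \<tau>)) + ennreal (3 * k / \<rho>) * emeasure lborel (Wi w)))"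
      by (intro sum_mono inner)
    also have "\<dots> = ennreal (4 / \<tau>) * (\<Sum>w\<in>words n. ennreal (1 / J ^ n) * emeasure lborel (escape (Wi w) (k * \<tau>)))
        + ennreal (3 * k / \<rho>) * (\<Sum>w\<in>words n. ennreal (1 / J ^ n) * emeasure lborel (Wi w))"
    proof -
      have alg: "c * (a * X + b * Y) = a * (c * X) + b * (c * Y)" for a b c X Y :: ennreal
        by (simp add: distrib_left mult.left_commute)
      show ?thesis unfolding alg by (simp only: sum.distrib sum_distrib_left)
    qed
    also have "\<dots> \<le> ennreal (4 / \<tau>) * emeasure lborel (Esc n (k * \<tau>)) + ennreal (3 * k / \<rho>) * 1"
      by (intro add_mono mult_left_mono sum_escape_le sum_Wi_le) auto
    finally show "Q (n + M) p \<tau> \<le> ennreal (4 / \<tau>) * emeasure lborel (Esc n (2 * K * \<theta> ^ M * \<tau>)) + ennreal (3 * k / \<rho>)"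
      by (simp add: k_def)
  qed
qed

end

lemma supd_swap: "supd (prod.swap y) (prod.swap p) = supd y p"
  by (simp add: supd_def max.commute)

lemma escape_swap: "escape (prod.swap -` W) \<tau> = prod.swap -` escape W \<tau>"
  by (auto simp: escape_def prod.swap_def)

lemma poly_trace_swap:
  assumes F: "finite F" and R: "(0, 1, r1) \<in> F" and L: "(0, -1, r2) \<in> F"
  shows "\<exists>C>0. \<exists>V. finite V \<and> (\<forall>W S \<tau>. convex W \<longrightarrow> W \<in> sets borel \<longrightarrow> S \<subseteq> poly_set F \<longrightarrow> S \<in> sets borel \<longrightarrow>
     (\<forall>t. emeasure lborel {x. (t, x) \<in> S} \<le> ennreal \<tau>) \<longrightarrow> 0 < \<tau> \<longrightarrow> \<tau> \<le> 1 \<longrightarrow>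
     emeasure lborel (W \<inter> S) \<le> emeasure lborel (escape W \<tau> \<inter> poly_set F) + ennreal (C * \<tau>) *
       (\<integral>\<^sup>+y. indicator (W \<inter> poly_set F) y * ennreal (1 + (\<Sum>p\<in>V. 1 / max (supd y p) \<tau>)) \<partial>lborel))"
proof -
  let ?s = "prod.swap :: real \<times> real \<Rightarrow> real \<times> real"
  define F' where "F' = (\<lambda>(a, b, c). (b, a, c)) ` F"
  have F': "finite F'" "(1, 0, r1) \<in> F'" "(-1, 0, r2) \<in> F'"
    using assms by (force simp: F'_def)+
  have pF: "poly_set F' = ?s -` poly_set F"
    by (fastforce simp: poly_set_def F'_def add.commute add.left_commute case_prod_beta')
  have pb[measurable]: "poly_set F \<in> sets borel" by (rule poly_set_borel[OF F])
  obtain C V where C: "C > 0" "finite V" and t: "\<And>W S \<tau>. convex W \<Longrightarrow> W \<in> sets borel \<Longrightarrow> S \<subseteq> poly_set F' \<Longrightarrow> S \<in> sets borel \<Longrightarrow>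
     (\<And>t. emeasure lborel {x. (x, t) \<in> S} \<le> ennreal \<tau>) \<Longrightarrow> 0 < \<tau> \<Longrightarrow> \<tau> \<le> 1 \<Longrightarrow>
     emeasure lborel (W \<inter> S) \<le> emeasure lborel (escape W \<tau> \<inter> poly_set F') + ennreal (C * \<tau>) *
       (\<integral>\<^sup>+y. indicator (W \<inter> poly_set F') y * ennreal (1 + (\<Sum>p\<in>V. 1 / max (supd y p) \<tau>)) \<partial>lborel)"
    using poly_trace[OF F'] by blast
  show ?thesis
  proof (intro exI[of _ C] exI[of _ "?s ` V"] conjI allI impI)
    fix W S :: "(real \<times> real) set" and \<tau> :: real
    assume W: "convex W" "W \<in> sets borel" and S: "S \<subseteq> poly_set F" "S \<in> sets borel"
      and sl: "\<forall>t. emeasure lborel {x. (t, x) \<in> S} \<le> ennreal \<tau>" and \<tau>: "0 < \<tau>" "\<tau> \<le> 1"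
    note [measurable] = W(2) S(2)
    have "emeasure lborel (?s -` W \<inter> ?s -` S) \<le> emeasure lborel (escape (?s -` W) \<tau> \<inter> poly_set F') + ennreal (C * \<tau>) *
       (\<integral>\<^sup>+y. indicator (?s -` W \<inter> poly_set F') y * ennreal (1 + (\<Sum>p\<in>V. 1 / max (supd y p) \<tau>)) \<partial>lborel)"
      by (rule t) (use W S sl \<tau> in \<open>auto simp: convex_swap swap_borel pF\<close>)
    moreover have "emeasure lborel (?s -` W \<inter> ?s -` S) = emeasure lborel (W \<inter> S)"
      using emeasure_swap[of "W \<inter> S"] W S by (simp add: sets.Int)
    moreover have "emeasure lborel (escape (?s -` W) \<tau> \<inter> poly_set F') = emeasure lborel (escape W \<tau> \<inter> poly_set F)"
      unfolding escape_swap pF using emeasure_swap[of "escape W \<tau> \<inter> poly_set F"] escape_borel[OF W(2)] pb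
      by (simp add: sets.Int)
    moreover have "(\<integral>\<^sup>+y. indicator (?s -` W \<inter> poly_set F') y * ennreal (1 + (\<Sum>p\<in>V. 1 / max (supd y p) \<tau>)) \<partial>lborel)
        = (\<integral>\<^sup>+y. indicator (W \<inter> poly_set F) y * ennreal (1 + (\<Sum>p\<in>?s ` V. 1 / max (supd y p) \<tau>)) \<partial>lborel)"
    proof -
      have e: "(\<Sum>p\<in>?s ` V. 1 / max (supd (?s y) p) \<tau>) = (\<Sum>p\<in>V. 1 / max (supd y p) \<tau>)" for y
        by (subst sum.reindex) (auto simp: inj_on_def supd_swap)
      have "(\<integral>\<^sup>+y. indicator (W \<inter> poly_set F) y * ennreal (1 + (\<Sum>p\<in>?s ` V. 1 / max (supd y p) \<tau>)) \<partial>lborel)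
        = (\<integral>\<^sup>+y. indicator (W \<inter> poly_set F) (?s y) * ennreal (1 + (\<Sum>p\<in>?s ` V. 1 / max (supd (?s y) p) \<tau>)) \<partial>lborel)"
        by (rule nn_integral_lborel_swap[symmetric]) measurable
      then show ?thesis unfolding e pF by (simp add: indicator_def)
    qed
    ultimately show "emeasure lborel (W \<inter> S) \<le> emeasure lborel (escape W \<tau> \<inter> poly_set F) + ennreal (C * \<tau>) *
       (\<integral>\<^sup>+y. indicator (W \<inter> poly_set F) y * ennreal (1 + (\<Sum>p\<in>?s ` V. 1 / max (supd y p) \<tau>)) \<partial>lborel)"
      by simp
  qed (use C in auto)
qed

text \<open>The open box (-1, 2) x (-1, 2). It is larger than the unit square because
  \<open>poly_set\<close> has strict inequalities, and its sides are the bounding half-planes which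
  the chord estimates ask for.\<close>

definition box_constraints :: "(real \<times> real \<times> real) set" where
  "box_constraints = {(1, 0, -2), (-1, 0, -1), (0, 1, -2), (0, -1, -1)}"

lemma unit_square_poly: "unit_square \<subseteq> poly_set box_constraints"
  by (auto simp: unit_square_def poly_set_def box_constraints_def)

lemma cell_poly:
  assumes \<alpha>: "0 < \<alpha>" "\<alpha> < 1/2"
  shows "\<exists>F. finite F \<and> box_constraints \<subseteq> F \<and> poly_set F = poly_set box_constraints \<inter> cell \<alpha> UNIV v"
proof (induction v rule: rev_induct)
  case Nil
  then show ?case by (intro exI[of _ box_constraints]) (auto simp: box_constraints_def)
next
  case (snoc b v)
  then obtain F where F: "finite F" "box_constraints \<subseteq> F" "poly_set F = poly_set box_constraints \<inter> cell \<alpha> UNIV v" by auto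
  define f where "f = (if b then (oml \<alpha> (lbs \<alpha> v (1, 0)), oml \<alpha> (lbs \<alpha> v (0, 1)), om \<alpha> (brs \<alpha> v 0))
     else (- oml \<alpha> (lbs \<alpha> v (1, 0)), - oml \<alpha> (lbs \<alpha> v (0, 1)), - om \<alpha> (brs \<alpha> v 0)))"
  have h: "brs \<alpha> v y \<in> half \<alpha> b \<longleftrightarrow> fst f * fst y + fst (snd f) * snd y + snd (snd f) < 0" for y
    by (auto simp: half_def f_def om_brs[OF \<alpha>, of v y])
  have "poly_set (insert f F) = poly_set F \<inter> brs \<alpha> v -` half \<alpha> b"
    unfolding poly_set_def vimage_def h by auto
  then show ?case using F by (intro exI[of _ "insert f F"]) (auto simp: cell_snoc)
qed

lemma Gmap_unit_square:
  assumes "0 < \<alpha>" "\<alpha> < 1" "x \<in> unit_square"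
  shows "Gmap \<alpha> x \<in> unit_square"
proof -
  have x: "0 \<le> fst x" "fst x \<le> 1" "0 \<le> snd x" "snd x \<le> 1" using assms by (auto simp: unit_square_def)
  have "0 \<le> \<alpha> * snd x + (1 - \<alpha>) * fst x" using assms x by simp
  moreover have "\<alpha> * snd x + (1 - \<alpha>) * fst x \<le> \<alpha> * 1 + (1 - \<alpha>) * 1"
    using assms x by (intro add_mono mult_left_mono) auto
  ultimately show ?thesis using x by (auto simp: Gmap_def unit_square_def tent_def)
qed

lemma Gmap_iter_unit_square:
  assumes "0 < \<alpha>" "\<alpha> < 1" "x \<in> unit_square"
  shows "(Gmap \<alpha> ^^ n) x \<in> unit_square"
  by (induction n) (auto simp: assms intro: Gmap_unit_square)

context expanding_branches
begin

section \<open>Slope of the pulled-back fold function and thin strips\<close>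

lemma Wi_unit_square: "Wi w \<subseteq> unit_square"
proof
  fix y assume "y \<in> Wi w"
  then obtain x where x: "x \<in> cell \<alpha> C w" "y = brs \<alpha> w x" by (auto simp: Wi_def)
  then have "y = (Gmap \<alpha> ^^ length w) x" using Gmap_cell[OF \<alpha> x(1)] by simp
  moreover have "x \<in> unit_square" using x C cell_subset[of \<alpha> C w] by auto
  ultimately show "y \<in> unit_square" using Gmap_iter_unit_square[of \<alpha> x] \<alpha> by simp
qed

text \<open>Pull back along \<open>v\<close> a vector on which \<open>oml\<close> equals 1.
  Contraction makes it short, yet the fold function after \<open>v\<close> still changes by 1 along
  it, so one of its two partial derivatives is large.\<close>

lemma slope_bound:
  assumes ne: "cell \<alpha> C (w @ v) \<noteq> {}"
  defines "g \<equiv> (1 - \<alpha>) / (2 * K * \<theta> ^ length v)"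
  shows "g \<le> \<bar>oml \<alpha> (lbs \<alpha> v (1, 0))\<bar> \<or> g \<le> \<bar>oml \<alpha> (lbs \<alpha> v (0, 1))\<bar>"
proof (rule ccontr)
  assume "\<not> ?thesis"
  then have lt: "\<bar>oml \<alpha> (lbs \<alpha> v (1, 0))\<bar> < g" "\<bar>oml \<alpha> (lbs \<alpha> v (0, 1))\<bar> < g" by auto
  define u where "u = ilbs \<alpha> v (1 / (1 - \<alpha>), 0)"
  have "oml \<alpha> (lbs \<alpha> v u) = 1" unfolding u_def lbs_ilbs[OF \<alpha>] using \<alpha> by (simp add: oml_def)
  then have one: "oml \<alpha> (lbs \<alpha> v (1, 0)) * fst u + oml \<alpha> (lbs \<alpha> v (0, 1)) * snd u = 1"
    using oml_lbs[OF \<alpha>, of v u] by simp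
  have "norm u \<le> K * \<theta> ^ length v * norm (1 / (1 - \<alpha>), 0::real)" unfolding u_def by (rule contr[OF ne])
  also have "\<dots> = K * \<theta> ^ length v / (1 - \<alpha>)" using \<alpha> by (simp add: norm_Pair)
  finally have nu: "norm u \<le> K * \<theta> ^ length v / (1 - \<alpha>)" .
  have u: "\<bar>fst u\<bar> \<le> K * \<theta> ^ length v / (1 - \<alpha>)" "\<bar>snd u\<bar> \<le> K * \<theta> ^ length v / (1 - \<alpha>)"
    using nu norm_fst_le[of "fst u" "snd u"] norm_snd_le[of "snd u" "fst u"] by auto
  have B: "0 < K * \<theta> ^ length v / (1 - \<alpha>)" using K \<theta> \<alpha> by simp
  have "1 \<le> \<bar>oml \<alpha> (lbs \<alpha> v (1, 0))\<bar> * \<bar>fst u\<bar> + \<bar>oml \<alpha> (lbs \<alpha> v (0, 1))\<bar> * \<bar>snd u\<bar>"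
    using one by (metis abs_mult abs_one abs_triangle_ineq)
  also have "\<dots> \<le> \<bar>oml \<alpha> (lbs \<alpha> v (1, 0))\<bar> * (K * \<theta> ^ length v / (1 - \<alpha>)) + \<bar>oml \<alpha> (lbs \<alpha> v (0, 1))\<bar> * (K * \<theta> ^ length v / (1 - \<alpha>))"
    using u by (intro add_mono mult_left_mono) auto
  also have "\<dots> < g * (K * \<theta> ^ length v / (1 - \<alpha>)) + g * (K * \<theta> ^ length v / (1 - \<alpha>))"
    using lt B by (intro add_strict_mono mult_strict_right_mono) auto
  also have "\<dots> = 1"
  proof -
    have "g = 1 / (2 * (K * \<theta> ^ length v / (1 - \<alpha>)))" by (simp add: g_def)
    moreover have "1 / (2 * x) * x + 1 / (2 * x) * x = 1" if "0 < x" for x :: real using that by simp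
    ultimately show ?thesis using B by (simp only:)
  qed
  finally show False by simp
qed

lemma slice_strip:
  fixes a g s r :: real
  assumes "0 < g" "g \<le> \<bar>a\<bar>" "0 < s" "X \<subseteq> {x. \<bar>a * x + r\<bar> \<le> s}"
  shows "emeasure lborel X \<le> ennreal (2 * s / g)"
proof -
  have a: "a \<noteq> 0" using assms by auto
  have "X \<subseteq> {- r / a - s / \<bar>a\<bar>..- r / a + s / \<bar>a\<bar>}"
  proof
    fix x assume "x \<in> X"
    then have "\<bar>a * x + r\<bar> \<le> s" using assms by auto
    moreover have "\<bar>a * x + r\<bar> = \<bar>a\<bar> * \<bar>x + r / a\<bar>" using a by (simp add: abs_mult[symmetric] distrib_left)
    ultimately have "\<bar>x + r / a\<bar> \<le> s / \<bar>a\<bar>" using a by (simp add: field_simps)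
    then show "x \<in> {- r / a - s / \<bar>a\<bar>..- r / a + s / \<bar>a\<bar>}" by (auto simp: abs_le_iff)
  qed
  then have "emeasure lborel X \<le> emeasure lborel {- r / a - s / \<bar>a\<bar>..- r / a + s / \<bar>a\<bar>}"
    by (rule emeasure_mono) simp
  also have "\<dots> = ennreal (2 * (s / \<bar>a\<bar>))"
  proof -
    have "- r / a - s / \<bar>a\<bar> \<le> - r / a + s / \<bar>a\<bar>" using assms by simp
    then show ?thesis by simp
  qed
  also have "\<dots> \<le> ennreal (2 * s / g)"
  proof (rule ennreal_leI)
    have "s / \<bar>a\<bar> \<le> s / g" using assms by (intro divide_left_mono) auto
    then show "2 * (s / \<bar>a\<bar>) \<le> 2 * s / g" by simp
  qed
  finally show ?thesis .
qed

lemma sum_cells_le: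
  assumes "A \<in> sets borel"
  shows "(\<Sum>v\<in>words k. emeasure lborel (A \<inter> cell \<alpha> UNIV v)) \<le> emeasure lborel A"
proof -
  have cb: "cell \<alpha> UNIV v \<in> sets borel" for v by (rule cell_borel) simp
  have "(\<Sum>v\<in>words k. emeasure lborel (A \<inter> cell \<alpha> UNIV v)) = emeasure lborel (\<Union>v\<in>words k. A \<inter> cell \<alpha> UNIV v)"
  proof (rule sum_emeasure)
    show "disjoint_family_on (\<lambda>v. A \<inter> cell \<alpha> UNIV v) (words k)"
      unfolding disjoint_family_on_def using cell_disjoint[of _ _ \<alpha> UNIV] by (fastforce simp: words_def)
  qed (use assms cb finite_words in auto)
  also have "\<dots> \<le> emeasure lborel A" by (rule emeasure_mono) (use assms in auto)
  finally show ?thesis .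
qed

lemma sum_cells_integral_le:
  assumes "A \<in> sets borel" and [measurable]: "h \<in> borel_measurable borel"
  shows "(\<Sum>v\<in>words k. \<integral>\<^sup>+y. indicator (A \<inter> cell \<alpha> UNIV v) y * h y \<partial>lborel) \<le> (\<integral>\<^sup>+y. indicator A y * h y \<partial>lborel)"
proof -
  have cb[measurable]: "cell \<alpha> UNIV v \<in> sets borel" for v by (rule cell_borel) simp
  note [measurable] = assms(1)
  have "(\<Sum>v\<in>words k. \<integral>\<^sup>+y. indicator (A \<inter> cell \<alpha> UNIV v) y * h y \<partial>lborel)
      = (\<integral>\<^sup>+y. (\<Sum>v\<in>words k. indicator (A \<inter> cell \<alpha> UNIV v) y * h y) \<partial>lborel)"
    by (rule nn_integral_sum[symmetric]) measurable
  also have "\<dots> \<le> (\<integral>\<^sup>+y. indicator A y * h y \<partial>lborel)"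
  proof (rule nn_integral_mono)
    fix y
    show "(\<Sum>v\<in>words k. indicator (A \<inter> cell \<alpha> UNIV v) y * h y) \<le> indicator A y * h y"
    proof (cases "\<exists>v\<in>words k. y \<in> A \<inter> cell \<alpha> UNIV v")
      case False
      then have "(\<Sum>v\<in>words k. indicator (A \<inter> cell \<alpha> UNIV v) y * h y) = 0"
        by (intro sum.neutral) (auto simp: indicator_def)
      then show ?thesis by simp
    next
      case True
      then obtain v where v: "v \<in> words k" "y \<in> A" "y \<in> cell \<alpha> UNIV v" by auto
      have oth: "y \<notin> cell \<alpha> UNIV v'" if "v' \<in> words k" "v' \<noteq> v" for v'
        using cell_disjoint[of v' v \<alpha> UNIV] that v by (auto simp: words_def)
      have "(\<Sum>v\<in>words k. indicator (A \<inter> cell \<alpha> UNIV v) y * h y)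
         = (\<Sum>v'\<in>{v}. indicator (A \<inter> cell \<alpha> UNIV v') y * h y)"
        by (rule sum.mono_neutral_right) (use v oth finite_words in \<open>auto simp: indicator_def\<close>)
      then show ?thesis using v by simp
    qed
  qed
  finally show ?thesis .
qed

definition strip :: "bool list \<Rightarrow> real \<Rightarrow> (real \<times> real) set" where
  "strip v s = {y \<in> poly_set box_constraints \<inter> cell \<alpha> UNIV v. \<bar>om \<alpha> (brs \<alpha> v y)\<bar> \<le> s}"

text \<open>The value of \<tau> is \<open>2 * s / g\<close> with the slope bound \<open>g\<close>,
  that is, the length of the slices of the strip in a direction in which the fold function is steep;
  both directions are prepared. If \<open>w @ v\<close> does not occur there is no slope bound, but
  then \<open>Wi w\<close> misses the strip.\<close>

lemma strip_trace:
  "\<exists>Cv\<ge>0. \<exists>V. finite V \<and> (\<forall>w s \<tau>. 0 < s \<longrightarrow> \<tau> = 4 * K * \<theta> ^ length v / (1 - \<alpha>) * s \<longrightarrow> \<tau> \<le> 1 \<longrightarrow>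
     emeasure lborel (Wi w \<inter> strip v s) \<le> emeasure lborel (escape (Wi w) \<tau> \<inter> cell \<alpha> UNIV v)
       + ennreal (Cv * \<tau>) * (\<integral>\<^sup>+y. indicator (Wi w \<inter> cell \<alpha> UNIV v) y * ennreal (1 + (\<Sum>p\<in>V. 1 / max (supd y p) \<tau>)) \<partial>lborel))"
proof -
  obtain F where F: "finite F" "box_constraints \<subseteq> F" "poly_set F = poly_set box_constraints \<inter> cell \<alpha> UNIV v"
    using cell_poly[OF \<alpha>] by blast
  have cs: "(1, 0, -2) \<in> F" "(-1, 0, -1) \<in> F" "(0, 1, -2) \<in> F" "(0, -1, -1) \<in> F"
    using F(2) by (auto simp: box_constraints_def)
  obtain C1 V1 where 1: "C1 > 0" "finite V1" "\<And>W S \<tau>. convex W \<Longrightarrow> W \<in> sets borel \<Longrightarrow> S \<subseteq> poly_set F \<Longrightarrow> S \<in> sets borel \<Longrightarrow>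
     (\<And>t. emeasure lborel {x. (x, t) \<in> S} \<le> ennreal \<tau>) \<Longrightarrow> 0 < \<tau> \<Longrightarrow> \<tau> \<le> 1 \<Longrightarrow>
     emeasure lborel (W \<inter> S) \<le> emeasure lborel (escape W \<tau> \<inter> poly_set F) + ennreal (C1 * \<tau>) *
       (\<integral>\<^sup>+y. indicator (W \<inter> poly_set F) y * ennreal (1 + (\<Sum>p\<in>V1. 1 / max (supd y p) \<tau>)) \<partial>lborel)"
    using poly_trace[OF F(1) cs(1,2)] by blast
  obtain C2 V2 where 2: "C2 > 0" "finite V2" "\<And>W S \<tau>. convex W \<Longrightarrow> W \<in> sets borel \<Longrightarrow> S \<subseteq> poly_set F \<Longrightarrow> S \<in> sets borel \<Longrightarrow>
     (\<And>t. emeasure lborel {x. (t, x) \<in> S} \<le> ennreal \<tau>) \<Longrightarrow> 0 < \<tau> \<Longrightarrow> \<tau> \<le> 1 \<Longrightarrow>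
     emeasure lborel (W \<inter> S) \<le> emeasure lborel (escape W \<tau> \<inter> poly_set F) + ennreal (C2 * \<tau>) *
       (\<integral>\<^sup>+y. indicator (W \<inter> poly_set F) y * ennreal (1 + (\<Sum>p\<in>V2. 1 / max (supd y p) \<tau>)) \<partial>lborel)"
    using poly_trace_swap[OF F(1) cs(3,4)] by blast
  have cb[measurable]: "cell \<alpha> UNIV v \<in> sets borel" by (rule cell_borel) simp
  have pb[measurable]: "poly_set F \<in> sets borel" "poly_set box_constraints \<in> sets borel"
    by (rule poly_set_borel, fact F, rule poly_set_borel, simp add: box_constraints_def)
  show ?thesis
  proof (intro exI[of _ "C1 + C2"] exI[of _ "V1 \<union> V2"] conjI allI impI)
    fix w and s \<tau> :: real assume s: "0 < s" and \<tau>e: "\<tau> = 4 * K * \<theta> ^ length v / (1 - \<alpha>) * s" and \<tau>1: "\<tau> \<le> 1"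
    have \<tau>: "0 < \<tau>" using \<tau>e s K \<theta> \<alpha> by simp
    define H where "H = (\<integral>\<^sup>+y. indicator (Wi w \<inter> cell \<alpha> UNIV v) y * ennreal (1 + (\<Sum>p\<in>V1 \<union> V2. 1 / max (supd y p) \<tau>)) \<partial>lborel)"
    have mono: "ennreal (Ci * \<tau>) * (\<integral>\<^sup>+y. indicator (Wi w \<inter> poly_set F) y * ennreal (1 + (\<Sum>p\<in>Vi. 1 / max (supd y p) \<tau>)) \<partial>lborel)
        \<le> ennreal ((C1 + C2) * \<tau>) * H"
      if "Ci \<le> C1 + C2" "Vi \<subseteq> V1 \<union> V2" for Ci Vi
    proof (rule mult_mono)
      show "ennreal (Ci * \<tau>) \<le> ennreal ((C1 + C2) * \<tau>)" using that \<tau> by (intro ennreal_leI mult_right_mono) auto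
      show "(\<integral>\<^sup>+y. indicator (Wi w \<inter> poly_set F) y * ennreal (1 + (\<Sum>p\<in>Vi. 1 / max (supd y p) \<tau>)) \<partial>lborel) \<le> H"
        unfolding H_def
      proof (intro nn_integral_mono mult_mono ennreal_leI add_left_mono)
        fix y
        show "(\<Sum>p\<in>Vi. 1 / max (supd y p) \<tau>) \<le> (\<Sum>p\<in>V1 \<union> V2. 1 / max (supd y p) \<tau>)"
          using that 1(2) 2(2) \<tau> by (intro sum_mono2) (auto simp: le_max_iff_disj)
        show "(indicator (Wi w \<inter> poly_set F) y :: ennreal) \<le> indicator (Wi w \<inter> cell \<alpha> UNIV v) y"
          using F(3) by (auto simp: indicator_def)
      qed auto
    qed auto
    have S: "strip v s \<subseteq> poly_set F" "strip v s \<in> sets borel"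
      unfolding strip_def F(3) by auto
    have esc: "emeasure lborel (escape (Wi w) \<tau> \<inter> poly_set F) \<le> emeasure lborel (escape (Wi w) \<tau> \<inter> cell \<alpha> UNIV v)"
      using F(3) by (intro emeasure_mono sets.Int) (auto simp: escape_borel)
    show "emeasure lborel (Wi w \<inter> strip v s) \<le> emeasure lborel (escape (Wi w) \<tau> \<inter> cell \<alpha> UNIV v)
       + ennreal ((C1 + C2) * \<tau>) * (\<integral>\<^sup>+y. indicator (Wi w \<inter> cell \<alpha> UNIV v) y * ennreal (1 + (\<Sum>p\<in>V1 \<union> V2. 1 / max (supd y p) \<tau>)) \<partial>lborel)"
    proof (cases "cell \<alpha> C (w @ v) = {}")
      case True
      then have "Wi w \<inter> strip v s = {}" using cell_nonempty[of _ w v] by (auto simp: strip_def)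
      then show ?thesis by simp
    next
      case ne: False
      define g where "g = (1 - \<alpha>) / (2 * K * \<theta> ^ length v)"
      have g: "0 < g" "2 * s / g = \<tau>" using K \<theta> \<alpha> by (simp_all add: g_def \<tau>e)
      from slope_bound[OF ne] consider "g \<le> \<bar>oml \<alpha> (lbs \<alpha> v (1, 0))\<bar>" | "g \<le> \<bar>oml \<alpha> (lbs \<alpha> v (0, 1))\<bar>"
        unfolding g_def by blast
      then show ?thesis
      proof cases
        case a: 1
        have "emeasure lborel (Wi w \<inter> strip v s) \<le> emeasure lborel (escape (Wi w) \<tau> \<inter> poly_set F) + ennreal (C1 * \<tau>) *
          (\<integral>\<^sup>+y. indicator (Wi w \<inter> poly_set F) y * ennreal (1 + (\<Sum>p\<in>V1. 1 / max (supd y p) \<tau>)) \<partial>lborel)"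
        proof (rule 1(3)[OF Wi_convex Wi_borel S _ \<tau> \<tau>1])
          fix t
          have "{x. (x, t) \<in> strip v s} \<subseteq> {x. \<bar>oml \<alpha> (lbs \<alpha> v (1, 0)) * x + (oml \<alpha> (lbs \<alpha> v (0, 1)) * t + om \<alpha> (brs \<alpha> v 0))\<bar> \<le> s}"
            by (auto simp: strip_def om_brs[OF \<alpha>, of v "(_, t)"] add.assoc)
          from slice_strip[OF g(1) a s this] show "emeasure lborel {x. (x, t) \<in> strip v s} \<le> ennreal \<tau>"
            unfolding g(2) .
        qed
        also have "\<dots> \<le> emeasure lborel (escape (Wi w) \<tau> \<inter> cell \<alpha> UNIV v) + ennreal ((C1 + C2) * \<tau>) * H"
          using 2(1) by (intro add_mono esc mono) auto
        finally show ?thesis by (simp add: H_def)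
      next
        case a: 2
        have "emeasure lborel (Wi w \<inter> strip v s) \<le> emeasure lborel (escape (Wi w) \<tau> \<inter> poly_set F) + ennreal (C2 * \<tau>) *
          (\<integral>\<^sup>+y. indicator (Wi w \<inter> poly_set F) y * ennreal (1 + (\<Sum>p\<in>V2. 1 / max (supd y p) \<tau>)) \<partial>lborel)"
        proof (rule 2(3)[OF Wi_convex Wi_borel S _ \<tau> \<tau>1])
          fix t
          have "{x. (t, x) \<in> strip v s} \<subseteq> {x. \<bar>oml \<alpha> (lbs \<alpha> v (0, 1)) * x + (oml \<alpha> (lbs \<alpha> v (1, 0)) * t + om \<alpha> (brs \<alpha> v 0))\<bar> \<le> s}"
            by (auto simp: strip_def om_brs[OF \<alpha>, of v "(t, _)"] algebra_simps)
          from slice_strip[OF g(1) a s this] show "emeasure lborel {x. (t, x) \<in> strip v s} \<le> ennreal \<tau>"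
            unfolding g(2) .
        qed
        also have "\<dots> \<le> emeasure lborel (escape (Wi w) \<tau> \<inter> cell \<alpha> UNIV v) + ennreal ((C1 + C2) * \<tau>) * H"
          using 1(1) by (intro add_mono esc mono) auto
        finally show ?thesis by (simp add: H_def)
      qed
    qed
  qed (use 1 2 in auto)
qed

end

section \<open>The recursion for the mass near the fold line and its solution\<close>

context expanding_branches
begin

text \<open>Words of length \<open>n + k\<close> are split at time \<open>n\<close>, and each image
  piece \<open>Wi w\<close> is cut by the cells of the next \<open>k\<close> letters. These cells
  are disjoint, so summing the traces over them counts the boundary layer of \<open>Wi w\<close>
  once and not \<open>2 ^ k\<close> times.\<close>

lemma Dset_recursion:
  "\<exists>Cc\<ge>0. \<exists>V. finite V \<and> (\<forall>n s \<tau>. 0 < s \<longrightarrow> \<tau> = 4 * K * \<theta> ^ k / (1 - \<alpha>) * s \<longrightarrow> \<tau> \<le> 1 \<longrightarrow>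
     emeasure lborel (Dset (n + k) s) \<le> emeasure lborel (Esc n \<tau>) + ennreal (Cc * \<tau>) * (1 + (\<Sum>p\<in>V. Q n p \<tau>)))"
proof -
  define Pr where "Pr v c V \<longleftrightarrow> 0 \<le> c \<and> finite V \<and> (\<forall>w s \<tau>. 0 < s \<longrightarrow> \<tau> = 4 * K * \<theta> ^ length v / (1 - \<alpha>) * s \<longrightarrow> \<tau> \<le> 1 \<longrightarrow>
     emeasure lborel (Wi w \<inter> strip v s) \<le> emeasure lborel (escape (Wi w) \<tau> \<inter> cell \<alpha> UNIV v)
       + ennreal (c * \<tau>) * (\<integral>\<^sup>+y. indicator (Wi w \<inter> cell \<alpha> UNIV v) y * ennreal (1 + (\<Sum>p\<in>V. 1 / max (supd y p) \<tau>)) \<partial>lborel))"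
    for v c V
  have "\<exists>c V. Pr v c V" for v
    unfolding Pr_def using strip_trace[of v] by blast
  then obtain Cv Vv where Pr: "\<And>v. Pr v (Cv v) (Vv v)" by metis
  have cv: "0 \<le> Cv v" "finite (Vv v)" for v using Pr[of v] by (simp_all add: Pr_def)
  have tr: "emeasure lborel (Wi w \<inter> strip v s) \<le> emeasure lborel (escape (Wi w) \<tau> \<inter> cell \<alpha> UNIV v)
       + ennreal (Cv v * \<tau>) * (\<integral>\<^sup>+y. indicator (Wi w \<inter> cell \<alpha> UNIV v) y * ennreal (1 + (\<Sum>p\<in>Vv v. 1 / max (supd y p) \<tau>)) \<partial>lborel)"
    if "0 < s" "\<tau> = 4 * K * \<theta> ^ length v / (1 - \<alpha>) * s" "\<tau> \<le> 1" for v w s \<tau>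
    using Pr[of v] that unfolding Pr_def by blast
  define Cc where "Cc = (\<Sum>v\<in>words k. Cv v)"
  define V where "V = (\<Union>v\<in>words k. Vv v)"
  have fV: "finite V" using cv finite_words by (simp add: V_def)
  have Cc0: "0 \<le> Cc" unfolding Cc_def using cv by (intro sum_nonneg) auto
  show ?thesis
  proof (intro exI[of _ Cc] exI[of _ V] conjI allI impI Cc0 fV)
    fix n and s \<tau> :: real assume s: "0 < s" and \<tau>e: "\<tau> = 4 * K * \<theta> ^ k / (1 - \<alpha>) * s" and \<tau>1: "\<tau> \<le> 1"
    have \<tau>: "0 < \<tau>" using \<tau>e s K \<theta> \<alpha> by simp
    define h where "h y = ennreal (1 + (\<Sum>p\<in>V. 1 / max (supd y p) \<tau>))" for y
    have hm[measurable]: "h \<in> borel_measurable borel" unfolding h_def by measurable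
    have cb[measurable]: "cell \<alpha> UNIV v \<in> sets borel" for v by (rule cell_borel) simp
    have pb[measurable]: "poly_set box_constraints \<in> sets borel"
      by (rule poly_set_borel) (simp add: box_constraints_def)
    have sb[measurable]: "strip v s \<in> sets borel" for v unfolding strip_def by measurable
    have inner: "(\<Sum>v\<in>words k. emeasure lborel (Wi w \<inter> strip v s))
      \<le> emeasure lborel (escape (Wi w) \<tau>) + ennreal (Cc * \<tau>) * (\<integral>\<^sup>+y. indicator (Wi w) y * h y \<partial>lborel)" for w
    proof -
      have "(\<Sum>v\<in>words k. emeasure lborel (Wi w \<inter> strip v s))
        \<le> (\<Sum>v\<in>words k. emeasure lborel (escape (Wi w) \<tau> \<inter> cell \<alpha> UNIV v)
           + ennreal (Cc * \<tau>) * (\<integral>\<^sup>+y. indicator (Wi w \<inter> cell \<alpha> UNIV v) y * h y \<partial>lborel))"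
      proof (rule sum_mono)
        fix v assume v: "v \<in> words k"
        have "emeasure lborel (Wi w \<inter> strip v s) \<le> emeasure lborel (escape (Wi w) \<tau> \<inter> cell \<alpha> UNIV v)
           + ennreal (Cv v * \<tau>) * (\<integral>\<^sup>+y. indicator (Wi w \<inter> cell \<alpha> UNIV v) y * ennreal (1 + (\<Sum>p\<in>Vv v. 1 / max (supd y p) \<tau>)) \<partial>lborel)"
          by (rule tr) (use v s \<tau>e \<tau>1 in \<open>auto simp: words_def\<close>)
        also have "\<dots> \<le> emeasure lborel (escape (Wi w) \<tau> \<inter> cell \<alpha> UNIV v)
           + ennreal (Cc * \<tau>) * (\<integral>\<^sup>+y. indicator (Wi w \<inter> cell \<alpha> UNIV v) y * h y \<partial>lborel)"
        proof (intro add_left_mono mult_mono)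
          have "Cv v \<le> Cc" unfolding Cc_def by (rule member_le_sum) (use v cv finite_words in auto)
          then show "ennreal (Cv v * \<tau>) \<le> ennreal (Cc * \<tau>)" using \<tau> by (intro ennreal_leI mult_right_mono) auto
          show "(\<integral>\<^sup>+y. indicator (Wi w \<inter> cell \<alpha> UNIV v) y * ennreal (1 + (\<Sum>p\<in>Vv v. 1 / max (supd y p) \<tau>)) \<partial>lborel)
             \<le> (\<integral>\<^sup>+y. indicator (Wi w \<inter> cell \<alpha> UNIV v) y * h y \<partial>lborel)"
            unfolding h_def
          proof (intro nn_integral_mono mult_left_mono ennreal_leI add_left_mono)
            fix y
            show "(\<Sum>p\<in>Vv v. 1 / max (supd y p) \<tau>) \<le> (\<Sum>p\<in>V. 1 / max (supd y p) \<tau>)"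
              using v fV \<tau> by (intro sum_mono2) (auto simp: V_def le_max_iff_disj)
          qed auto
        qed auto
        finally show "emeasure lborel (Wi w \<inter> strip v s) \<le> emeasure lborel (escape (Wi w) \<tau> \<inter> cell \<alpha> UNIV v)
           + ennreal (Cc * \<tau>) * (\<integral>\<^sup>+y. indicator (Wi w \<inter> cell \<alpha> UNIV v) y * h y \<partial>lborel)" .
      qed
      also have "\<dots> \<le> emeasure lborel (escape (Wi w) \<tau>) + ennreal (Cc * \<tau>) * (\<integral>\<^sup>+y. indicator (Wi w) y * h y \<partial>lborel)"
        unfolding sum.distrib sum_distrib_left[symmetric]
        by (intro add_mono mult_left_mono sum_cells_le sum_cells_integral_le escape_borel Wi_borel hm) auto
      finally show ?thesis .
    qed
    have hint: "(\<integral>\<^sup>+y. indicator (Wi w) y * h y \<partial>lborel) = emeasure lborel (Wi w)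
        + (\<Sum>p\<in>V. \<integral>\<^sup>+y. indicator (Wi w) y * ennreal (1 / max (supd y p) \<tau>) \<partial>lborel)" for w
    proof -
      have "h y = 1 + (\<Sum>p\<in>V. ennreal (1 / max (supd y p) \<tau>))" for y
        unfolding h_def using \<tau> by (subst sum_ennreal) (auto simp: le_max_iff_disj sum_nonneg)
      then have "(\<integral>\<^sup>+y. indicator (Wi w) y * h y \<partial>lborel) = (\<integral>\<^sup>+y. indicator (Wi w) y
          + (\<Sum>p\<in>V. indicator (Wi w) y * ennreal (1 / max (supd y p) \<tau>)) \<partial>lborel)"
        by (simp add: distrib_left sum_distrib_left)
      also have "\<dots> = emeasure lborel (Wi w)
        + (\<Sum>p\<in>V. \<integral>\<^sup>+y. indicator (Wi w) y * ennreal (1 / max (supd y p) \<tau>) \<partial>lborel)"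
        by (simp add: nn_integral_add nn_integral_sum)
      finally show ?thesis .
    qed
    have "emeasure lborel (Dset (n + k) s) \<le> (\<Sum>u\<in>words (n + k). emeasure lborel {x \<in> cell \<alpha> C u. \<bar>om \<alpha> (brs \<alpha> u x)\<bar> \<le> s})"
      unfolding Dset_def by (rule emeasure_subadditive_finite) (auto simp: finite_words)
    also have "\<dots> = (\<Sum>w\<in>words n. \<Sum>v\<in>words k. emeasure lborel {x \<in> cell \<alpha> C (w @ v). \<bar>om \<alpha> (brs \<alpha> (w @ v) x)\<bar> \<le> s})"
      by (rule sum_words_add)
    also have "\<dots> \<le> (\<Sum>w\<in>words n. \<Sum>v\<in>words k. ennreal (1 / J ^ n) * emeasure lborel (Wi w \<inter> strip v s))"
    proof (intro sum_mono)
      fix w v assume w: "w \<in> words n"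
      have "{x \<in> cell \<alpha> C (w @ v). \<bar>om \<alpha> (brs \<alpha> (w @ v) x)\<bar> \<le> s} \<subseteq> cell \<alpha> C w \<inter> brs \<alpha> w -` strip v s"
      proof
        fix x assume "x \<in> {x \<in> cell \<alpha> C (w @ v). \<bar>om \<alpha> (brs \<alpha> (w @ v) x)\<bar> \<le> s}"
        then have x: "x \<in> cell \<alpha> C w" "brs \<alpha> w x \<in> cell \<alpha> UNIV v" "\<bar>om \<alpha> (brs \<alpha> v (brs \<alpha> w x))\<bar> \<le> s"
          by (auto simp: cell_append brs_append)
        then have "brs \<alpha> w x \<in> poly_set box_constraints"
          using Wi_unit_square[of w] unit_square_poly by (auto simp: Wi_def)
        then show "x \<in> cell \<alpha> C w \<inter> brs \<alpha> w -` strip v s" using x by (auto simp: strip_def)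
      qed
      then have "emeasure lborel {x \<in> cell \<alpha> C (w @ v). \<bar>om \<alpha> (brs \<alpha> (w @ v) x)\<bar> \<le> s} \<le> emeasure lborel (cell \<alpha> C w \<inter> brs \<alpha> w -` strip v s)"
        by (rule emeasure_mono) (use vimage_brs_borel[OF sb] in simp)
      then show "emeasure lborel {x \<in> cell \<alpha> C (w @ v). \<bar>om \<alpha> (brs \<alpha> (w @ v) x)\<bar> \<le> s} \<le> ennreal (1 / J ^ n) * emeasure lborel (Wi w \<inter> strip v s)"
        using emeasure_piece[OF sb, of w v] w by (simp add: words_def)
    qed
    also have "\<dots> \<le> (\<Sum>w\<in>words n. ennreal (1 / J ^ n) * (emeasure lborel (escape (Wi w) \<tau>) + ennreal (Cc * \<tau>) * (\<integral>\<^sup>+y. indicator (Wi w) y * h y \<partial>lborel)))"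
      unfolding sum_distrib_left[symmetric] by (intro sum_mono mult_left_mono inner) auto
    also have "\<dots> = (\<Sum>w\<in>words n. ennreal (1 / J ^ n) * emeasure lborel (escape (Wi w) \<tau>))
        + ennreal (Cc * \<tau>) * (\<Sum>w\<in>words n. ennreal (1 / J ^ n) * (\<integral>\<^sup>+y. indicator (Wi w) y * h y \<partial>lborel))"
    proof -
      have alg: "c * (X + b * Y) = c * X + b * (c * Y)" for b c X Y :: ennreal
        by (simp add: distrib_left mult.left_commute)
      show ?thesis unfolding alg by (simp only: sum.distrib sum_distrib_left)
    qed
    also have "(\<Sum>w\<in>words n. ennreal (1 / J ^ n) * (\<integral>\<^sup>+y. indicator (Wi w) y * h y \<partial>lborel))
       = (\<Sum>w\<in>words n. ennreal (1 / J ^ n) * emeasure lborel (Wi w)) + (\<Sum>p\<in>V. Q n p \<tau>)"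
      unfolding hint distrib_left sum.distrib sum_distrib_left Q_def by (subst (2) sum.swap) simp
    also have "(\<Sum>w\<in>words n. ennreal (1 / J ^ n) * emeasure lborel (escape (Wi w) \<tau>))
        + ennreal (Cc * \<tau>) * ((\<Sum>w\<in>words n. ennreal (1 / J ^ n) * emeasure lborel (Wi w)) + (\<Sum>p\<in>V. Q n p \<tau>))
       \<le> emeasure lborel (Esc n \<tau>) + ennreal (Cc * \<tau>) * (1 + (\<Sum>p\<in>V. Q n p \<tau>))"
      by (intro add_mono mult_left_mono sum_escape_le sum_Wi_le order_refl) auto
    finally show "emeasure lborel (Dset (n + k) s) \<le> emeasure lborel (Esc n \<tau>) + ennreal (Cc * \<tau>) * (1 + (\<Sum>p\<in>V. Q n p \<tau>))" .
  qed
qed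

lemma om_strip_le:
  assumes s: "0 < s"
  shows "emeasure lborel (unit_square \<inter> {y. \<bar>om \<alpha> y\<bar> \<le> s}) \<le> ennreal (4 * s)"
proof -
  let ?S = "unit_square \<inter> {y. \<bar>om \<alpha> y\<bar> \<le> s}"
  have ub: "unit_square \<in> sets borel"
    unfolding unit_square_def by (intro borel_closed closed_Times) auto
  have Sb: "?S \<in> sets borel"
    by (rule sets.Int[OF ub]) measurable
  have "emeasure lborel ?S = (\<integral>\<^sup>+y. indicator ?S y \<partial>lborel)" using Sb by simp
  also have "\<dots> = (\<integral>\<^sup>+t. (\<integral>\<^sup>+x. indicator ?S (x, t) \<partial>lborel) \<partial>lborel)"
    by (rule nn_integral_lborel_pair) (use Sb in simp)
  also have "\<dots> \<le> (\<integral>\<^sup>+t. ennreal (4 * s) * indicator {0..1} (t::real) \<partial>lborel)"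
  proof (rule nn_integral_mono)
    fix t :: real
    have "(\<integral>\<^sup>+x. indicator ?S (x, t) \<partial>lborel) = (\<integral>\<^sup>+x. indicator {x. (x, t) \<in> ?S} x \<partial>lborel)"
      by (intro nn_integral_cong) (auto simp: indicator_def)
    also have "\<dots> = emeasure lborel {x. (x, t) \<in> ?S}" using borel_slice1[OF Sb] by simp
    also have "\<dots> \<le> ennreal (4 * s) * indicator {0..1} t"
    proof (cases "t \<in> {0..1}")
      case True
      have "{x. (x, t) \<in> ?S} \<subseteq> {x. \<bar>(1 - \<alpha>) * x + (\<alpha> * t - 1/2)\<bar> \<le> s}"
        by (auto simp: om_def algebra_simps)
      from slice_strip[of "1/2" "1 - \<alpha>" s, OF _ _ s this] \<alpha> True show ?thesis by simp
    qed (auto simp: unit_square_def)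
    finally show "(\<integral>\<^sup>+x. indicator ?S (x, t) \<partial>lborel) \<le> ennreal (4 * s) * indicator {0..1} t" .
  qed
  also have "\<dots> = ennreal (4 * s)" by (subst nn_integral_cmult_indicator) auto
  finally show ?thesis .
qed

text \<open>A crude bound, exponential in \<open>n\<close>, which starts the induction at finitely
  many times: every word contributes at most the part of the unit square near the fold line.\<close>

lemma Dset_initial:
  assumes s: "0 < s"
  shows "emeasure lborel (Dset n s) \<le> ennreal (2 ^ n * 4 * s)"
proof -
  have ub: "unit_square \<in> sets borel"
    unfolding unit_square_def by (intro borel_closed closed_Times) auto
  have Sb: "{y. \<bar>om \<alpha> y\<bar> \<le> s} \<in> sets borel" by measurable
  have eq: "{x \<in> cell \<alpha> C w. \<bar>om \<alpha> (brs \<alpha> w x)\<bar> \<le> s} = cell \<alpha> C w \<inter> brs \<alpha> w -` {y. \<bar>om \<alpha> y\<bar> \<le> s}" for w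
    by auto
  have "emeasure lborel (Dset n s) \<le> (\<Sum>w\<in>words n. emeasure lborel {x \<in> cell \<alpha> C w. \<bar>om \<alpha> (brs \<alpha> w x)\<bar> \<le> s})"
    unfolding Dset_def by (rule emeasure_subadditive_finite) (auto simp: finite_words)
  also have "\<dots> \<le> (\<Sum>w\<in>words n. ennreal (4 * s))"
  proof (rule sum_mono)
    fix w assume "w \<in> words n"
    have "emeasure lborel {x \<in> cell \<alpha> C w. \<bar>om \<alpha> (brs \<alpha> w x)\<bar> \<le> s} = ennreal (1 / J ^ length w) * emeasure lborel (Wi w \<inter> {y. \<bar>om \<alpha> y\<bar> \<le> s})"
      unfolding eq by (rule emeasure_piece[OF Sb])
    also have "\<dots> \<le> 1 * emeasure lborel (Wi w \<inter> {y. \<bar>om \<alpha> y\<bar> \<le> s})"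
      using J by (intro mult_right_mono) (auto simp: ennreal_le_1 divide_le_eq one_le_power)
    also have "\<dots> \<le> emeasure lborel (unit_square \<inter> {y. \<bar>om \<alpha> y\<bar> \<le> s})"
      using Wi_unit_square[of w] ub Sb by (simp, intro emeasure_mono) auto
    also have "\<dots> \<le> ennreal (4 * s)" by (rule om_strip_le[OF s])
    finally show "emeasure lborel {x \<in> cell \<alpha> C w. \<bar>om \<alpha> (brs \<alpha> w x)\<bar> \<le> s} \<le> ennreal (4 * s)" .
  qed
  also have "\<dots> = of_nat (2 ^ n) * ennreal (4 * s)"
    using card_lists_length_eq[of "UNIV :: bool set" n] by (simp add: words_def)
  also have "\<dots> = ennreal (2 ^ n * 4 * s)"
    using s by (simp add: ennreal_mult mult.assoc ennreal_of_nat_eq_real_of_nat)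
  finally show ?thesis .
qed

lemma Dset_le_1: "emeasure lborel (Dset n s) \<le> 1"
proof -
  have "emeasure lborel (Dset n s) \<le> emeasure lborel C"
    using cell_subset[of \<alpha> C] C(2) by (intro emeasure_mono) (auto simp: Dset_def)
  then show ?thesis using C_emeasure_le by (rule order_trans)
qed

lemma power_small: "0 < e \<Longrightarrow> \<exists>k. c * \<theta> ^ k \<le> e"
proof -
  assume e: "0 < e"
  have "(\<lambda>k. c * \<theta> ^ k) \<longlonglongrightarrow> c * 0" using \<theta> by (intro tendsto_intros LIMSEQ_power_zero) auto
  then have "eventually (\<lambda>k. c * \<theta> ^ k < e) sequentially" using e by (intro order_tendstoD(2)) auto
  then obtain N where "\<And>n. n \<ge> N \<Longrightarrow> c * \<theta> ^ n < e" unfolding eventually_sequentially by blast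
  then show ?thesis by (intro exI[of _ N]) (simp add: less_imp_le)
qed

text \<open>The bound \<open>A * s\<close> reproduces itself under the recursion. The depth
  \<open>k\<close> makes the direct escape term a quarter of it; this choice fixes \<open>V\<close>
  and \<open>Cc\<close>, after which \<open>M\<close> makes the kernel terms contribute at most
  another quarter. All that remains is free of \<open>A\<close> and is covered by the other
  half.\<close>

lemma Dset_uniform: "\<exists>A\<ge>0. \<forall>n s. 0 < s \<longrightarrow> emeasure lborel (Dset n s) \<le> ennreal (A * s)"
proof -
  define a0 where "a0 = cB * K"
  define a1 where "a1 = K / (1 - \<theta>)"
  have a: "0 \<le> a0" "0 < a1" using cB K \<theta> by (auto simp: a0_def a1_def)
  obtain k where k: "(a1 * (4 * K / (1 - \<alpha>))) * \<theta> ^ k \<le> 1/4" using power_small[of "1/4" "a1 * (4 * K / (1 - \<alpha>))"] by auto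
  define \<kappa> where "\<kappa> = 4 * K * \<theta> ^ k / (1 - \<alpha>)"
  have \<kappa>: "0 < \<kappa>" "a1 * \<kappa> \<le> 1/4" using K \<theta> \<alpha> k by (simp_all add: \<kappa>_def mult_ac)
  obtain Cc V where Cc: "0 \<le> Cc" "finite V" and rec: "\<And>n s \<tau>. 0 < s \<Longrightarrow> \<tau> = \<kappa> * s \<Longrightarrow> \<tau> \<le> 1 \<Longrightarrow>
     emeasure lborel (Dset (n + k) s) \<le> emeasure lborel (Esc n \<tau>) + ennreal (Cc * \<tau>) * (1 + (\<Sum>p\<in>V. Q n p \<tau>))"
    using Dset_recursion[of k] unfolding \<kappa>_def by blast
  obtain M where M: "(Cc * \<kappa> * card V * 8 * K * a1) * \<theta> ^ M \<le> 1/4" using power_small[of "1/4" "Cc * \<kappa> * card V * 8 * K * a1"] by auto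
  define \<mu> where "\<mu> = 8 * K * \<theta> ^ M"
  have \<mu>: "0 < \<mu>" "Cc * \<kappa> * card V * (\<mu> * a1) \<le> 1/4" using K \<theta> M by (simp_all add: \<mu>_def mult_ac)
  have "\<forall>p. \<exists>R\<ge>0. \<forall>n \<tau>. 0 < \<tau> \<longrightarrow> Q (n + M) p \<tau> \<le>
     ennreal (4 / \<tau>) * emeasure lborel (Esc n (2 * K * \<theta> ^ M * \<tau>)) + ennreal R"
    using Q_bound by blast
  then obtain R where R: "\<And>p. (0::real) \<le> R p" and Qb: "\<And>p n \<tau>. 0 < \<tau> \<Longrightarrow> Q (n + M) p \<tau> \<le>
     ennreal (4 / \<tau>) * emeasure lborel (Esc n (2 * K * \<theta> ^ M * \<tau>)) + ennreal (R p)"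
    by metis
  define SR where "SR = (\<Sum>p\<in>V. R p)"
  have SR: "0 \<le> SR" unfolding SR_def by (intro sum_nonneg R)
  define B where "B = a0 * \<kappa> + Cc * \<kappa> * (1 + card V * (\<mu> * a0) + SR)"
  have B: "0 \<le> B" unfolding B_def using a \<kappa> \<mu> Cc SR by (intro add_nonneg_nonneg mult_nonneg_nonneg) auto
  define N where "N = k + M"
  \<comment> \<open>The summands absorb the terms free of \<open>A\<close>, the scales with
    \<open>\<kappa> * s > 1\<close>, where the total mass 1 is bound enough, and the times before
    \<open>N\<close>.\<close>
  define A where "A = 2 * B + \<kappa> + 2 ^ N * 4"
  have A: "0 \<le> A" "2 * B \<le> A" "\<kappa> \<le> A" "2 ^ N * 4 \<le> A" using B \<kappa> by (simp_all add: A_def)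
  have "\<forall>s. 0 < s \<longrightarrow> emeasure lborel (Dset n s) \<le> ennreal (A * s)" for n
  proof (induction n rule: less_induct)
    case (less n)
    show ?case
    proof (intro allI impI)
      fix s :: real assume s: "0 < s"
      show "emeasure lborel (Dset n s) \<le> ennreal (A * s)"
      proof (cases "n < N")
        case True
        have "(2::real) ^ n * 4 * s \<le> 2 ^ N * 4 * s" using s True by (intro mult_right_mono power_increasing) auto
        also have "\<dots> \<le> A * s" using A s by (intro mult_right_mono) auto
        finally show ?thesis using Dset_initial[OF s, of n] by (meson ennreal_leI order_trans)
      next
        case False
        define m where "m = n - N"
        have n: "n = (m + M) + k" using False by (simp add: m_def N_def)
        have Esc: "emeasure lborel (Esc j t) \<le> ennreal ((a0 + A * a1) * t)" if "j \<le> n" "0 < t" for j t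
          unfolding a0_def a1_def by (rule Esc_bound) (use that less A in auto)
        have X: "0 \<le> a0 + A * a1" using a A by simp
        show ?thesis
        proof (cases "\<kappa> * s \<le> 1")
          case False
          then have "1 \<le> A * s" using A(3) s by (smt (verit) mult_right_mono)
          then have "ennreal 1 \<le> ennreal (A * s)" by (rule ennreal_leI)
          then show ?thesis using Dset_le_1[of n s] by (auto intro: order_trans)
        next
          case True
          define \<tau> where "\<tau> = \<kappa> * s"
          have \<tau>: "0 < \<tau>" "\<tau> \<le> 1" using True \<kappa> s by (auto simp: \<tau>_def)
          have Q1: "Q (m + M) p \<tau> \<le> ennreal (\<mu> * (a0 + A * a1) + R p)" for p
          proof -
            have t: "0 < 2 * K * \<theta> ^ M * \<tau>" using K \<theta> \<tau> by simp
            have "Q (m + M) p \<tau> \<le> ennreal (4 / \<tau>) * ennreal ((a0 + A * a1) * (2 * K * \<theta> ^ M * \<tau>)) + ennreal (R p)"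
              by (rule order_trans[OF Qb[OF \<tau>(1)]]) (intro add_right_mono mult_left_mono Esc t, auto simp: n)
            also have "\<dots> = ennreal (4 / \<tau> * ((a0 + A * a1) * (2 * K * \<theta> ^ M * \<tau>)) + R p)"
            proof -
              have n1: "0 \<le> 4 / \<tau>" and n2: "0 \<le> (a0 + A * a1) * (2 * K * \<theta> ^ M * \<tau>)" using \<tau> X t by auto
              show ?thesis
                by (simp only: ennreal_mult[OF n1 n2] ennreal_plus[OF mult_nonneg_nonneg[OF n1 n2] R])
            qed
            also have "4 / \<tau> * ((a0 + A * a1) * (2 * K * \<theta> ^ M * \<tau>)) = \<mu> * (a0 + A * a1)"
              using \<tau> by (simp add: \<mu>_def)
            finally show ?thesis .
          qed
          have "emeasure lborel (Dset n s) \<le> emeasure lborel (Esc (m + M) \<tau>) + ennreal (Cc * \<tau>) * (1 + (\<Sum>p\<in>V. Q (m + M) p \<tau>))"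
            unfolding n by (rule rec[OF s \<tau>_def \<tau>(2)])
          also have "\<dots> \<le> ennreal ((a0 + A * a1) * \<tau>) + ennreal (Cc * \<tau>) * (1 + (\<Sum>p\<in>V. ennreal (\<mu> * (a0 + A * a1) + R p)))"
            by (intro add_mono mult_left_mono sum_mono Q1 Esc \<tau>) (auto simp: n)
          also have "\<dots> = ennreal ((a0 + A * a1) * \<tau> + Cc * \<tau> * (1 + (\<Sum>p\<in>V. \<mu> * (a0 + A * a1) + R p)))"
          proof -
            have p0: "0 \<le> \<mu> * (a0 + A * a1) + R p" for p using \<mu> X R by simp
            have "(\<Sum>p\<in>V. ennreal (\<mu> * (a0 + A * a1) + R p)) = ennreal (\<Sum>p\<in>V. \<mu> * (a0 + A * a1) + R p)"
              by (rule sum_ennreal) (use p0 in auto)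
            moreover have "0 \<le> (\<Sum>p\<in>V. \<mu> * (a0 + A * a1) + R p)" by (intro sum_nonneg p0)
            moreover have "ennreal c + ennreal d * (1 + ennreal e) = ennreal (c + d * (1 + e))"
              if "0 \<le> c" "0 \<le> d" "0 \<le> e" for c d e
              using that by (simp add: ennreal_plus ennreal_mult)
            ultimately show ?thesis using X \<tau> Cc by simp
          qed
          also have "\<dots> \<le> ennreal (A * s)"
          proof (rule ennreal_leI)
            have "(\<Sum>p\<in>V. \<mu> * (a0 + A * a1) + R p) = card V * (\<mu> * (a0 + A * a1)) + SR"
              by (simp add: sum.distrib SR_def)
            then have "(a0 + A * a1) * \<tau> + Cc * \<tau> * (1 + (\<Sum>p\<in>V. \<mu> * (a0 + A * a1) + R p))
              = (B + A * (a1 * \<kappa>) + A * (Cc * \<kappa> * card V * (\<mu> * a1))) * s"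
              by (simp add: B_def \<tau>_def algebra_simps)
            also have "\<dots> \<le> (A / 2 + A * (1/4) + A * (1/4)) * s"
              using s A \<kappa>(2) \<mu>(2) by (intro mult_right_mono add_mono mult_left_mono) auto
            finally show "(a0 + A * a1) * \<tau> + Cc * \<tau> * (1 + (\<Sum>p\<in>V. \<mu> * (a0 + A * a1) + R p)) \<le> A * s"
              by simp
          qed
          finally show ?thesis .
        qed
      qed
    qed
  qed
  then show ?thesis using A(1) by blast
qed

text \<open>The four shifted points span a diamond inside \<open>W\<close>, which contains a square
  of side \<tau> around \<open>y\<close>: each point of the square is the midpoint of a point on the
  horizontal and a point on the vertical diagonal.\<close>

lemma escape_free_area:
  assumes W: "convex W" "W \<in> sets borel" and \<tau>: "0 < \<tau>" and y: "y \<in> W" "y \<notin> escape W \<tau>"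
  shows "ennreal (\<tau>\<^sup>2) \<le> emeasure lborel W"
proof -
  obtain y1 y2 where yy: "y = (y1, y2)" by (cases y)
  have pt: "(y1 + \<tau>, y2) \<in> W" "(y1 - \<tau>, y2) \<in> W" "(y1, y2 + \<tau>) \<in> W" "(y1, y2 - \<tau>) \<in> W"
    using y by (auto simp: escape_def yy)
  have sub: "cbox (y1 - \<tau>/2, y2 - \<tau>/2) (y1 + \<tau>/2, y2 + \<tau>/2) \<subseteq> W"
  proof
    fix z assume "z \<in> cbox (y1 - \<tau>/2, y2 - \<tau>/2) (y1 + \<tau>/2, y2 + \<tau>/2)"
    then obtain a b where z: "z = (y1 + a, y2 + b)" and ab: "\<bar>a\<bar> \<le> \<tau>/2" "\<bar>b\<bar> \<le> \<tau>/2"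
    proof -
      assume zz: "z \<in> cbox (y1 - \<tau>/2, y2 - \<tau>/2) (y1 + \<tau>/2, y2 + \<tau>/2)"
        and th: "\<And>a b. z = (y1 + a, y2 + b) \<Longrightarrow> \<bar>a\<bar> \<le> \<tau>/2 \<Longrightarrow> \<bar>b\<bar> \<le> \<tau>/2 \<Longrightarrow> thesis"
      have "y1 - \<tau>/2 \<le> fst z" "fst z \<le> y1 + \<tau>/2" "y2 - \<tau>/2 \<le> snd z" "snd z \<le> y2 + \<tau>/2"
        using zz by (auto simp: cbox_Pair_eq)
      then have "\<bar>fst z - y1\<bar> \<le> \<tau>/2" "\<bar>snd z - y2\<bar> \<le> \<tau>/2" by linarith+
      then show thesis by (intro th[of "fst z - y1" "snd z - y2"]) auto
    qed
    define P where "P = (if 0 \<le> a then (y1 + \<tau>, y2) else (y1 - \<tau>, y2))"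
    define R where "R = (if 0 \<le> b then (y1, y2 + \<tau>) else (y1, y2 - \<tau>))"
    define u where "u = \<bar>a\<bar> / \<tau>"
    define v where "v = \<bar>b\<bar> / \<tau>"
    have uv: "0 \<le> u" "u \<le> 1/2" "0 \<le> v" "v \<le> 1/2" using ab \<tau> by (auto simp: u_def v_def field_simps)
    have "P \<in> W" "R \<in> W" "(y1, y2) \<in> W" using pt y by (auto simp: P_def R_def yy)
    have m: "(2 * u) *\<^sub>R P + (1 - 2 * u) *\<^sub>R (y1, y2) \<in> W" "(2 * v) *\<^sub>R R + (1 - 2 * v) *\<^sub>R (y1, y2) \<in> W"
      by (rule convexD[OF W(1) \<open>P \<in> W\<close> \<open>(y1, y2) \<in> W\<close>] convexD[OF W(1) \<open>R \<in> W\<close> \<open>(y1, y2) \<in> W\<close>];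
          use uv in simp)+
    have "(1/2::real) *\<^sub>R ((2 * u) *\<^sub>R P + (1 - 2 * u) *\<^sub>R (y1, y2)) + (1/2) *\<^sub>R ((2 * v) *\<^sub>R R + (1 - 2 * v) *\<^sub>R (y1, y2)) \<in> W"
      by (rule convexD[OF W(1) m]) auto
    moreover have "(1/2::real) *\<^sub>R ((2 * u) *\<^sub>R P + (1 - 2 * u) *\<^sub>R (y1, y2)) + (1/2) *\<^sub>R ((2 * v) *\<^sub>R R + (1 - 2 * v) *\<^sub>R (y1, y2)) = z"
    proof -
      have ua: "u * \<tau> = \<bar>a\<bar>" "v * \<tau> = \<bar>b\<bar>" using \<tau> by (auto simp: u_def v_def)
      show ?thesis using ua by (auto simp: z P_def R_def algebra_simps abs_if split: if_splits)
    qed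
    ultimately show "z \<in> W" by simp
  qed
  have "emeasure lborel (cbox (y1 - \<tau>/2, y2 - \<tau>/2) (y1 + \<tau>/2, y2 + \<tau>/2)) = ennreal (\<tau>\<^sup>2)"
  proof -
    have "(\<Prod>b\<in>(Basis :: (real \<times> real) set). ((y1 + \<tau>/2, y2 + \<tau>/2) - (y1 - \<tau>/2, y2 - \<tau>/2)) \<bullet> b) = \<tau>\<^sup>2"
      by (simp add: Basis_prod_def prod.union_disjoint power2_eq_square)
    moreover have "(y1 - \<tau>/2, y2 - \<tau>/2) \<bullet> b \<le> (y1 + \<tau>/2, y2 + \<tau>/2) \<bullet> b" if "b \<in> Basis" for b
      using that \<tau> by (auto simp: Basis_prod_def)
    ultimately show ?thesis by (subst emeasure_lborel_cbox) auto
  qed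
  then show ?thesis using emeasure_mono[OF sub, of lborel] W by simp
qed

text \<open>The points in boundary layers cost \<open>B * \<tau>\<close>. A piece not exhausted by
  its layer has area at least the square of \<tau>, so \<open>E\<close> occupies at most the area of
  \<open>E\<close> divided by that square as a fraction of the piece, and the weighted areas of all
  pieces sum to at most one. Taking first \<tau> and then \<open>E\<close> small gives absolute
  continuity uniformly in \<open>n\<close>.\<close>

lemma visits_uniform:
  "\<exists>B\<ge>0. \<forall>n E \<tau>. E \<in> sets borel \<longrightarrow> 0 < \<tau> \<longrightarrow>
     emeasure lborel (\<Union>w\<in>words n. cell \<alpha> C w \<inter> brs \<alpha> w -` E) \<le> ennreal (B * \<tau>) + ennreal (1 / \<tau>\<^sup>2) * emeasure lborel E"
proof -
  obtain A where A: "0 \<le> A" "\<And>n s. 0 < s \<Longrightarrow> emeasure lborel (Dset n s) \<le> ennreal (A * s)"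
    using Dset_uniform by blast
  define B where "B = cB * K + A * (K / (1 - \<theta>))"
  have B: "0 \<le> B" using A cB K \<theta> by (simp add: B_def)
  show ?thesis
  proof (intro exI[of _ B] conjI allI impI B)
    fix n and E :: "(real \<times> real) set" and \<tau> :: real assume E[measurable]: "E \<in> sets borel" and \<tau>: "0 < \<tau>"
    define T where "T = (\<Union>w\<in>words n. cell \<alpha> C w \<inter> brs \<alpha> w -` (E - escape (Wi w) \<tau>))"
    have eb[measurable]: "escape (Wi w) \<tau> \<in> sets borel" for w by (rule escape_borel) simp
    have pm[measurable]: "cell \<alpha> C w \<inter> brs \<alpha> w -` (E - escape (Wi w) \<tau>) \<in> sets borel" for w
      by (intro sets.Int cell_bo vimage_brs_borel sets.Diff E eb)
    have Tb: "T \<in> sets borel"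
      unfolding T_def using finite_words by (intro sets.finite_UN pm) auto
    have "(\<Union>w\<in>words n. cell \<alpha> C w \<inter> brs \<alpha> w -` E) \<subseteq> Esc n \<tau> \<union> T"
      by (auto simp: Esc_def T_def)
    then have "emeasure lborel (\<Union>w\<in>words n. cell \<alpha> C w \<inter> brs \<alpha> w -` E) \<le> emeasure lborel (Esc n \<tau> \<union> T)"
      using Tb by (intro emeasure_mono) auto
    also have "\<dots> \<le> emeasure lborel (Esc n \<tau>) + emeasure lborel T"
      using Tb by (intro emeasure_subadditive) auto
    also have "\<dots> \<le> ennreal (B * \<tau>) + ennreal (1 / \<tau>\<^sup>2) * emeasure lborel E"
    proof (rule add_mono)
      show "emeasure lborel (Esc n \<tau>) \<le> ennreal (B * \<tau>)"
        unfolding B_def by (rule Esc_bound[OF \<tau>]) (use A in auto)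
      have "emeasure lborel T \<le> (\<Sum>w\<in>words n. emeasure lborel (cell \<alpha> C w \<inter> brs \<alpha> w -` (E - escape (Wi w) \<tau>)))"
        unfolding T_def by (rule emeasure_subadditive_finite) (use finite_words pm in auto)
      also have "\<dots> = (\<Sum>w\<in>words n. ennreal (1 / J ^ n) * emeasure lborel (Wi w \<inter> (E - escape (Wi w) \<tau>)))"
        by (intro sum.cong refl) (simp add: emeasure_piece words_def)
      also have "\<dots> \<le> (\<Sum>w\<in>words n. (ennreal (1 / \<tau>\<^sup>2) * emeasure lborel E) * (ennreal (1 / J ^ n) * emeasure lborel (Wi w)))"
      proof (rule sum_mono)
        fix w
        show "ennreal (1 / J ^ n) * emeasure lborel (Wi w \<inter> (E - escape (Wi w) \<tau>))
          \<le> (ennreal (1 / \<tau>\<^sup>2) * emeasure lborel E) * (ennreal (1 / J ^ n) * emeasure lborel (Wi w))"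
        proof (cases "Wi w \<subseteq> escape (Wi w) \<tau>")
          case True
          then have "Wi w \<inter> (E - escape (Wi w) \<tau>) = {}" by auto
          then show ?thesis by simp
        next
          case False
          then obtain y where "y \<in> Wi w" "y \<notin> escape (Wi w) \<tau>" by auto
          from escape_free_area[OF Wi_convex Wi_borel \<tau> this]
          have ar: "ennreal (\<tau>\<^sup>2) \<le> emeasure lborel (Wi w)" .
          have "emeasure lborel (Wi w \<inter> (E - escape (Wi w) \<tau>)) \<le> emeasure lborel E"
            by (rule emeasure_mono) auto
          also have "\<dots> = emeasure lborel E * (ennreal (1 / \<tau>\<^sup>2) * ennreal (\<tau>\<^sup>2))"
            using \<tau> by (simp add: ennreal_mult[symmetric])
          also have "\<dots> \<le> emeasure lborel E * (ennreal (1 / \<tau>\<^sup>2) * emeasure lborel (Wi w))"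
            by (intro mult_left_mono ar) auto
          finally have "ennreal (1 / J ^ n) * emeasure lborel (Wi w \<inter> (E - escape (Wi w) \<tau>))
             \<le> ennreal (1 / J ^ n) * (emeasure lborel E * (ennreal (1 / \<tau>\<^sup>2) * emeasure lborel (Wi w)))"
            by (rule mult_left_mono) auto
          also have "\<dots> = (ennreal (1 / \<tau>\<^sup>2) * emeasure lborel E) * (ennreal (1 / J ^ n) * emeasure lborel (Wi w))"
            by (simp only: mult.assoc mult.commute mult.left_commute)
          finally show ?thesis .
        qed
      qed
      also have "\<dots> = (ennreal (1 / \<tau>\<^sup>2) * emeasure lborel E) * (\<Sum>w\<in>words n. ennreal (1 / J ^ n) * emeasure lborel (Wi w))"
        by (rule sum_distrib_left[symmetric])
      also have "\<dots> \<le> (ennreal (1 / \<tau>\<^sup>2) * emeasure lborel E) * 1"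
        by (intro mult_left_mono sum_Wi_le) auto
      finally show "emeasure lborel T \<le> ennreal (1 / \<tau>\<^sup>2) * emeasure lborel E" by simp
    qed
    finally show "emeasure lborel (\<Union>w\<in>words n. cell \<alpha> C w \<inter> brs \<alpha> w -` E) \<le> ennreal (B * \<tau>) + ennreal (1 / \<tau>\<^sup>2) * emeasure lborel E" .
  qed
qed

end

section \<open>Invariant measures from uniform contraction\<close>

lemma unit_square_borel [measurable]: "unit_square \<in> sets borel"
  unfolding unit_square_def by (intro borel_closed closed_Times) auto

lemma emeasure_unit_square: "emeasure lborel unit_square = 1"
proof -
  have u: "unit_square = cbox (0, 0) (1, 1)" by (auto simp: unit_square_def cbox_Pair_eq)
  have "(0, 0) \<bullet> i \<le> (1, 1) \<bullet> i" if "i \<in> Basis" for i :: "real \<times> real"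
    using that by (auto simp: Basis_prod_def)
  moreover have "(\<Prod>i\<in>(Basis :: (real \<times> real) set). ((1, 1) - (0, 0)) \<bullet> i) = 1"
    by (simp add: Basis_prod_def prod.union_disjoint)
  ultimately show ?thesis unfolding u by (subst emeasure_lborel_cbox) auto
qed

lemma sets_leb_square: "A \<in> sets leb_square \<longleftrightarrow> A \<in> sets borel \<and> A \<subseteq> unit_square"
  unfolding leb_square_def by (subst sets_restrict_space_iff) auto

lemma space_leb_square: "space leb_square = unit_square"
  by (simp add: leb_square_def space_restrict_space)

lemma emeasure_leb_square: "A \<in> sets borel \<Longrightarrow> A \<subseteq> unit_square \<Longrightarrow> emeasure leb_square A = emeasure lborel A"
  unfolding leb_square_def by (subst emeasure_restrict_space) auto

lemma finite_leb_square: "finite_measure leb_square"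
  by (rule finite_measureI) (simp add: space_leb_square emeasure_leb_square emeasure_unit_square)

lemma tent_measurable [measurable]: "tent \<in> borel_measurable borel"
  unfolding tent_def[abs_def] by measurable

lemma Gmap_borel [measurable]: "Gmap \<alpha> \<in> borel_measurable borel"
  unfolding Gmap_def[abs_def] by measurable

lemma Gmap_measurable:
  assumes "0 < \<alpha>" "\<alpha> < 1"
  shows "Gmap \<alpha> \<in> measurable leb_square leb_square"
  unfolding leb_square_def
  by (rule measurable_restrict_space3) (use assms Gmap_unit_square in auto)

lemma (in expanding_branches) acim_exists:
  assumes pos: "0 < emeasure lborel C"
  shows "\<exists>\<mu>. sets \<mu> = sets leb_square \<and> prob_space \<mu> \<and> absolutely_continuous leb_square \<mu> \<and>
     Gmap \<alpha> \<in> measurable \<mu> \<mu> \<and> distr \<mu> \<mu> (Gmap \<alpha>) = \<mu>"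
proof -
  let ?G = "Gmap \<alpha>"
  have Gm: "?G \<in> measurable leb_square leb_square" by (rule Gmap_measurable) (use \<alpha> in auto)
  have CU: "C \<in> sets leb_square" using C by (simp add: sets_leb_square)
  have eC: "emeasure leb_square C = emeasure lborel C" by (rule emeasure_leb_square[OF C(2,3)])
  have fC: "emeasure lborel C \<noteq> \<infinity>" using C_emeasure_le by (auto simp: top_unique)
  define c where "c = measure lborel C"
  have c: "0 < c" "emeasure lborel C = ennreal c"
    using pos fC by (auto simp: c_def emeasure_eq_ennreal_measure zero_less_measure_iff)
  define \<nu> where "\<nu> n = ((\<lambda>N. distr N leb_square ?G) ^^ n) (uniform_measure leb_square C)" for n
  have nu0: "\<nu> 0 = uniform_measure leb_square C" and nuS: "\<nu> (Suc n) = distr (\<nu> n) leb_square ?G" for n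
    by (simp_all add: \<nu>_def)
  have sets: "sets (\<nu> n) = sets leb_square" for n by (cases n) (simp_all add: nu0 nuS)
  have Gm': "?G \<in> measurable (\<nu> n) leb_square" for n
    using Gm by (simp add: measurable_cong_sets[OF sets refl])
  have prob: "prob_space (\<nu> n)" for n
  proof (induction n)
    case 0
    show ?case unfolding nu0 by (rule prob_space_uniform_measure) (use pos fC eC in auto)
  next
    case (Suc n)
    then show ?case unfolding nuS by (rule prob_space.prob_space_distr[OF _ Gm'])
  qed
  have GU: "(?G ^^ n) x \<in> unit_square" if "x \<in> C" for n x
    using Gmap_iter_unit_square[of \<alpha> x n] that C \<alpha> by auto
  have pre: "(?G ^^ n) -` A \<inter> unit_square \<in> sets leb_square" if "A \<in> sets leb_square" for n A
  proof -
    have "(?G ^^ n) \<in> measurable leb_square leb_square" by (rule measurable_compose_n[OF Gm])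
    from measurable_sets[OF this that] show ?thesis by (simp add: space_leb_square)
  qed
  \<comment> \<open>The iterated push-forwards are rewritten as visits of points of
    \<open>C\<close>, the form in which the cells can be used.\<close>
  have nu: "emeasure (\<nu> n) A = emeasure lborel (C \<inter> (?G ^^ n) -` A) / ennreal c" if A: "A \<in> sets leb_square" for n A
    using A
  proof (induction n arbitrary: A)
    case 0
    have "C \<inter> A \<in> sets borel" "C \<inter> A \<subseteq> unit_square" using C 0 by (auto simp: sets_leb_square)
    then show ?case using 0 CU
      by (simp add: nu0 emeasure_uniform_measure eC c emeasure_leb_square funpow_0[unfolded id_def])
  next
    case (Suc n)
    have B: "?G -` A \<inter> unit_square \<in> sets leb_square"
      using measurable_sets[OF Gm Suc.prems] by (simp add: space_leb_square)
    have "emeasure (\<nu> (Suc n)) A = emeasure (\<nu> n) (?G -` A \<inter> space (\<nu> n))"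
      unfolding nuS by (rule emeasure_distr[OF Gm' Suc.prems])
    also have "space (\<nu> n) = unit_square" using sets_eq_imp_space_eq[OF sets] by (simp add: space_leb_square)
    also have "emeasure (\<nu> n) (?G -` A \<inter> unit_square) = emeasure lborel (C \<inter> (?G ^^ n) -` (?G -` A \<inter> unit_square)) / ennreal c"
      by (rule Suc.IH[OF B])
    also have "C \<inter> (?G ^^ n) -` (?G -` A \<inter> unit_square) = C \<inter> (?G ^^ Suc n) -` A"
      using GU by auto
    finally show ?case .
  qed
  obtain B where B: "0 \<le> B" "\<And>n E \<tau>. E \<in> sets borel \<Longrightarrow> 0 < \<tau> \<Longrightarrow>
     emeasure lborel (\<Union>w\<in>words n. cell \<alpha> C w \<inter> brs \<alpha> w -` E) \<le> ennreal (B * \<tau>) + ennreal (1 / \<tau>\<^sup>2) * emeasure lborel E"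
    using visits_uniform by blast
  have uac: "\<exists>d>0. \<forall>n. \<forall>A\<in>sets leb_square. measure leb_square A < d \<longrightarrow> measure (\<nu> n) A \<le> e" if e: "0 < e" for e
  proof -
    \<comment> \<open>This makes the boundary term at most half of \<open>e * c\<close>, and
      \<open>d\<close> makes the area term the other half; the area \<open>c\<close> of
      \<open>C\<close> is the normalisation of the initial measure.\<close>
    define \<tau> where "\<tau> = e * c / (2 * (B + 1))"
    have \<tau>: "0 < \<tau>" using e c B by (simp add: \<tau>_def)
    define d where "d = \<tau>\<^sup>2 * (e * c / 2)"
    have d: "0 < d" using \<tau> e c by (simp add: d_def)
    have "measure (\<nu> n) A \<le> e" if A: "A \<in> sets leb_square" "measure leb_square A < d" for n A
    proof -
      interpret \<nu>: prob_space "\<nu> n" by (rule prob)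
      have Ab: "A \<in> sets borel" "A \<subseteq> unit_square" using A by (auto simp: sets_leb_square)
      have "emeasure leb_square A = ennreal (measure leb_square A)"
        using finite_measure.emeasure_eq_measure[OF finite_leb_square] by simp
      then have lA: "emeasure lborel A \<le> ennreal d"
        using A(2) emeasure_leb_square[OF Ab] by (simp add: ennreal_leI less_imp_le)
      have Mb: "(\<Union>w\<in>words n. cell \<alpha> C w \<inter> brs \<alpha> w -` A) \<in> sets lborel"
        using finite_words vimage_brs_borel[OF Ab(1)] by (auto intro!: sets.finite_UN sets.Int)
      have "AE x in lborel. x \<in> C \<inter> (?G ^^ n) -` A \<longrightarrow> x \<in> (\<Union>w\<in>words n. cell \<alpha> C w \<inter> brs \<alpha> w -` A)"
        using cells_cover[OF \<alpha>, of C n]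
      proof eventually_elim
        case (elim x)
        show ?case
        proof
          assume x: "x \<in> C \<inter> (?G ^^ n) -` A"
          then obtain w where w: "w \<in> words n" "x \<in> cell \<alpha> C w" using elim by auto
          then have "brs \<alpha> w x = (?G ^^ n) x" using Gmap_cell[OF \<alpha> w(2)] by (simp add: words_def)
          then show "x \<in> (\<Union>w\<in>words n. cell \<alpha> C w \<inter> brs \<alpha> w -` A)" using x w by auto
        qed
      qed
      then have "emeasure lborel (C \<inter> (?G ^^ n) -` A) \<le> emeasure lborel (\<Union>w\<in>words n. cell \<alpha> C w \<inter> brs \<alpha> w -` A)"
        by (rule emeasure_mono_AE[OF _ Mb])
      also have "\<dots> \<le> ennreal (B * \<tau>) + ennreal (1 / \<tau>\<^sup>2) * emeasure lborel A" by (rule B(2)[OF Ab(1) \<tau>])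
      also have "\<dots> \<le> ennreal (B * \<tau>) + ennreal (1 / \<tau>\<^sup>2) * ennreal d"
        by (intro add_left_mono mult_left_mono lA) auto
      also have "\<dots> = ennreal (B * \<tau> + 1 / \<tau>\<^sup>2 * d)"
      proof -
        have n: "0 \<le> B * \<tau>" "0 \<le> 1 / \<tau>\<^sup>2" "0 \<le> d" using B(1) \<tau> d by auto
        show ?thesis
          by (simp only: ennreal_plus[OF n(1) mult_nonneg_nonneg[OF n(2,3)]] ennreal_mult[OF n(2,3)])
      qed
      also have "\<dots> \<le> ennreal (e * c)"
      proof (rule ennreal_leI)
        have "1 / \<tau>\<^sup>2 * d = e * c / 2" using \<tau> by (simp add: d_def)
        moreover have "B * \<tau> \<le> (B + 1) * \<tau>" using \<tau> by simp
        moreover have "(B + 1) * \<tau> = e * c / 2" using B(1) by (simp add: \<tau>_def field_simps)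
        ultimately show "B * \<tau> + 1 / \<tau>\<^sup>2 * d \<le> e * c" by simp
      qed
      finally have b: "emeasure lborel (C \<inter> (?G ^^ n) -` A) \<le> ennreal (e * c)" .
      have "emeasure (\<nu> n) A \<le> ennreal (e * c) / ennreal c"
        unfolding nu[OF A(1)] by (rule divide_right_mono_ennreal[OF b])
      also have "\<dots> = ennreal e" using e c by (simp add: divide_ennreal)
      finally show ?thesis using e by (simp add: \<nu>.emeasure_eq_measure)
    qed
    then show ?thesis using d by blast
  qed
  show ?thesis
    by (rule acim_of_uniformly_ac[where \<nu>=\<nu>, OF finite_leb_square Gm sets prob nuS uac])
qed

text \<open>The support of the initial density; it lies in the polygon \<open>x + y \<ge> 2 \<alpha>\<close>.\<close>

definition quarter :: "(real \<times> real) set" where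
  "quarter = {1/2..1} \<times> {1/2..1}"

definition quarter_rim :: "real \<Rightarrow> (real \<times> real) set" where
  "quarter_rim r = cbox (1/2, 1/2) (1/2 + r, 1) \<union> cbox (1 - r, 1/2) (1, 1)
     \<union> (cbox (1/2, 1/2) (1, 1/2 + r) \<union> cbox (1/2, 1 - r) (1, 1))"

lemma emeasure_rect: "emeasure lborel (cbox (a, b) (c, d) :: (real \<times> real) set) \<le> ennreal (max 0 (c - a) * max 0 (d - b))"
proof (cases "a \<le> c \<and> b \<le> d")
  case True
  have "(\<Prod>i\<in>(Basis :: (real \<times> real) set). ((c, d) - (a, b)) \<bullet> i) = (c - a) * (d - b)"
    by (simp add: Basis_prod_def prod.union_disjoint)
  moreover have "(a, b) \<bullet> i \<le> (c, d) \<bullet> i" if "i \<in> Basis" for i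
    using that True by (auto simp: Basis_prod_def)
  ultimately show ?thesis using True by (subst emeasure_lborel_cbox) auto
next
  case False
  then have "cbox (a, b) (c, d) = {}" by (auto simp: cbox_Pair_eq)
  then show ?thesis by simp
qed

lemma acim_of_contraction:
  assumes \<alpha>: "0 < \<alpha>" "\<alpha> < 1/2" and K: "0 < K" and \<theta>: "0 < \<theta>" "\<theta> < 1"
    and contr: "\<And>w v u. cell \<alpha> quarter (w @ v) \<noteq> {} \<Longrightarrow> norm (ilbs \<alpha> v u) \<le> K * \<theta> ^ length v * norm u"
  shows "\<exists>\<mu>. sets \<mu> = sets leb_square \<and> prob_space \<mu> \<and> absolutely_continuous leb_square \<mu> \<and>
     Gmap \<alpha> \<in> measurable \<mu> \<mu> \<and> distr \<mu> \<mu> (Gmap \<alpha>) = \<mu>"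
proof -
  have q: "quarter = cbox (1/2, 1/2) (1, 1)" by (auto simp: quarter_def cbox_Pair_eq)
  \<comment> \<open>The constant 2 is the sum of four strips of width \<open>r\<close> along sides
    of length 1/2.\<close>
  interpret expanding_branches \<alpha> K \<theta> 2 quarter quarter_rim
  proof
    show "convex quarter" "quarter \<in> sets borel" unfolding q by auto
    show "quarter \<subseteq> unit_square" by (auto simp: quarter_def unit_square_def)
    fix r :: real assume r: "0 < r"
    show "quarter_rim r \<in> sets borel" unfolding quarter_rim_def by auto
    have "emeasure lborel (quarter_rim r) \<le> (ennreal (r/2) + ennreal (r/2)) + (ennreal (r/2) + ennreal (r/2))"
      unfolding quarter_rim_def
    proof (intro order_trans[OF emeasure_subadditive] add_mono)
      show "emeasure lborel (cbox (1/2, 1/2) (1/2 + r, 1) :: (real \<times> real) set) \<le> ennreal (r/2)"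
        using emeasure_rect[of "1/2" "1/2" "1/2 + r" 1] r by (simp add: max_def)
      show "emeasure lborel (cbox (1 - r, 1/2) (1, 1) :: (real \<times> real) set) \<le> ennreal (r/2)"
        using emeasure_rect[of "1 - r" "1/2" 1 1] r by (simp add: max_def)
      show "emeasure lborel (cbox (1/2, 1/2) (1, 1/2 + r) :: (real \<times> real) set) \<le> ennreal (r/2)"
        using emeasure_rect[of "1/2" "1/2" 1 "1/2 + r"] r by (simp add: max_def)
      show "emeasure lborel (cbox (1/2, 1 - r) (1, 1) :: (real \<times> real) set) \<le> ennreal (r/2)"
        using emeasure_rect[of "1/2" "1 - r" 1 1] r by (simp add: max_def)
    qed auto
    also have "\<dots> = ennreal (2 * r)" using r by (simp add: ennreal_plus[symmetric] del: ennreal_plus)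
    finally show "emeasure lborel (quarter_rim r) \<le> ennreal (2 * r)" .
    fix x u :: "real \<times> real" assume x: "x \<in> quarter" "norm u \<le> r" "x + u \<notin> quarter"
    have "\<bar>fst u\<bar> \<le> r" "\<bar>snd u\<bar> \<le> r"
      using x(2) norm_fst_le[of "fst u" "snd u"] norm_snd_le[of "snd u" "fst u"] by auto
    then show "x \<in> quarter_rim r" using x unfolding quarter_rim_def q
      by (cases x; cases u) (auto simp: cbox_Pair_eq)
  qed (use assms in auto)
  have "emeasure lborel quarter = ennreal (1/4)"
  proof -
    have "(\<Prod>i\<in>(Basis :: (real \<times> real) set). ((1, 1) - (1/2, 1/2)) \<bullet> i) = 1/4"
      by (simp add: Basis_prod_def prod.union_disjoint)
    moreover have "(1/2, 1/2) \<bullet> i \<le> (1, 1) \<bullet> i" if "i \<in> Basis" for i :: "real \<times> real"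
      using that by (auto simp: Basis_prod_def)
    ultimately show ?thesis unfolding q by (subst emeasure_lborel_cbox) auto
  qed
  then show ?thesis by (intro acim_exists) simp
qed

section \<open>Polynomial certificates\<close>

text \<open>Polynomials are lists of integer coefficients, constant term first, so that the
  certificates can be evaluated and reduce to signs of integers.\<close>

fun padd :: "int list \<Rightarrow> int list \<Rightarrow> int list" where
  "padd [] q = q"
| "padd (a # p) [] = a # p"
| "padd (a # p) (b # q) = (a + b) # padd p q"

definition pscale :: "int \<Rightarrow> int list \<Rightarrow> int list" where
  "pscale c p = map ((*) c) p"

primrec pmul :: "int list \<Rightarrow> int list \<Rightarrow> int list" where
  "pmul [] q = []"
| "pmul (a # p) q = padd (pscale a q) (0 # pmul p q)"

primrec peval :: "int list \<Rightarrow> real \<Rightarrow> real" where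
  "peval [] x = 0"
| "peval (a # p) x = of_int a + x * peval p x"

lemma peval_padd [simp]: "peval (padd p q) x = peval p x + peval q x"
  by (induction p q rule: padd.induct) (simp_all add: algebra_simps)

lemma peval_pscale [simp]: "peval (pscale c p) x = of_int c * peval p x"
  by (induction p) (simp_all add: pscale_def algebra_simps)

lemma peval_pmul [simp]: "peval (pmul p q) x = peval p x * peval q x"
  by (induction p) (simp_all add: algebra_simps)

definition pnonneg :: "int list \<Rightarrow> bool" where
  "pnonneg p = list_all (\<lambda>c. 0 \<le> c) p"

lemma peval_nonneg: "pnonneg p \<Longrightarrow> 0 \<le> x \<Longrightarrow> 0 \<le> peval p x"
  by (induction p) (simp_all add: pnonneg_def)

text \<open>Strictness is required of the constant term, so that the value is negative at
  \<open>x = 0\<close>, the left end of the parameter interval, as well.\<close>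

definition pneg :: "int list \<Rightarrow> bool" where
  "pneg p = (p \<noteq> [] \<and> hd p < 0 \<and> pnonneg (pscale (-1) p))"

lemma peval_neg:
  assumes "pneg p" "0 \<le> x"
  shows "peval p x < 0"
proof (cases p)
  case Nil
  then show ?thesis using assms by (simp add: pneg_def)
next
  case (Cons a q)
  have "pnonneg (pscale (-1) q)" using assms(1) Cons by (simp add: pneg_def pnonneg_def pscale_def)
  then have "0 \<le> peval (pscale (-1) q) x" using peval_nonneg assms(2) by blast
  then have "x * peval q x \<le> 0" using assms(2) by (simp add: mult_nonneg_nonpos)
  then show ?thesis using assms(1) Cons by (simp add: pneg_def)
qed

text \<open>An interval of parameters is traversed by \<open>\<alpha> = (n + m x) / (N + M x)\<close> with \<open>x \<ge> 0\<close>,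
  so that a polynomial inequality on it follows from the signs of coefficients.\<close>

lemma mobius_parameter:
  fixes \<alpha> :: real and n N m M :: int
  assumes "0 < N" "0 < M" "of_int n \<le> \<alpha> * of_int N" "\<alpha> * of_int M < of_int m"
  obtains x where "0 \<le> x" "peval [n, m] x = \<alpha> * peval [N, M] x" "0 < peval [N, M] x"
proof
  let ?x = "(\<alpha> * N - n) / (m - \<alpha> * M)"
  show "0 \<le> ?x" using assms by simp
  then show "0 < peval [N, M] ?x" using assms by (simp add: add_pos_nonneg)
  show "peval [n, m] ?x = \<alpha> * peval [N, M] ?x" using assms by (simp add: field_simps)
qed

text \<open>\<open>e = 0\<close> is the form in which expansion is measured, \<open>e = 1\<close>
  the form that the decreasing branch multiplies by J, and \<open>e = -1\<close> its mirror image,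
  into which the increasing branch carries it.\<close>

definition quad :: "real \<Rightarrow> real \<Rightarrow> real \<times> real \<Rightarrow> real" where
  "quad \<alpha> e v = 2 * (1 - \<alpha>) * (fst v)\<^sup>2 + 2 * e * \<alpha> * fst v * snd v + (snd v)\<^sup>2"

text \<open>The target form is always \<open>e = 0\<close>, so estimates can be chained. The source
  form is free, so that a word can also be attached directly to a run, which ends in the form
  \<open>e = -1\<close>.\<close>

definition expands :: "real \<Rightarrow> real \<Rightarrow> real \<Rightarrow> bool list \<Rightarrow> bool" where
  "expands \<alpha> e r w = (\<forall>u. r * quad \<alpha> e u \<le> quad \<alpha> 0 (lbs \<alpha> w u))"

text \<open>The orbit of a vector with denominators cleared by \<open>b = N + M x\<close>. The
  second component carries one power of \<open>b\<close> more than the first; as the new first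
  component is the old second one, each letter raises both powers by one, with \<open>A\<close>
  standing for \<alpha> b and \<open>D\<close> for (1 - \<alpha>) b^2.\<close>

primrec lin_poly :: "int list \<Rightarrow> int list \<Rightarrow> int list \<Rightarrow> int list \<Rightarrow> bool list \<Rightarrow> int list \<times> int list" where
  "lin_poly A D z z' [] = (z, z')"
| "lin_poly A D z z' (s # w) =
    lin_poly A D z' (pscale (if s then 2 else -2) (padd (pmul A z') (pmul D z))) w"

lemma lbs_Cons: "lbs \<alpha> (s # w) u = lbs \<alpha> w (lb \<alpha> s u)" by (simp add: lbs_def)
lemma brs_Cons: "brs \<alpha> (s # w) u = brs \<alpha> w (br \<alpha> s u)" by (simp add: brs_def)

lemma lin_poly_eval:
  assumes "peval A x = \<alpha> * b" "peval D x = (1 - \<alpha>) * b\<^sup>2"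
    "peval z x = k * fst u" "peval z' x = k * b * snd u" "lin_poly A D z z' w = (y, y')"
  shows "peval y x = k * b ^ length w * fst (lbs \<alpha> w u)
    \<and> peval y' x = k * b ^ Suc (length w) * snd (lbs \<alpha> w u)"
  using assms
proof (induction w arbitrary: z z' k u)
  case (Cons s w)
  have "peval y x = k * b * b ^ length w * fst (lbs \<alpha> w (lb \<alpha> s u))
    \<and> peval y' x = k * b * b ^ Suc (length w) * snd (lbs \<alpha> w (lb \<alpha> s u))"
    by (rule Cons.IH[OF Cons.prems(1,2) _ _ Cons.prems(5)[unfolded lin_poly.simps]])
       (use Cons.prems(3,4) in \<open>simp_all add: Cons.prems(1,2) lb_def oml_def power2_eq_square algebra_simps\<close>)
  then show ?case by (simp add: lbs_Cons mult.assoc)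
qed simp

primrec ppow :: "int list \<Rightarrow> nat \<Rightarrow> int list" where
  "ppow p 0 = [1]"
| "ppow p (Suc n) = pmul p (ppow p n)"

lemma peval_ppow [simp]: "peval (ppow p n) x = peval p x ^ n"
  by (induction n) simp_all

text \<open>One coefficient of \<open>r'\<close> times the form after a word of length h minus
  \<open>r\<close> times the form before it, scaled by b^(2h+2): \<open>S\<close> is b^(2h+1), and
  \<open>g\<close> is a coefficient of the source form times b.\<close>

definition form_diff :: "int list \<Rightarrow> int list \<Rightarrow> int \<Rightarrow> int \<Rightarrow> int list \<Rightarrow> int list \<Rightarrow> int list \<Rightarrow> int list \<Rightarrow> int list \<Rightarrow> int list" where
  "form_diff D S r r' y z y' z' g =
    padd (pscale r' (padd (pscale 2 (pmul D (pmul y y'))) (pmul z z'))) (pscale (- r) (pmul S g))"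

text \<open>Weighted diagonal dominance of the form with coefficients \<open>a\<close>,
  \<open>b\<close>, \<open>c\<close>. Unlike a discriminant it is linear in the coefficients, so the
  degree of the polynomials is not doubled; the weights \<open>k\<close> and \<open>k'\<close> adapt
  it to the form at hand.\<close>

definition dominant :: "int \<Rightarrow> int \<Rightarrow> int list \<Rightarrow> int list \<Rightarrow> int list \<Rightarrow> bool" where
  "dominant k k' a b c \<longleftrightarrow>
     pnonneg (padd (pscale k' a) (pscale k b)) \<and> pnonneg (padd (pscale k' a) (pscale (- k) b)) \<and>
     pnonneg (padd (pscale k c) (pscale k' b)) \<and> pnonneg (padd (pscale k c) (pscale (- k') b))"

fun form_check :: "int list \<Rightarrow> int list \<Rightarrow> int list \<Rightarrow> int list \<Rightarrow> int list \<Rightarrow> int \<Rightarrow> int \<Rightarrow> int \<Rightarrow> int \<Rightarrow> int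
    \<Rightarrow> int list \<times> int list \<Rightarrow> int list \<times> int list \<Rightarrow> bool" where
  "form_check A B C D S e r r' k k' (p, q) (p', q') =
    dominant k k' (form_diff D S r r' p q p q (pscale 2 C)) (form_diff D S r r' p q p' q' (pscale e A))
      (form_diff D S r r' p' q' p' q' B)"

definition expands_check :: "int \<Rightarrow> int \<Rightarrow> int \<Rightarrow> int \<Rightarrow> int \<Rightarrow> int \<Rightarrow> int \<Rightarrow> int \<Rightarrow> int \<Rightarrow> bool list \<Rightarrow> bool" where
  "expands_check n N m M e r r' k k' w \<longleftrightarrow> 0 < N \<and> 0 < M \<and> 0 < r' \<and> 0 < k \<and> 0 < k' \<and>
    form_check [n, m] [N, M] [N - n, M - m] (pmul [N - n, M - m] [N, M]) (ppow [N, M] (Suc (2 * length w))) e r r' k k'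
      (lin_poly [n, m] (pmul [N - n, M - m] [N, M]) [1] [0] w)
      (lin_poly [n, m] (pmul [N - n, M - m] [N, M]) [0] [N, M] w)"

text \<open>Multiplied by \<open>k * k'\<close>, the mixed term is at most what the expansion of
  \<open>\<bar>b\<bar> * (k * \<bar>s\<bar> - k' * \<bar>t\<bar>)\<^sup>2 \<ge> 0\<close> allows,
  and the hypotheses turn this into the diagonal terms.\<close>

lemma diagonally_dominant_form_nonneg:
  fixes a b c k k' :: real
  assumes "0 < k" "0 < k'" "\<bar>k * b\<bar> \<le> k' * a" "\<bar>k' * b\<bar> \<le> k * c"
  shows "0 \<le> a * s\<^sup>2 + 2 * b * s * t + c * t\<^sup>2"
proof -
  have ab: "k * \<bar>b\<bar> \<le> k' * a" "k' * \<bar>b\<bar> \<le> k * c" using assms by (simp_all add: abs_mult)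
  have "0 \<le> \<bar>b\<bar> * (k * \<bar>s\<bar> - k' * \<bar>t\<bar>)\<^sup>2" by simp
  then have "2 * (k * k') * (\<bar>b\<bar> * \<bar>s\<bar> * \<bar>t\<bar>) \<le> k * (k * \<bar>b\<bar>) * s\<^sup>2 + k' * (k' * \<bar>b\<bar>) * t\<^sup>2"
    by (simp add: power2_eq_square algebra_simps)
  also have "\<dots> \<le> k * (k' * a) * s\<^sup>2 + k' * (k * c) * t\<^sup>2"
    using ab assms by (intro add_mono mult_right_mono mult_left_mono) simp_all
  finally have "(k * k') * (2 * (\<bar>b\<bar> * \<bar>s\<bar> * \<bar>t\<bar>)) \<le> (k * k') * (a * s\<^sup>2 + c * t\<^sup>2)"
    by (simp add: algebra_simps)
  then have "2 * (\<bar>b\<bar> * \<bar>s\<bar> * \<bar>t\<bar>) \<le> a * s\<^sup>2 + c * t\<^sup>2"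
    using assms by (simp add: mult_le_cancel_left_pos)
  moreover have "- (\<bar>b\<bar> * \<bar>s\<bar> * \<bar>t\<bar>) \<le> b * s * t" by (metis abs_ge_minus_self abs_mult minus_le_iff)
  ultimately show ?thesis by (simp add: mult.assoc)
qed

lemma expands_check_sound:
  assumes chk: "expands_check n N m M e r r' k k' w"
    and lo: "of_int n \<le> \<alpha> * of_int N" and hi: "\<alpha> * of_int M < of_int m"
  shows "expands \<alpha> (of_int e) (of_int r / of_int r') w"
  unfolding expands_def
proof
  fix u
  define A B C D where d: "A = [n, m]" "B = [N, M]" "C = [N - n, M - m]" "D = pmul C B"
  obtain p q where pq: "lin_poly A D [1] [0] w = (p, q)" by fastforce
  obtain p' q' where pq': "lin_poly A D [0] B w = (p', q')" by fastforce
  define S where "S = ppow B (Suc (2 * length w))"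
  define F where "F = (\<lambda>y z y' z' g. padd (pscale r' (padd (pscale 2 (pmul D (pmul y y'))) (pmul z z'))) (pscale (- r) (pmul S g)))"
  define a b c where abc: "a = F p q p q (pscale 2 C)" "b = F p q p' q' (pscale e A)" "c = F p' q' p' q' B"
  have ck: "0 < N" "0 < M" "0 < r'" "0 < k" "0 < k'"
       "pnonneg (padd (pscale k' a) (pscale k b))" "pnonneg (padd (pscale k' a) (pscale (- k) b))"
       "pnonneg (padd (pscale k c) (pscale k' b))" "pnonneg (padd (pscale k c) (pscale (- k') b))"
    using chk unfolding expands_check_def pq[unfolded d] pq'[unfolded d]
      by (simp_all add: dominant_def form_diff_def abc F_def S_def d)
  obtain x where x: "0 \<le> x" "peval A x = \<alpha> * peval B x" "0 < peval B x"
    using mobius_parameter[OF ck(1,2) lo hi] unfolding d by blast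
  define \<beta> where "\<beta> = peval B x"
  have C: "peval C x = (1 - \<alpha>) * \<beta>" using x(2) by (simp add: d \<beta>_def algebra_simps)
  have A: "peval A x = \<alpha> * \<beta>" and D: "peval D x = (1 - \<alpha>) * \<beta>\<^sup>2"
    using x(2) C d(4) by (simp_all add: \<beta>_def power2_eq_square)
  define h where "h = length w"
  let ?f = "lbs \<alpha> w (1, 0)" let ?g = "lbs \<alpha> w (0, 1)"
  \<comment> \<open>It is enough to follow the two basis vectors; the coefficients of the form after
    the word are bilinear in their images.\<close>
  have e1: "peval p x = \<beta> ^ h * fst ?f" "peval q x = \<beta> ^ Suc h * snd ?f"
    using lin_poly_eval[OF A D _ _ pq, of 1 "(1, 0)"] by (simp_all add: h_def)
  have e2: "peval p' x = \<beta> ^ h * fst ?g" "peval q' x = \<beta> ^ Suc h * snd ?g"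
    using lin_poly_eval[OF A D _ _ pq', of 1 "(0, 1)"] by (simp_all add: h_def \<beta>_def)
  have "lbs \<alpha> w (fst u *\<^sub>R (1, 0) + snd u *\<^sub>R (0, 1)) = fst u *\<^sub>R ?f + snd u *\<^sub>R ?g"
    using linear_lbs[of \<alpha> w] by (simp only: linear_add linear_scale)
  moreover have "u = fst u *\<^sub>R (1, 0) + snd u *\<^sub>R (0, 1)" by (simp add: prod_eq_iff)
  ultimately have lu: "lbs \<alpha> w u = fst u *\<^sub>R ?f + snd u *\<^sub>R ?g" by simp
  have "0 \<le> peval a x * (fst u)\<^sup>2 + 2 * peval b x * fst u * snd u + peval c x * (snd u)\<^sup>2"
  proof (rule diagonally_dominant_form_nonneg)
    show "0 < real_of_int k" "0 < real_of_int k'" using ck by auto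
    show "\<bar>k * peval b x\<bar> \<le> k' * peval a x" "\<bar>k' * peval b x\<bar> \<le> k * peval c x"
      using ck(6-9)[THEN peval_nonneg, OF x(1)] by (auto simp: abs_le_iff)
  qed
  also have "\<dots> = \<beta> ^ (2 * h + 2) * (r' * quad \<alpha> 0 (lbs \<alpha> w u) - r * quad \<alpha> e u)"
    unfolding abc F_def quad_def lu S_def
    by (simp add: e1 e2 A C D \<beta>_def[symmetric] h_def[symmetric] power_mult power2_eq_square algebra_simps)
       (simp add: power_add[symmetric] power_mult power_mult_distrib algebra_simps power2_eq_square)?
  finally have "0 \<le> \<beta> ^ (2 * h + 2) * (r' * quad \<alpha> 0 (lbs \<alpha> w u) - r * quad \<alpha> e u)" .
  moreover have "0 < \<beta> ^ (2 * h + 2)" using x(3) unfolding \<beta>_def by (rule zero_less_power)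
  ultimately have "0 \<le> r' * quad \<alpha> 0 (lbs \<alpha> w u) - r * quad \<alpha> e u"
    unfolding zero_le_mult_iff by linarith
  then show "of_int r / of_int r' * quad \<alpha> (of_int e) u \<le> quad \<alpha> 0 (lbs \<alpha> w u)"
    using ck(3) by (simp add: field_simps)
qed

text \<open>A run of length \<open>m\<close> is \<open>m - 1\<close> decreasing branches closed by
  an increasing one, which is counted in \<open>m\<close>; the final \<open>k\<close> decreasing
  branches belong to an unfinished run.\<close>

definition runs :: "nat list \<Rightarrow> nat \<Rightarrow> bool list" where
  "runs ms k = concat (map (\<lambda>m. replicate (m - 1) False @ [True]) ms) @ replicate k False"

text \<open>If a combination with nonnegative weights is negative at the corners of the invariant polygon,
  then the word does not occur there.\<close>

fun constr :: "real \<Rightarrow> bool list \<Rightarrow> int list \<Rightarrow> real \<times> real \<Rightarrow> real" where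
  "constr \<alpha> (s # w) (l # ls) p = (if s then - of_int l else of_int l) * om \<alpha> p + constr \<alpha> w ls (br \<alpha> s p)"
| "constr \<alpha> _ _ p = 0"

lemma constr_nonneg:
  assumes "list_all (\<lambda>l. 0 \<le> l) ls" "p \<in> cell \<alpha> UNIV w"
  shows "0 \<le> constr \<alpha> w ls p"
  using assms
proof (induction \<alpha> w ls p rule: constr.induct)
  case (1 \<alpha> s w l ls p)
  have "p \<in> half \<alpha> s" using 1(3) by (auto simp: cell_def dest: spec[of _ 0])
  moreover have "br \<alpha> s p \<in> cell \<alpha> UNIV w"
    using 1(3) by (fastforce simp: cell_def brs_Cons)
  ultimately have "0 \<le> (if s then - of_int l else of_int l) * om \<alpha> p" "0 \<le> constr \<alpha> w ls (br \<alpha> s p)"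
    using 1(1,2) by (auto simp: half_def mult_nonneg_nonpos)
  then show ?case unfolding constr.simps by (rule add_nonneg_nonneg)
qed auto

lemma br_affine: "br \<alpha> s ((1 - t) *\<^sub>R p + t *\<^sub>R q) = (1 - t) *\<^sub>R br \<alpha> s p + t *\<^sub>R br \<alpha> s q"
  by (simp add: br_def om_def field_simps)

lemma constr_affine:
  "constr \<alpha> w ls ((1 - t) *\<^sub>R p + t *\<^sub>R q) = (1 - t) * constr \<alpha> w ls p + t * constr \<alpha> w ls q"
proof (induction \<alpha> w ls p arbitrary: q rule: constr.induct)
  case (1 \<alpha> s w l ls p)
  have o: "om \<alpha> ((1 - t) *\<^sub>R p + t *\<^sub>R q) = (1 - t) * om \<alpha> p + t * om \<alpha> q"
    by (simp add: om_def field_simps)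
  show ?case unfolding constr.simps br_affine 1 o by (simp add: algebra_simps)
qed auto

section \<open>The invariant polygon and certificates for words that cannot occur\<close>

definition truncated_square :: "real \<Rightarrow> (real \<times> real) set" where
  "truncated_square \<alpha> = {p. 0 \<le> fst p \<and> fst p \<le> 1 \<and> 0 \<le> snd p \<and> snd p \<le> 1 \<and> 2 * \<alpha> \<le> fst p + snd p}"

text \<open>The bound 2 \<alpha> is the coordinate sum of (0, 2 \<alpha>), the image of the corner
  (1, 0) under the decreasing branch. Under the increasing branch the new first coordinate
  \<open>b\<close> suffices alone if it exceeds 2 \<alpha>; otherwise the bound for the old point
  forces \<open>a\<close> to be at least 2 \<alpha> - \<open>b\<close>.\<close>

lemma br_truncated_square:
  assumes \<alpha>: "0 < \<alpha>" "\<alpha> < 1/2" and p: "p \<in> truncated_square \<alpha>" "p \<in> half \<alpha> s"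
  shows "br \<alpha> s p \<in> truncated_square \<alpha>"
proof -
  obtain a b where ab: "p = (a, b)" by fastforce
  have h: "0 \<le> a" "a \<le> 1" "0 \<le> b" "b \<le> 1" "2 * \<alpha> \<le> a + b" using p(1) by (simp_all add: truncated_square_def ab)
  have m: "0 \<le> \<alpha> * b" "0 \<le> (1 - \<alpha>) * a" "\<alpha> * b \<le> \<alpha>" "(1 - \<alpha>) * a \<le> 1 - \<alpha>" "0 \<le> (1 - 2 * \<alpha>) * b"
    using h \<alpha> by (simp_all add: mult_left_le)
  show ?thesis
  proof (cases s)
    case True
    have "2 * \<alpha> \<le> b + (2 * (\<alpha> * b) + 2 * ((1 - \<alpha>) * a))"
    proof (cases "b \<le> 2 * \<alpha>")
      case True
      have "(1 - \<alpha>) * (2 * \<alpha> - b) \<le> (1 - \<alpha>) * a" using h \<alpha> by (intro mult_left_mono) auto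
      moreover have "(1 - 2 * \<alpha>) * b \<le> (1 - 2 * \<alpha>) * (2 * \<alpha>)" using True \<alpha> by (intro mult_left_mono) auto
      ultimately show ?thesis using \<alpha> True m by (simp add: algebra_simps)
    qed (use m in linarith)
    then show ?thesis using True p(2) m h
      by (simp add: ab truncated_square_def br_def half_def om_def algebra_simps)
  next
    case False
    then show ?thesis using p(2) m h
      by (simp add: ab truncated_square_def br_def half_def om_def algebra_simps)
  qed
qed

text \<open>The five points are the corners of the polygon, and the signs and the order of the two
  slopes tell which corner dominates the value at \<open>p\<close>.\<close>

lemma affine_neg_truncated_square:
  fixes f :: "real \<times> real \<Rightarrow> real"
  assumes aff: "\<And>p q t. f ((1 - t) *\<^sub>R p + t *\<^sub>R q) = (1 - t) * f p + t * f q"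
    and \<alpha>: "0 < \<alpha>" "\<alpha> < 1/2" and p: "p \<in> truncated_square \<alpha>"
    and v: "f (1, 1) < 0" "f (1, 0) < 0" "f (0, 1) < 0" "f (2 * \<alpha>, 0) < 0" "f (0, 2 * \<alpha>) < 0"
  shows "f p < 0"
proof -
  define c a b where d: "c = f (0, 0)" "a = f (1, 0) - c" "b = f (0, 1) - c"
  have f: "f (x, y) = c + a * x + b * y" for x y
  proof -
    have x: "f (2 * x, 0) = c + a * (2 * x)" and y: "f (0, 2 * y) = c + b * (2 * y)"
      using aff[of "2 * x" "(0, 0)" "(1, 0)"] aff[of "2 * y" "(0, 0)" "(0, 1)"]
      by (simp_all add: d algebra_simps)
    show ?thesis using aff[of "1/2" "(2 * x, 0)" "(0, 2 * y)"] x y by (simp add: field_simps)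
  qed
  obtain x y where xy: "p = (x, y)" by fastforce
  have h: "0 \<le> x" "x \<le> 1" "0 \<le> y" "y \<le> 1" "2 * \<alpha> \<le> x + y" using p by (simp_all add: truncated_square_def xy)
  consider "0 \<le> a" "0 \<le> b" | "0 \<le> a" "b \<le> 0" | "a \<le> 0" "0 \<le> b" | "a \<le> 0" "b \<le> a" | "b \<le> 0" "a \<le> b"
    by linarith
  then have "a * x + b * y \<le> a + b \<or> a * x + b * y \<le> a \<or> a * x + b * y \<le> b
    \<or> a * x + b * y \<le> a * (2 * \<alpha>) \<or> a * x + b * y \<le> b * (2 * \<alpha>)"
  proof cases
    case 1
    then have "a * x \<le> a" "b * y \<le> b" using h by (simp_all add: mult_left_le)
    then show ?thesis by linarith
  next
    case 2
    then have "a * x \<le> a" "b * y \<le> 0" using h by (simp_all add: mult_left_le mult_nonpos_nonneg)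
    then show ?thesis by linarith
  next
    case 3
    then have "a * x \<le> 0" "b * y \<le> b" using h by (simp_all add: mult_left_le mult_nonpos_nonneg)
    then show ?thesis by linarith
  next
    case 4
    then have "a * (x + y) \<le> a * (2 * \<alpha>)" "b * y \<le> a * y"
      using h by (intro mult_left_mono_neg mult_right_mono; simp)+
    then show ?thesis by (simp add: distrib_left)
  next
    case 5
    then have "b * (x + y) \<le> b * (2 * \<alpha>)" "a * x \<le> b * x"
      using h by (intro mult_left_mono_neg mult_right_mono; simp)+
    then show ?thesis by (simp add: distrib_left)
  qed
  then show ?thesis using v unfolding xy f by auto
qed

text \<open>The state holds the accumulated combination, the two coordinates of the orbit and
  \<open>q\<close> for the constant 1, with denominators cleared. In the same scale \<open>u\<close>
  stands for 1 + 2 \<open>om\<close>, so \<open>u - q\<close> is twice the constraint; this is the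
  factor 2 in the evaluation.\<close>

definition constr_update :: "int list \<Rightarrow> bool \<Rightarrow> int \<Rightarrow> int list \<Rightarrow> int list \<Rightarrow> int list \<Rightarrow> int list
    \<Rightarrow> int list \<times> int list \<times> int list \<times> int list" where
  "constr_update B s l y z' q u =
    (padd (pmul B y) (pscale (if s then - l else l) (padd u (pscale (-1) q))), z',
     if s then u else padd (pscale 2 q) (pscale (-1) u), pmul B q)"

fun constr_step :: "int list \<Rightarrow> int list \<Rightarrow> int list \<Rightarrow> bool \<Rightarrow> int
    \<Rightarrow> int list \<times> int list \<times> int list \<times> int list \<Rightarrow> int list \<times> int list \<times> int list \<times> int list" where
  "constr_step A B D s l (y, z, z', q) = constr_update B s l y z' q (pscale 2 (padd (pmul A z') (pmul D z)))"

fun constr_poly :: "int list \<Rightarrow> int list \<Rightarrow> int list \<Rightarrow> int list \<times> int list \<times> int list \<times> int list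
    \<Rightarrow> bool list \<Rightarrow> int list \<Rightarrow> int list" where
  "constr_poly A B D st (s # w) (l # ls) = constr_poly A B D (constr_step A B D s l st) w ls"
| "constr_poly A B D st _ _ = fst st"

lemma constr_poly_eval:
  assumes "peval A x = \<alpha> * b" "peval B x = b" "peval D x = (1 - \<alpha>) * b\<^sup>2"
    "peval z x = k * fst p" "peval z' x = k * b * snd p" "peval q x = k * b\<^sup>2" "length w = length ls"
  shows "peval (constr_poly A B D (y, z, z', q) w ls) x
    = b ^ length w * peval y x + 2 * k * b ^ Suc (length w) * constr \<alpha> w ls p"
  using assms
proof (induction w arbitrary: ls k p y z z' q)
  case (Cons s w)
  obtain l ls' where ls: "ls = l # ls'" using Cons.prems(7) by (cases ls) auto
  let ?u = "pscale 2 (padd (pmul A z') (pmul D z))"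
  let ?g = "pscale (if s then - l else l) (padd ?u (pscale (-1) q))"
  note pr = Cons.prems(1-6)
  have u: "peval ?u x = k * b\<^sup>2 * (2 * om \<alpha> p + 1)"
    by (simp add: pr om_def power2_eq_square algebra_simps)
  have g: "peval ?g x = 2 * k * b\<^sup>2 * ((if s then - of_int l else of_int l) * om \<alpha> p)"
    using u by (simp add: pr algebra_simps)
  have "peval (constr_poly A B D (padd (pmul B y) ?g, z', if s then ?u else padd (pscale 2 q) (pscale (-1) ?u), pmul B q) w ls') x
     = b ^ length w * peval (padd (pmul B y) ?g) x + 2 * (k * b) * b ^ Suc (length w) * constr \<alpha> w ls' (br \<alpha> s p)"
  proof (rule Cons.IH)
    show "peval (if s then ?u else padd (pscale 2 q) (pscale (-1) ?u)) x = k * b * b * snd (br \<alpha> s p)"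
      using u pr(6) by (simp add: br_def power2_eq_square algebra_simps)
  qed (use Cons.prems ls in \<open>simp_all add: br_def power2_eq_square\<close>)
  also have "\<dots> = b ^ length (s # w) * peval y x + 2 * k * b ^ Suc (length (s # w)) * constr \<alpha> (s # w) ls p"
    unfolding peval_padd g ls by (simp add: pr(2) power2_eq_square algebra_simps)
  finally show ?case by (simp add: ls constr_update_def)
qed auto

text \<open>The initial states are the five corners, in the scale \<open>k = b\<close> of
  \<open>constr_poly_eval\<close>, which clears the denominator of 2 \<alpha>: \<open>B\<close> and
  \<open>E = b^2\<close> encode a coordinate 1, twice \<open>A\<close> and twice \<open>A B\<close>
  a coordinate 2 \<alpha>, and \<open>Q = b^3\<close> the constant.\<close>

definition constr_neg :: "int list \<Rightarrow> int list \<Rightarrow> int list \<Rightarrow> int list \<Rightarrow> int list \<Rightarrow> bool list \<Rightarrow> int list \<Rightarrow> bool" where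
  "constr_neg A B D E Q w ls \<longleftrightarrow>
    pneg (constr_poly A B D ([], B, E, Q) w ls) \<and> pneg (constr_poly A B D ([], B, [], Q) w ls) \<and>
    pneg (constr_poly A B D ([], [], E, Q) w ls) \<and> pneg (constr_poly A B D ([], pscale 2 A, [], Q) w ls) \<and>
    pneg (constr_poly A B D ([], [], pscale 2 (pmul A B), Q) w ls)"

definition infeasible_check :: "int \<Rightarrow> int \<Rightarrow> int \<Rightarrow> int \<Rightarrow> bool list \<Rightarrow> int list \<Rightarrow> bool" where
  "infeasible_check n N m M w ls \<longleftrightarrow> 0 < N \<and> 0 < M \<and> length w = length ls \<and> list_all (\<lambda>l. 0 \<le> l) ls \<and>
    constr_neg [n, m] [N, M] (pmul [N - n, M - m] [N, M]) (pmul [N, M] [N, M]) (pmul [N, M] (pmul [N, M] [N, M])) w ls"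

lemma infeasible_check_sound:
  assumes chk: "infeasible_check n N m M w ls"
    and lo: "of_int n \<le> \<alpha> * of_int N" and hi: "\<alpha> * of_int M < of_int m"
    and \<alpha>: "0 < \<alpha>" "\<alpha> < 1/2" and p: "p \<in> truncated_square \<alpha>"
  shows "p \<notin> cell \<alpha> UNIV w"
proof -
  define A B D E Q where d: "A = [n, m]" "B = [N, M]" "D = pmul [N - n, M - m] B" "E = pmul B B" "Q = pmul B E"
  have ck: "0 < N" "0 < M" "length w = length ls" "list_all (\<lambda>l. 0 \<le> l) ls"
    "\<And>z z'. (z, z') \<in> {(B, E), (B, []), ([], E), (pscale 2 A, []), ([], pscale 2 (pmul A B))}
      \<Longrightarrow> pneg (constr_poly A B D ([], z, z', Q) w ls)"
    using chk unfolding infeasible_check_def constr_neg_def d by auto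
  obtain x where x: "0 \<le> x" "peval A x = \<alpha> * peval B x" "0 < peval B x"
    using mobius_parameter[OF ck(1,2) lo hi] unfolding d by blast
  define b where "b = peval B x"
  have b: "0 < b" "peval A x = \<alpha> * b" "peval B x = b" using x by (simp_all add: b_def)
  have "peval [N - n, M - m] x = (1 - \<alpha>) * b" using x(2) by (simp add: d b_def algebra_simps)
  then have D: "peval D x = (1 - \<alpha>) * b\<^sup>2" by (simp only: d(3) peval_pmul b(3)) (simp add: power2_eq_square)
  have v: "constr \<alpha> w ls v < 0"
    if "(z, z') \<in> {(B, E), (B, []), ([], E), (pscale 2 A, []), ([], pscale 2 (pmul A B))}"
      "peval z x = b * fst v" "peval z' x = b * b * snd v" for z z' v
  proof -
    have "peval (constr_poly A B D ([], z, z', Q) w ls) x = 2 * b * b ^ Suc (length w) * constr \<alpha> w ls v"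
      using constr_poly_eval[OF b(2,3) D that(2,3) _ ck(3), of Q "[]"]
      by (simp add: d(4,5) b(3) power2_eq_square)
    moreover have "peval (constr_poly A B D ([], z, z', Q) w ls) x < 0"
      by (rule peval_neg[OF ck(5)[OF that(1)] x(1)])
    ultimately show ?thesis using b(1) by (simp add: mult_less_0_iff zero_less_mult_iff)
  qed
  have "constr \<alpha> w ls p < 0"
  proof (rule affine_neg_truncated_square[OF constr_affine \<alpha> p])
    show "constr \<alpha> w ls (1, 1) < 0" by (rule v[of B E]) (simp_all add: d(4) b)
    show "constr \<alpha> w ls (1, 0) < 0" by (rule v[of B "[]"]) (simp_all add: b)
    show "constr \<alpha> w ls (0, 1) < 0" by (rule v[of "[]" E]) (simp_all add: d(4) b)
    show "constr \<alpha> w ls (2 * \<alpha>, 0) < 0" by (rule v[of "pscale 2 A" "[]"]) (simp_all add: b)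
    show "constr \<alpha> w ls (0, 2 * \<alpha>) < 0" by (rule v[of "[]" "pscale 2 (pmul A B)"]) (simp_all add: b)
  qed
  then show ?thesis using constr_nonneg[OF ck(4), of p \<alpha> w] by (meson not_less)
qed

section \<open>Expansion along admissible words\<close>

text \<open>A letter \<open>s\<close> is demanded in front so that a certificate may start one step
  earlier and use that the orbit enters the word through one of the two branches.\<close>

definition excluded :: "real \<Rightarrow> bool list \<Rightarrow> bool" where
  "excluded \<alpha> x \<longleftrightarrow> (\<forall>w s. cell \<alpha> quarter (w @ s # x) = {})"

lemma brs_quarter_truncated:
  assumes \<alpha>: "0 < \<alpha>" "\<alpha> < 1/2" and z: "z \<in> cell \<alpha> quarter w"
  shows "brs \<alpha> w z \<in> truncated_square \<alpha>"
  using z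
proof (induction w rule: rev_induct)
  case Nil
  then show ?case using \<alpha> by (auto simp: quarter_def truncated_square_def)
next
  case (snoc s w)
  then show ?case using br_truncated_square[OF \<alpha>] by (simp add: cell_snoc brs_snoc)
qed

lemma cell_quarter_empty:
  assumes \<alpha>: "0 < \<alpha>" "\<alpha> < 1/2" and "\<And>p. p \<in> truncated_square \<alpha> \<Longrightarrow> p \<notin> cell \<alpha> UNIV x"
  shows "cell \<alpha> quarter (w @ x) = {}"
proof -
  have "z \<notin> cell \<alpha> quarter (w @ x)" for z
    using assms(3)[OF brs_quarter_truncated[OF \<alpha>]] unfolding cell_append by blast
  then show ?thesis by blast
qed

lemma excluded_check:
  assumes \<alpha>: "0 < \<alpha>" "\<alpha> < 1/2" and "infeasible_check n N m M x ls"
    and "of_int n \<le> \<alpha> * of_int N" "\<alpha> * of_int M < of_int m"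
  shows "excluded \<alpha> x"
proof -
  have "cell \<alpha> quarter ((w @ [s]) @ x) = {}" for w s
    by (rule cell_quarter_empty[OF \<alpha>]) (rule infeasible_check_sound[OF assms(3-5) \<alpha>])
  then show ?thesis by (simp add: excluded_def)
qed

lemma excluded_check_Cons:
  assumes \<alpha>: "0 < \<alpha>" "\<alpha> < 1/2"
    and "infeasible_check n N m M (True # x) ls" "infeasible_check n' N' m' M' (False # x) ls'"
    and "of_int n \<le> \<alpha> * of_int N" "\<alpha> * of_int M < of_int m"
    and "of_int n' \<le> \<alpha> * of_int N'" "\<alpha> * of_int M' < of_int m'"
  shows "excluded \<alpha> x"
proof -
  have "cell \<alpha> quarter (w @ s # x) = {}" for w s
    by (rule cell_quarter_empty[OF \<alpha>], cases s)
       (use infeasible_check_sound[OF assms(3,5,6) \<alpha>] infeasible_check_sound[OF assms(4,7,8) \<alpha>] in auto)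
  then show ?thesis by (simp add: excluded_def)
qed

section \<open>Quadratic forms along runs and rates of words\<close>

lemma quad_lb_False: "quad \<alpha> 1 (lb \<alpha> False v) = 2 * (1 - \<alpha>) * quad \<alpha> 1 v"
  by (simp add: quad_def lb_def oml_def power2_eq_square algebra_simps)

lemma quad_lb_True: "quad \<alpha> e (lb \<alpha> True v) = quad \<alpha> (- e) (lb \<alpha> False v)"
  by (simp add: quad_def lb_def)

lemma quad_run:
  assumes "1 \<le> m"
  shows "quad \<alpha> (-1) (lbs \<alpha> (runs [m] 0) v) = (2 * (1 - \<alpha>)) ^ m * quad \<alpha> 1 v"
proof -
  have "quad \<alpha> 1 (lbs \<alpha> (replicate k False) v) = (2 * (1 - \<alpha>)) ^ k * quad \<alpha> 1 v" for k
    by (induction k arbitrary: v) (simp_all add: lbs_Cons quad_lb_False)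
  moreover have "runs [m] 0 = replicate (m - 1) False @ [True]" by (simp add: runs_def)
  moreover have "m = Suc (m - 1)" using assms by simp
  ultimately show ?thesis by (metis (no_types) lbs_snoc minus_minus mult.assoc power_Suc quad_lb_False quad_lb_True)
qed

lemma quad_0_nonneg: "\<alpha> < 1 \<Longrightarrow> 0 \<le> quad \<alpha> 0 v"
  by (simp add: quad_def)

text \<open>By the arithmetic-geometric mean inequality the mixed term is at most \<alpha> / sqrt J
  times the form with \<open>e = 0\<close>; \<open>c\<close> stands for a rational upper bound of
  this ratio.\<close>

lemma quad_bounds:
  assumes \<alpha>: "0 < \<alpha>" "\<alpha> < 1/2" and c: "0 \<le> c" "\<alpha>\<^sup>2 \<le> c\<^sup>2 * (2 * (1 - \<alpha>))" and e: "\<bar>e\<bar> = 1"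
  shows "(1 - c) * quad \<alpha> 0 v \<le> quad \<alpha> e v" "quad \<alpha> e v \<le> (1 + c) * quad \<alpha> 0 v"
proof -
  define J where "J = 2 * (1 - \<alpha>)"
  obtain x y where v: "v = (x, y)" by fastforce
  have "\<bar>2 * \<alpha> * x * y\<bar> \<le> c * (J * x\<^sup>2 + y\<^sup>2)"
  proof (rule abs_le_square_iff[THEN iffD2, THEN order_trans])
    have "\<alpha>\<^sup>2 * (x * y)\<^sup>2 \<le> c\<^sup>2 * J * (x * y)\<^sup>2" using c(2) by (intro mult_right_mono) (simp_all add: J_def)
    moreover have "0 \<le> c\<^sup>2 * (J * x\<^sup>2 - y\<^sup>2)\<^sup>2" by simp
    ultimately show "(2 * \<alpha> * x * y)\<^sup>2 \<le> (c * (J * x\<^sup>2 + y\<^sup>2))\<^sup>2"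
      by (simp add: power2_eq_square algebra_simps)
    show "\<bar>c * (J * x\<^sup>2 + y\<^sup>2)\<bar> \<le> c * (J * x\<^sup>2 + y\<^sup>2)"
      using c(1) \<alpha> by (simp add: J_def)
  qed
  moreover have "\<bar>2 * e * \<alpha> * x * y\<bar> = \<bar>2 * \<alpha> * x * y\<bar>" using e by (simp add: abs_mult)
  ultimately have "\<bar>2 * e * \<alpha> * x * y\<bar> \<le> c * (J * x\<^sup>2 + y\<^sup>2)" by simp
  then show "(1 - c) * quad \<alpha> 0 v \<le> quad \<alpha> e v" "quad \<alpha> e v \<le> (1 + c) * quad \<alpha> 0 v"
    by (simp_all add: quad_def v J_def abs_le_iff algebra_simps)
qed

lemma expands_mono:
  assumes "\<alpha> < 1" "expands \<alpha> 0 r w" "s \<le> r"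
  shows "expands \<alpha> 0 s w"
  using assms quad_0_nonneg[OF assms(1)] unfolding expands_def
  by (meson mult_right_mono order_trans)

lemma expands_append:
  assumes "expands \<alpha> e r w" "expands \<alpha> 0 s v" "0 \<le> s"
  shows "expands \<alpha> e (r * s) (w @ v)"
  unfolding expands_def
proof
  fix u
  have "s * (r * quad \<alpha> e u) \<le> s * quad \<alpha> 0 (lbs \<alpha> w u)"
    using assms(1,3) unfolding expands_def by (intro mult_left_mono) blast+
  also have "\<dots> \<le> quad \<alpha> 0 (lbs \<alpha> (w @ v) u)" using assms(2) unfolding expands_def lbs_append by blast
  finally show "r * s * quad \<alpha> e u \<le> quad \<alpha> 0 (lbs \<alpha> (w @ v) u)" by (simp add: mult.assoc mult.left_commute)
qed

text \<open>The two branches differ by a reflection, which is an isometry.\<close>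

lemma expands_change_last:
  assumes "expands \<alpha> e r (w @ [s])"
  shows "expands \<alpha> e r (w @ [t])"
proof -
  have "quad \<alpha> 0 (lb \<alpha> s v) = quad \<alpha> 0 (lb \<alpha> t v)" for v
    by (cases s; cases t) (simp_all add: quad_lb_True)
  then show ?thesis using assms by (simp add: expands_def lbs_snoc)
qed

text \<open>A run multiplies the adapted form by a constant exactly, only the passage between the forms
  loses a factor.\<close>

lemma expands_run_append:
  assumes \<alpha>: "0 < \<alpha>" "\<alpha> \<le> a" "a < 1/2" and c: "0 \<le> c" "c < 1" "a\<^sup>2 \<le> c\<^sup>2 * (2 * (1 - a))"
    and w: "expands \<alpha> (-1) k w" "0 \<le> k" and m: "1 \<le> m" and r: "r \<le> k * (2 * (1 - a)) ^ m * (1 - c)"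
  shows "expands \<alpha> 0 r (runs [m] 0 @ w)"
  unfolding expands_def
proof
  fix u
  have "\<alpha>\<^sup>2 \<le> a\<^sup>2" using \<alpha> by (simp add: power_mono)
  also have "\<dots> \<le> c\<^sup>2 * (2 * (1 - a))" by (rule c)
  also have "\<dots> \<le> c\<^sup>2 * (2 * (1 - \<alpha>))" using \<alpha> by (simp add: mult_left_mono)
  finally have c': "\<alpha>\<^sup>2 \<le> c\<^sup>2 * (2 * (1 - \<alpha>))" .
  have nn: "0 \<le> quad \<alpha> 0 u" using \<alpha> by (intro quad_0_nonneg) simp
  have "r * quad \<alpha> 0 u \<le> k * (2 * (1 - a)) ^ m * (1 - c) * quad \<alpha> 0 u"
    using r nn by (rule mult_right_mono)
  also have "\<dots> \<le> k * (2 * (1 - \<alpha>)) ^ m * (1 - c) * quad \<alpha> 0 u"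
    using \<alpha> w c nn by (intro mult_right_mono mult_left_mono power_mono) auto
  also have "\<dots> = k * (2 * (1 - \<alpha>)) ^ m * ((1 - c) * quad \<alpha> 0 u)" by (simp add: mult.assoc)
  also have "\<dots> \<le> k * (2 * (1 - \<alpha>)) ^ m * quad \<alpha> 1 u"
    using \<alpha> w by (intro mult_left_mono quad_bounds(1)[OF _ _ c(1) c']) auto
  also have "\<dots> = k * quad \<alpha> (-1) (lbs \<alpha> (runs [m] 0) u)" by (simp add: quad_run[OF m])
  also have "\<dots> \<le> quad \<alpha> 0 (lbs \<alpha> w (lbs \<alpha> (runs [m] 0) u))" using w(1) unfolding expands_def by blast
  finally show "r * quad \<alpha> 0 u \<le> quad \<alpha> 0 (lbs \<alpha> (runs [m] 0 @ w) u)" by (simp add: lbs_append)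
qed

text \<open>Entering the adapted form costs \<open>1 - c\<close>, leaving its mirror image costs
  \<open>1 / (1 + c)\<close>, and J^m in between is exact. J decreases in \<alpha> and the mixed
  term grows, so all is checked at the right end \<open>a\<close> of an interval and at the shortest
  run.\<close>

lemma expands_run:
  assumes \<alpha>: "0 < \<alpha>" "\<alpha> \<le> a" "a < 1/2" and c: "0 \<le> c" "c < 1" "a\<^sup>2 \<le> c\<^sup>2 * (2 * (1 - a))"
    and m: "1 \<le> n" "n \<le> m" and r: "r * (1 + c) \<le> (2 * (1 - a)) ^ n * (1 - c)"
  shows "expands \<alpha> 0 r (runs [m] 0)"
proof -
  have "\<alpha>\<^sup>2 \<le> a\<^sup>2" using \<alpha> by (simp add: power_mono)
  also have "\<dots> \<le> c\<^sup>2 * (2 * (1 - a))" by (rule c)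
  also have "\<dots> \<le> c\<^sup>2 * (2 * (1 - \<alpha>))" using \<alpha> by (simp add: mult_left_mono)
  finally have c': "\<alpha>\<^sup>2 \<le> c\<^sup>2 * (2 * (1 - \<alpha>))" .
  have "expands \<alpha> (-1) (1 / (1 + c)) []"
    using quad_bounds(2)[OF _ _ c(1) c', of "-1"] \<alpha> c by (simp add: expands_def divide_le_eq mult.commute)
  moreover have "r * (1 + c) \<le> (2 * (1 - a)) ^ m * (1 - c)"
    using r m c \<alpha> by (intro order_trans[OF r] mult_right_mono power_increasing) auto
  then have "r \<le> 1 / (1 + c) * (2 * (1 - a)) ^ m * (1 - c)"
    using c by (simp add: le_divide_eq)
  ultimately have "expands \<alpha> 0 r (runs [m] 0 @ [])"
    using c m by (intro expands_run_append[OF \<alpha> c, of "1 / (1 + c)"]) auto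
  then show ?thesis by simp
qed

text \<open>The rate 1/3 is (1 - c) / (1 + c) for c = 1/2. It serves only to bound the loss on a
  bounded number of letters outside the expanding pieces.\<close>

lemma expands_single:
  assumes \<alpha>: "0 < \<alpha>" "\<alpha> < 1/2"
  shows "expands \<alpha> 0 (1/3) [s]"
proof -
  have "\<alpha>\<^sup>2 \<le> (1/2)\<^sup>2" using \<alpha> by (intro power_mono) auto
  then have "expands \<alpha> 0 (1/3) (runs [1] 0)"
    using \<alpha> by (intro expands_run[OF \<alpha>(1) order_refl \<alpha>(2), of "1/2" 1]) (auto simp: power2_eq_square)
  then show ?thesis using expands_change_last[of \<alpha> 0 "1/3" "[]" True s] by (simp add: runs_def)
qed

lemma expands_any:
  assumes \<alpha>: "0 < \<alpha>" "\<alpha> < 1/2"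
  shows "expands \<alpha> 0 ((1/3) ^ length w) w"
proof (induction w)
  case (Cons s w)
  then show ?case using expands_append[OF expands_single[OF \<alpha>, of s], of _ w] by simp
qed (simp add: expands_def)

text \<open>The words \<open>b\<close> at which the search through the continuations of an increasing branch stops:
  \<open>b\<close> is an expanding word after which the search can be resumed, or \<open>b\<close> cannot occur.\<close>

definition stops :: "nat \<Rightarrow> bool list list \<Rightarrow> bool list list \<Rightarrow> bool list \<Rightarrow> bool" where
  "stops T E X b \<longleftrightarrow> (b \<in> set E \<and> last b) \<or> list_ex (\<lambda>e. b = e @ replicate T False) ([] # E)
    \<or> list_ex (\<lambda>x. drop (Suc (length b) - length x) (True # b) = x) X"

text \<open>The last argument records whether the search stops at \<open>b\<close>; matching on it
  prunes the subtree during evaluation. The number bounds the remaining depth.\<close>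

fun covered :: "nat \<Rightarrow> bool list list \<Rightarrow> bool list list \<Rightarrow> nat \<Rightarrow> bool list \<Rightarrow> bool \<Rightarrow> bool" where
  "covered T E X n b True = True"
| "covered T E X 0 b False = False"
| "covered T E X (Suc n) b False =
    (covered T E X n (b @ [True]) (stops T E X (b @ [True])) \<and>
     covered T E X n (b @ [False]) (stops T E X (b @ [False])))"

lemma covered_stops:
  assumes "covered T E X n b c" "c \<Longrightarrow> stops T E X b" "take (length b) v = b" "length b + n \<le> length v"
  shows "\<exists>b'. take (length b') v = b' \<and> length b' \<le> length b + n \<and> stops T E X b'"
  using assms
proof (induction T E X n b c rule: covered.induct)
  case (3 T E X n b)
  have l: "length b < length v" using "3.prems" by simp
  let ?s = "v ! length b"
  have t: "take (length (b @ [?s])) v = b @ [?s]" using "3.prems"(3) l by (simp add: take_Suc_conv_app_nth)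
  have "\<exists>b'. take (length b') v = b' \<and> length b' \<le> length (b @ [?s]) + n \<and> stops T E X b'"
  proof (cases ?s)
    case True
    then show ?thesis using "3.IH"(1) "3.prems" t by simp
  next
    case False
    then show ?thesis using "3.IH"(2) "3.prems" t by simp
  qed
  then show ?case by auto
qed auto

definition contracting :: "real \<Rightarrow> bool" where
  "contracting \<alpha> \<longleftrightarrow> (\<exists>K \<theta>. 0 < K \<and> 0 < \<theta> \<and> \<theta> < 1 \<and>
     (\<forall>w v u. cell \<alpha> quarter (w @ v) \<noteq> {} \<longrightarrow> norm (ilbs \<alpha> v u) \<le> K * \<theta> ^ length v * norm u))"

lemma leading_False_split:
  assumes "take n v = replicate n False" "take m v \<noteq> replicate m False" "m \<le> length v"
  obtains k v' where "n \<le> k" "k < m" "v = replicate k False @ True # v'"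
proof
  define k where "k = length (takeWhile Not v)"
  have tw: "takeWhile Not v = replicate k False"
    unfolding k_def by (rule replicate_length_same[symmetric]) (use set_takeWhileD in fastforce)
  have split: "v = replicate k False @ dropWhile Not v" by (metis takeWhile_dropWhile_id tw)
  show k: "k < m"
  proof (rule ccontr)
    assume "\<not> k < m"
    then have "take m v = replicate m False" by (subst split) (simp add: min_absorb1)
    then show False using assms(2) by simp
  qed
  then have ne: "dropWhile Not v \<noteq> []"
    using assms(3) split by (metis append_Nil2 length_replicate not_le)
  then have "hd (dropWhile Not v)" using hd_dropWhile by blast
  then show "v = replicate k False @ True # tl (dropWhile Not v)" using split ne by (metis (full_types) hd_Cons_tl)
  then have "v ! k" by (metis length_replicate nth_append_length)
  moreover have "\<not> v ! i" if "i < n" for i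
    using that assms(1) by (metis nth_replicate nth_take)
  ultimately show "n \<le> k" by (meson not_le)
qed

text \<open>A long run of decreasing branches is cut into expanding pieces of length three; otherwise the
  search stops after a bounded number of steps with an expanding piece.\<close>

lemma contracting_if_covered:
  assumes \<alpha>: "0 < \<alpha>" "\<alpha> < 1/2" and r: "1 < r"
    and E: "\<And>e. e \<in> set E \<Longrightarrow> expands \<alpha> 0 r e"
    and X: "\<And>x. x \<in> set X \<Longrightarrow> excluded \<alpha> x"
    and long: "\<And>m. T < m \<Longrightarrow> expands \<alpha> 0 r (runs [m] 0)"
    and peel: "expands \<alpha> 0 r (replicate 3 False)"
    and cov: "covered T E X n [] (stops T E X [])"
  shows "contracting \<alpha>"
proof -
  \<comment> \<open>The states in which the search can be resumed: an increasing branch has just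
    been read, with a letter before it as \<open>excluded\<close> demands, or \<open>T\<close>
    decreasing branches lie ahead.\<close>
  define good where "good = (\<lambda>w v :: bool list. (2 \<le> length w \<and> last w) \<or> take T v = replicate T False)"
  define N where "N = T + n + 4 + sum_list (map length E)"
  have lenE: "length e \<le> N" if "e \<in> set E" for e
    using member_le_sum_list[of "length e" "map length E"] that by (simp add: N_def)
  have ne: "e \<noteq> []" if "expands \<alpha> 0 r e" for e
  proof
    assume "e = []"
    then have "r * quad \<alpha> 0 (0, 1) \<le> quad \<alpha> 0 (0, 1)" using that by (simp add: expands_def)
    then show False using r by (simp add: quad_def)
  qed
  let ?step = "\<lambda>w v. \<exists>b v'. v = b @ v' \<and> length b \<le> N \<and> expands \<alpha> 0 r b \<and> good (w @ b) v'"
  \<comment> \<open>If \<open>T + 3\<close> decreasing branches lie ahead, three are split off and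
    \<open>T\<close> still remain. Otherwise what is left of the run has length between
    \<open>T + 1\<close> and \<open>T + 3\<close> and expands as a whole.\<close>
  have long_step: "?step w v" if tT: "take T v = replicate T False" and lN: "N \<le> length v" for w v
  proof (cases "take (T + 3) v = replicate (T + 3) False")
    case True
    have "take 3 v = take 3 (take (T + 3) v)" by (simp add: min_def)
    then have b: "take 3 v = replicate 3 False" unfolding True by (simp add: min_def)
    have "take T (drop 3 v) = drop 3 (take (T + 3) v)" by (simp add: drop_take)
    then have "take T (drop 3 v) = replicate T False" unfolding True by simp
    moreover have "v = replicate 3 False @ drop 3 v" using b by (metis append_take_drop_id)
    ultimately show ?thesis using peel by (intro exI[of _ "replicate 3 False"] exI[of _ "drop 3 v"]) (simp add: good_def N_def)
  next
    case False
    have "T + 3 \<le> length v" using lN by (simp add: N_def)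
    then obtain k v' where k: "T \<le> k" "k < T + 3" "v = replicate k False @ True # v'"
      using leading_False_split[OF tT False] by blast
    have b: "runs [Suc k] 0 = replicate k False @ [True]" by (simp add: runs_def)
    have "good (w @ runs [Suc k] 0) v'"
    proof (cases "T = 0")
      case True
      then show ?thesis by (simp add: good_def)
    next
      case False
      then show ?thesis using k by (simp add: good_def b)
    qed
    then show ?thesis using k long[of "Suc k"]
      by (intro exI[of _ "runs [Suc k] 0"] exI[of _ v']) (simp add: b N_def)
  qed
  have step: "?step w v" if g: "good w v" and a: "cell \<alpha> quarter (w @ v) \<noteq> {}" and l: "N \<le> length v" for w v
  proof (cases "take T v = replicate T False")
    case True
    then show ?thesis by (rule long_step[OF _ l])
  next
    case False
    then have w: "2 \<le> length w" "last w" using g by (auto simp: good_def)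
    obtain b where b: "take (length b) v = b" "length b \<le> n" "stops T E X b"
      using covered_stops[OF cov, of v] l by (auto simp: N_def)
    define v' where "v' = drop (length b) v"
    have v: "v = b @ v'" using b(1) by (metis append_take_drop_id v'_def)
    from b(3) consider "b \<in> set E" "last b" | e where "e \<in> insert [] (set E)" "b = e @ replicate T False"
      | x where "x \<in> set X" "drop (Suc (length b) - length x) (True # b) = x"
      unfolding stops_def by (auto simp: list_ex_iff)
    then show ?thesis
    proof cases
      case 1
      then have "good (w @ b) v'" using ne[OF E[OF 1(1)]] w by (simp add: good_def)
      then show ?thesis using v E[OF 1(1)] lenE[OF 1(1)] by blast
    next
      case 2
      show ?thesis
      proof (cases "e = []")
        case True
        then show ?thesis using 2 v False by simp
      next
        case False
        then have e: "e \<in> set E" using 2 by simp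
        have "good (w @ e) (replicate T False @ v')" by (simp add: good_def)
        then show ?thesis using v 2(2) E[OF e] lenE[OF e] by (metis append.assoc)
      qed
    next
      case 3
      \<comment> \<open>The excluded word may begin with the last letter of \<open>w\<close>. As
        \<open>w\<close> has at least two letters, some letter precedes it even then.\<close>
      define y where "y = take (Suc (length b) - length x) (True # b)"
      have yx: "True # b = y @ x" using 3(2) by (metis append_take_drop_id y_def)
      have wl: "w = butlast w @ [True]" using w by (metis (full_types) append_butlast_last_id list.size(3) not_numeral_le_zero)
      have "butlast w \<noteq> []" using w(1) by (cases w rule: rev_cases) auto
      then have "butlast w @ y \<noteq> []" by simp
      then obtain z s where z: "butlast w @ y = z @ [s]" by (metis append_butlast_last_id)
      have "w @ b = butlast w @ (True # b)" by (subst wl) simp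
      also have "\<dots> = (butlast w @ y) @ x" unfolding yx by simp
      also have "\<dots> = z @ s # x" unfolding z by simp
      finally have "cell \<alpha> quarter (w @ b) = {}" using X[OF 3(1)] by (simp add: excluded_def)
      then have "cell \<alpha> quarter ((w @ b) @ v') = {}" by (subst cell_append) simp
      then show ?thesis using a v by simp
    qed
  qed
  \<comment> \<open>A piece has at most \<open>N\<close> letters and gains \<open>r\<close>, hence
    at least \<rho> per letter. The factor \<open>d\<close> below is the price of a letter outside
    the pieces, which may lose 1/3 instead of gaining \<rho>.\<close>
  define \<rho> where "\<rho> = root N r"
  have N: "0 < N" by (simp add: N_def)
  have \<rho>: "1 < \<rho>" "\<rho> ^ N = r" using r N by (simp_all add: \<rho>_def)
  define d where "d = 1 / (3 * \<rho>)"
  have d: "0 < d" "d \<le> 1" "d * \<rho> = 1/3" using \<rho> by (simp_all add: d_def)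
  have pow: "(d * \<rho>) ^ k = d ^ k * \<rho> ^ k" for k by (rule power_mult_distrib)
  have q0: "0 \<le> quad \<alpha> 0 u" for u using \<alpha> by (simp add: quad_0_nonneg)
  have grow: "d ^ N * \<rho> ^ length v * quad \<alpha> 0 u \<le> quad \<alpha> 0 (lbs \<alpha> v u)"
    if "good w v" "cell \<alpha> quarter (w @ v) \<noteq> {}" for w v u
    using that
  proof (induction "length v" arbitrary: w v u rule: less_induct)
    case less
    show ?case
    proof (cases "N \<le> length v")
      case True
      obtain b v' where b: "v = b @ v'" "length b \<le> N" "expands \<alpha> 0 r b" "good (w @ b) v'"
        using step[OF less.prems True] by blast
      have "b \<noteq> []" using ne b(3) by blast
      then have IH: "d ^ N * \<rho> ^ length v' * quad \<alpha> 0 (lbs \<alpha> b u) \<le> quad \<alpha> 0 (lbs \<alpha> v' (lbs \<alpha> b u))"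
        using less.prems(2) b by (intro less.hyps[of v' "w @ b"]) auto
      have "\<rho> ^ length b \<le> r" using \<rho> b(2) by (metis less_imp_le power_increasing)
      then have "\<rho> ^ length b * quad \<alpha> 0 u \<le> r * quad \<alpha> 0 u" using q0 by (rule mult_right_mono)
      also have "\<dots> \<le> quad \<alpha> 0 (lbs \<alpha> b u)" using b(3) unfolding expands_def by blast
      finally have "d ^ N * \<rho> ^ length v' * (\<rho> ^ length b * quad \<alpha> 0 u) \<le> d ^ N * \<rho> ^ length v' * quad \<alpha> 0 (lbs \<alpha> b u)"
        using d \<rho> by (intro mult_left_mono) auto
      then show ?thesis using IH by (simp add: b(1) lbs_append power_add mult_ac)
    next
      case False
      have "d ^ N * \<rho> ^ length v * quad \<alpha> 0 u \<le> d ^ length v * \<rho> ^ length v * quad \<alpha> 0 u"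
        using d \<rho> q0 False by (intro mult_right_mono power_decreasing) auto
      also have "\<dots> = (1/3) ^ length v * quad \<alpha> 0 u" using pow d(3) by metis
      also have "\<dots> \<le> quad \<alpha> 0 (lbs \<alpha> v u)" using expands_any[OF \<alpha>] unfolding expands_def by blast
      finally show ?thesis .
    qed
  qed
  have all: "d ^ (2 * N) * \<rho> ^ length v * quad \<alpha> 0 u \<le> quad \<alpha> 0 (lbs \<alpha> v u)"
    if a: "cell \<alpha> quarter (w @ v) \<noteq> {}" for w v u
  proof -
    \<comment> \<open>The word may start in the middle of a run. Its first letter is set aside as a
      predecessor; then either \<open>T\<close> decreasing branches follow or an increasing one
      comes soon.\<close>
    obtain b v' where b: "v = b @ v'" "length b \<le> N" "v' = [] \<or> good (w @ b) v'"
    proof (cases "length v \<le> N")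
      case True
      then show ?thesis using that[of v "[]"] by simp
    next
      case False
      then obtain s v1 where v: "v = s # v1" by (cases v) auto
      show ?thesis
      proof (cases "take T v1 = replicate T False")
        case True
        then show ?thesis using that[of "[s]" v1] by (simp add: v good_def N_def)
      next
        case nT: False
        have "take 0 v1 = replicate 0 False" "T \<le> length v1" using False by (simp_all add: v N_def)
        then obtain k v2 where "k < T" "v1 = replicate k False @ True # v2"
          using leading_False_split[OF _ nT] by blast
        then show ?thesis using that[of "s # replicate k False @ [True]" v2]
          by (simp add: v good_def N_def)
      qed
    qed
    have "d ^ N * (1/3) ^ length b * \<rho> ^ length v' * quad \<alpha> 0 u = d ^ N * \<rho> ^ length v' * ((1/3) ^ length b * quad \<alpha> 0 u)"
      by simp
    also have "\<dots> \<le> d ^ N * \<rho> ^ length v' * quad \<alpha> 0 (lbs \<alpha> b u)"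
    proof (rule mult_left_mono)
      show "(1/3) ^ length b * quad \<alpha> 0 u \<le> quad \<alpha> 0 (lbs \<alpha> b u)"
        using expands_any[OF \<alpha>, of b] unfolding expands_def by blast
    qed (use d \<rho> in simp)
    also have "\<dots> \<le> quad \<alpha> 0 (lbs \<alpha> v' (lbs \<alpha> b u))"
    proof (cases "v' = []")
      case True
      have "d ^ N * quad \<alpha> 0 (lbs \<alpha> b u) \<le> 1 * quad \<alpha> 0 (lbs \<alpha> b u)"
        using d q0 by (intro mult_right_mono power_le_one) auto
      then show ?thesis using True by simp
    next
      case False
      then show ?thesis using grow[of "w @ b" v'] a b by simp
    qed
    finally have "d ^ N * (1/3) ^ length b * \<rho> ^ length v' * quad \<alpha> 0 u \<le> quad \<alpha> 0 (lbs \<alpha> v u)"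
      by (simp add: b(1) lbs_append)
    moreover have "d ^ (2 * N) * \<rho> ^ length v \<le> d ^ N * (1/3) ^ length b * \<rho> ^ length v'"
    proof -
      have "d ^ (2 * N) * \<rho> ^ length v = d ^ N * (d ^ N * \<rho> ^ length b) * \<rho> ^ length v'"
        unfolding b(1) length_append power_add mult_2 by (simp only: mult_ac)
      also have "\<dots> \<le> d ^ N * (d ^ length b * \<rho> ^ length b) * \<rho> ^ length v'"
        using d \<rho> b(2) by (intro mult_right_mono mult_left_mono power_decreasing) auto
      also have "d ^ length b * \<rho> ^ length b = (1/3) ^ length b" using pow d(3) by metis
      finally show ?thesis .
    qed
    ultimately show ?thesis using q0 by (meson mult_right_mono order_trans)
  qed
  \<comment> \<open>Square roots appear because \<open>quad\<close> is quadratic; the 2 is its upper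
    bound in terms of the squared norm.\<close>
  define K where "K = sqrt (2 / d ^ (2 * N))"
  define \<theta> where "\<theta> = sqrt (1 / \<rho>)"
  have "norm (ilbs \<alpha> v u) \<le> K * \<theta> ^ length v * norm u" if "cell \<alpha> quarter (w @ v) \<noteq> {}" for w v u
  proof -
    have n1: "(norm x)\<^sup>2 \<le> quad \<alpha> 0 x" and n2: "quad \<alpha> 0 x \<le> 2 * (norm x)\<^sup>2" for x :: "real \<times> real"
    proof -
      have "1 * (fst x)\<^sup>2 \<le> 2 * (1 - \<alpha>) * (fst x)\<^sup>2" "2 * (1 - \<alpha>) * (fst x)\<^sup>2 \<le> 2 * (fst x)\<^sup>2"
        using \<alpha> by (intro mult_right_mono; simp)+
      moreover have "(norm x)\<^sup>2 = (fst x)\<^sup>2 + (snd x)\<^sup>2" by (simp add: norm_prod_def)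
      moreover have "quad \<alpha> 0 x = 2 * (1 - \<alpha>) * (fst x)\<^sup>2 + (snd x)\<^sup>2" by (simp add: quad_def)
      moreover have "0 \<le> (snd x)\<^sup>2" by simp
      ultimately show "(norm x)\<^sup>2 \<le> quad \<alpha> 0 x" "quad \<alpha> 0 x \<le> 2 * (norm x)\<^sup>2" by linarith+
    qed
    have c: "0 < d ^ (2 * N) * \<rho> ^ length v" using d \<rho> by simp
    have "d ^ (2 * N) * \<rho> ^ length v * (norm (ilbs \<alpha> v u))\<^sup>2 \<le> d ^ (2 * N) * \<rho> ^ length v * quad \<alpha> 0 (ilbs \<alpha> v u)"
      using c n1 by (intro mult_left_mono) auto
    also have "\<dots> \<le> quad \<alpha> 0 u" using all[OF that, of "ilbs \<alpha> v u"] by (simp add: lbs_ilbs[OF \<alpha>])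
    also have "\<dots> \<le> 2 * (norm u)\<^sup>2" by (rule n2)
    finally have "(norm (ilbs \<alpha> v u))\<^sup>2 \<le> 2 / (d ^ (2 * N) * \<rho> ^ length v) * (norm u)\<^sup>2"
      using c by (simp add: field_simps)
    also have "\<dots> = K\<^sup>2 * (\<theta>\<^sup>2) ^ length v * (norm u)\<^sup>2"
    proof -
      have "K\<^sup>2 = 2 / d ^ (2 * N)" "\<theta>\<^sup>2 = 1 / \<rho>" using d \<rho> by (simp_all add: K_def \<theta>_def)
      then show ?thesis by (simp add: power_divide)
    qed
    also have "\<dots> = (K * \<theta> ^ length v * norm u)\<^sup>2"
      by (simp add: power_mult_distrib mult.commute flip: power_mult)
    finally show ?thesis
      by (rule power2_le_imp_le) (use d \<rho> in \<open>simp add: K_def \<theta>_def\<close>)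
  qed
  moreover have "0 < K" "0 < \<theta>" "\<theta> < 1" using d \<rho> by (simp_all add: K_def \<theta>_def)
  ultimately show ?thesis unfolding contracting_def by blast
qed

section \<open>Certificates on parameter intervals\<close>

text \<open>The weights of the constraints and the constants of the quadratic estimates were found numerically.\<close>

lemma expands_checkI:
  assumes "expands_check n N m M e r r' k k' w"
    "of_int n \<le> \<alpha> * of_int N" "\<alpha> * of_int M < of_int m"
    "e' = of_int e" "s = of_int r / of_int r'"
  shows "expands \<alpha> e' s w"
  using expands_check_sound[OF assms(1-3)] assms(4,5) by simp

text \<open>All excluded words begin with a run of length one, the increasing branch after which the
  search starts. A single nonzero weight at the end says that the affine composition of the
  preceding letters carries the whole polygon to the wrong side of the fold line. Two nonzero
  weights, as in some certificates below, form a Farkas combination of two constraints.\<close>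

lemma excluded_1_1_1_1_0: "3/13 \<le> \<alpha> \<Longrightarrow> \<alpha> < 2/7 \<Longrightarrow> excluded \<alpha> (runs [1,1,1,1] 0)"
  by (rule excluded_check[of _ 3 13 2 7 _ "[0,0,0] @ [1]"]) (simp; fail | code_simp)+

lemma excluded_1_1_1_0: "2/7 \<le> \<alpha> \<Longrightarrow> \<alpha> < 7/20 \<Longrightarrow> excluded \<alpha> (runs [1,1,1] 0)"
  by (rule excluded_check[of _ 2 7 7 20 _ "[0,0] @ [1]"]) (simp; fail | code_simp)+

lemma excluded_1_2_0: "5/16 \<le> \<alpha> \<Longrightarrow> \<alpha> < 6/13 \<Longrightarrow> excluded \<alpha> (runs [1,2] 0)"
  by (rule excluded_check[of _ 5 16 6 13 _ "[0,0] @ [1]"]) (simp; fail | code_simp)+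

lemma excluded_1_1_0: "7/20 \<le> \<alpha> \<Longrightarrow> \<alpha> < 6/13 \<Longrightarrow> excluded \<alpha> (runs [1,1] 0)"
  by (rule excluded_check_Cons[of _ 7 20 6 13 _ "[0,0] @ [1]"
      7 20 6 13 "[0] @ [1] @ [3]"]) (simp; fail | code_simp)+

lemma excluded_1_4_3: "19/48 \<le> \<alpha> \<Longrightarrow> \<alpha> < 3/7 \<Longrightarrow> excluded \<alpha> (runs [1,4] 3)"
  by (rule excluded_check_Cons[of _ 19 48 3 7 _ "replicate 8 0 @ [1]"
      19 48 3 7 "[0] @ [7] @ replicate 6 0 @ [3]"]) (simp; fail | code_simp)+

lemma excluded_1_5_0: "19/48 \<le> \<alpha> \<Longrightarrow> \<alpha> < 6/13 \<Longrightarrow> excluded \<alpha> (runs [1,5] 0)"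
  by (rule excluded_check[of _ 19 48 6 13 _ "replicate 5 0 @ [1]"]) (simp; fail | code_simp)+

lemma excluded_1_8_0: "5/12 \<le> \<alpha> \<Longrightarrow> \<alpha> < 6/13 \<Longrightarrow> excluded \<alpha> (runs [1,8] 0)"
  by (rule excluded_check[of _ 5 12 6 13 _ "replicate 8 0 @ [1]"]) (simp; fail | code_simp)+

lemma excluded_1_4_3_4_0: "5/12 \<le> \<alpha> \<Longrightarrow> \<alpha> < 3/7 \<Longrightarrow> excluded \<alpha> (runs [1,4,3,4] 0)"
  by (rule excluded_check[of _ 5 12 3 7 _ "replicate 4 0 @ [1] @ replicate 6 0 @ [1]"]) (simp; fail | code_simp)+

lemma excluded_1_4_3_7_0: "5/12 \<le> \<alpha> \<Longrightarrow> \<alpha> < 3/7 \<Longrightarrow> excluded \<alpha> (runs [1,4,3,7] 0)"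
  by (rule excluded_check[of _ 5 12 3 7 _ "replicate 4 0 @ [1] @ replicate 9 0 @ [1]"]) (simp; fail | code_simp)+

lemma excluded_1_4_0: "3/7 \<le> \<alpha> \<Longrightarrow> \<alpha> < 6/13 \<Longrightarrow> excluded \<alpha> (runs [1,4] 0)"
  by (rule excluded_check_Cons[of _ 3 7 6 13 _ "replicate 5 0 @ [1]"
      3 7 6 13 "[0] @ [68] @ [0,0,0] @ [27]"]) (simp; fail | code_simp)+

lemma excluded_1_7_7_0: "3/7 \<le> \<alpha> \<Longrightarrow> \<alpha> < 4/9 \<Longrightarrow> excluded \<alpha> (runs [1,7,7] 0)"
  by (rule excluded_check[of _ 3 7 4 9 _ "replicate 4 0 @ [1] @ replicate 9 0 @ [1]"]) (simp; fail | code_simp)+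

lemma excluded_1_7_10_0: "3/7 \<le> \<alpha> \<Longrightarrow> \<alpha> < 4/9 \<Longrightarrow> excluded \<alpha> (runs [1,7,10] 0)"
  by (rule excluded_check[of _ 3 7 4 9 _ "replicate 17 0 @ [1]"]) (simp; fail | code_simp)+

lemma excluded_1_7_3: "4/9 \<le> \<alpha> \<Longrightarrow> \<alpha> < 16/35 \<Longrightarrow> excluded \<alpha> (runs [1,7] 3)"
  by (rule excluded_check_Cons[of _ 4 9 16 35 _ "replicate 11 0 @ [1]"
      4 9 16 35 "[0] @ [11] @ replicate 9 0 @ [2]"]) (simp; fail | code_simp)+

lemma excluded_1_7_3_7_0: "4/9 \<le> \<alpha> \<Longrightarrow> \<alpha> < 14/31 \<Longrightarrow> excluded \<alpha> (runs [1,7,3,7] 0)"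
  by (rule excluded_check[of _ 4 9 14 31 _ "replicate 7 0 @ [1] @ replicate 9 0 @ [1]"]) (simp; fail | code_simp)+

lemma excluded_1_7_3_10_0: "4/9 \<le> \<alpha> \<Longrightarrow> \<alpha> < 14/31 \<Longrightarrow> excluded \<alpha> (runs [1,7,3,10] 0)"
  by (rule excluded_check[of _ 4 9 14 31 _ "replicate 20 0 @ [1]"]) (simp; fail | code_simp)+

lemma excluded_1_7_3_3_0: "14/31 \<le> \<alpha> \<Longrightarrow> \<alpha> < 16/35 \<Longrightarrow> excluded \<alpha> (runs [1,7,3,3] 0)"
  by (rule excluded_check_Cons[of _ 14 31 16 35 _ "replicate 14 0 @ [1]"
      14 31 16 35 "[0] @ [15] @ replicate 12 0 @ [2]"]) (simp; fail | code_simp)+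

lemma excluded_1_7_3_6: "14/31 \<le> \<alpha> \<Longrightarrow> \<alpha> < 16/35 \<Longrightarrow> excluded \<alpha> (runs [1,7,3] 6)"
  by (rule excluded_check_Cons[of _ 14 31 16 35 _ "replicate 16 0 @ [1] @ [0]"
      14 31 16 35 "replicate 8 0 @ [33] @ replicate 8 0 @ [17]"]) (simp; fail | code_simp)+

lemma excluded_1_10_6_lo: "14/31 \<le> \<alpha> \<Longrightarrow> \<alpha> < 5/11 \<Longrightarrow> excluded \<alpha> (runs [1,10] 6)"
  by (rule excluded_check_Cons[of _ 14 31 5 11 _ "replicate 17 0 @ [1]"
      14 31 5 11 "replicate 8 0 @ [2] @ replicate 8 0 @ [1]"]) (simp; fail | code_simp)+

lemma excluded_1_10_6_hi: "5/11 \<le> \<alpha> \<Longrightarrow> \<alpha> < 29/63 \<Longrightarrow> excluded \<alpha> (runs [1,10] 6)"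
  by (rule excluded_check_Cons[of _ 5 11 29 63 _ "replicate 17 0 @ [1]"
      5 11 29 63 "[0] @ [19] @ replicate 15 0 @ [2]"]) (simp; fail | code_simp)+

text \<open>After a decreasing branch the word is refuted by different pairs of constraints on the
  two sides of 5/11.\<close>

lemma excluded_1_10_6: "14/31 \<le> \<alpha> \<Longrightarrow> \<alpha> < 29/63 \<Longrightarrow> excluded \<alpha> (runs [1,10] 6)"
  using excluded_1_10_6_lo excluded_1_10_6_hi by (cases "\<alpha> < 5/11") auto

lemma excluded_1_11_0: "14/31 \<le> \<alpha> \<Longrightarrow> \<alpha> < 29/63 \<Longrightarrow> excluded \<alpha> (runs [1,11] 0)"
  by (rule excluded_check[of _ 14 31 29 63 _ "replicate 11 0 @ [1]"]) (simp; fail | code_simp)+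

lemma excluded_1_7_0: "16/35 \<le> \<alpha> \<Longrightarrow> \<alpha> < 29/63 \<Longrightarrow> excluded \<alpha> (runs [1,7] 0)"
  by (rule excluded_check_Cons[of _ 16 35 29 63 _ "replicate 8 0 @ [1]"
      16 35 29 63 "[0] @ [5] @ replicate 6 0 @ [1]"]) (simp; fail | code_simp)+

lemma excluded_1_10_3_6: "16/35 \<le> \<alpha> \<Longrightarrow> \<alpha> < 29/63 \<Longrightarrow> excluded \<alpha> (runs [1,10,3] 6)"
  by (rule excluded_check_Cons[of _ 16 35 29 63 _ "replicate 19 0 @ [1] @ [0]"
      16 35 29 63 "replicate 11 0 @ [9] @ replicate 8 0 @ [5]"]) (simp; fail | code_simp)+

section \<open>Rates of short words\<close>

lemma expands_1_a: "0 \<le> \<alpha> \<Longrightarrow> \<alpha> < 3/13 \<Longrightarrow> expands \<alpha> 0 (26/25) (runs [1] 0)"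
  by (rule expands_checkI[of 0 1 3 13 "0" 26 25 1 1]) (simp; fail | code_simp)+

lemma expands_1_b: "3/13 \<le> \<alpha> \<Longrightarrow> \<alpha> < 2/7 \<Longrightarrow> expands \<alpha> 0 (85/100) (runs [1] 0)"
  by (rule expands_checkI[of 3 13 2 7 "0" 85 100 1 1]) (simp; fail | code_simp)+

lemma expands_2_b: "3/13 \<le> \<alpha> \<Longrightarrow> \<alpha> < 2/7 \<Longrightarrow> expands \<alpha> 0 (159/100) (runs [2] 0)"
  by (rule expands_checkI[of 3 13 2 7 "0" 159 100 3 1]) (simp; fail | code_simp)+

lemma expands_3_b: "3/13 \<le> \<alpha> \<Longrightarrow> \<alpha> < 2/7 \<Longrightarrow> expands \<alpha> 0 (2/1) (runs [3] 0)"
  by (rule expands_checkI[of 3 13 2 7 "0" 2 1 4 7]) (simp; fail | code_simp)+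

lemma expands_1_c: "2/7 \<le> \<alpha> \<Longrightarrow> \<alpha> < 5/16 \<Longrightarrow> expands \<alpha> 0 (78/100) (runs [1] 0)"
  by (rule expands_checkI[of 2 7 5 16 "0" 78 100 7 8]) (simp; fail | code_simp)+

lemma expands_2_c: "2/7 \<le> \<alpha> \<Longrightarrow> \<alpha> < 5/16 \<Longrightarrow> expands \<alpha> 0 (139/100) (runs [2] 0)"
  by (rule expands_checkI[of 2 7 5 16 "0" 139 100 3 1]) (simp; fail | code_simp)+

lemma expands_3_c: "2/7 \<le> \<alpha> \<Longrightarrow> \<alpha> < 5/16 \<Longrightarrow> expands \<alpha> 0 (176/100) (runs [3] 0)"
  by (rule expands_checkI[of 2 7 5 16 "0" 176 100 1 2]) (simp; fail | code_simp)+

lemma expands_1_d: "5/16 \<le> \<alpha> \<Longrightarrow> \<alpha> < 7/20 \<Longrightarrow> expands \<alpha> 0 (7/10) (runs [1] 0)"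
  by (rule expands_checkI[of 5 16 7 20 "0" 7 10 6 7]) (simp; fail | code_simp)+

lemma expands_3_d: "5/16 \<le> \<alpha> \<Longrightarrow> \<alpha> < 7/20 \<Longrightarrow> expands \<alpha> 0 (148/100) (runs [3] 0)"
  by (rule expands_checkI[of 5 16 7 20 "0" 148 100 3 7]) (simp; fail | code_simp)+

lemma expands_3_e: "7/20 \<le> \<alpha> \<Longrightarrow> \<alpha> < 3/7 \<Longrightarrow> expands \<alpha> 0 (11/10) (runs [3] 0)"
  by (rule expands_checkI[of 7 20 3 7 "0" 11 10 1 3]) (simp; fail | code_simp)+

lemma expands_3_f: "3/7 \<le> \<alpha> \<Longrightarrow> \<alpha> < 6/13 \<Longrightarrow> expands \<alpha> 0 (103/100) (runs [3] 0)"
  by (rule expands_checkI[of 3 7 6 13 "0" 103 100 1 5]) (simp; fail | code_simp)+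

lemma expands_8_g: "3/7 \<le> \<alpha> \<Longrightarrow> \<alpha> < 4/9 \<Longrightarrow> expands \<alpha> 0 (3/2) (runs [8] 0)"
  by (rule expands_checkI[of 3 7 4 9 "0" 3 2 3 1]) (simp; fail | code_simp)+

lemma expands_8_h: "4/9 \<le> \<alpha> \<Longrightarrow> \<alpha> < 14/31 \<Longrightarrow> expands \<alpha> 0 (13/10) (runs [8] 0)"
  by (rule expands_checkI[of 4 9 14 31 "0" 13 10 3 1]) (simp; fail | code_simp)+

text \<open>The source form is the one in which a preceding run ends. Attaching the word there
  avoids the return to \<open>e = 0\<close> and saves the factor \<open>1 / (1 + c)\<close>.\<close>

lemma reflected_3_f: "19/48 \<le> \<alpha> \<Longrightarrow> \<alpha> < 5/12 \<Longrightarrow> expands \<alpha> (- 1) (92/100) (runs [3] 0)"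
  by (rule expands_checkI[of 19 48 5 12 "- 1" 92 100 1 2]) (simp; fail | code_simp)+

lemma reflected_3_3_f: "5/12 \<le> \<alpha> \<Longrightarrow> \<alpha> < 3/7 \<Longrightarrow> expands \<alpha> (- 1) (103/100) (runs [3,3] 0)"
  by (rule expands_checkI[of 5 12 3 7 "- 1" 103 100 3 8]) (simp; fail | code_simp)+

lemma reflected_3_g: "3/7 \<le> \<alpha> \<Longrightarrow> \<alpha> < 4/9 \<Longrightarrow> expands \<alpha> (- 1) (844/1000) (runs [3] 0)"
  by (rule expands_checkI[of 3 7 4 9 "- 1" 844 1000 4 7]) (simp; fail | code_simp)+

lemma reflected_3_3_h: "4/9 \<le> \<alpha> \<Longrightarrow> \<alpha> < 14/31 \<Longrightarrow> expands \<alpha> (- 1) (93/100) (runs [3,3] 0)"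
  by (rule expands_checkI[of 4 9 14 31 "- 1" 93 100 3 8]) (simp; fail | code_simp)+

lemma reflected_3_6_i: "14/31 \<le> \<alpha> \<Longrightarrow> \<alpha> < 16/35 \<Longrightarrow> expands \<alpha> (- 1) (103/100) (runs [3,6] 0)"
  by (rule expands_checkI[of 14 31 16 35 "- 1" 103 100 1 4]) (simp; fail | code_simp)+

lemma reflected_3_i: "14/31 \<le> \<alpha> \<Longrightarrow> \<alpha> < 16/35 \<Longrightarrow> expands \<alpha> (- 1) (81/100) (runs [3] 0)"
  by (rule expands_checkI[of 14 31 16 35 "- 1" 81 100 3 5]) (simp; fail | code_simp)+

lemma reflected_3_3_j: "16/35 \<le> \<alpha> \<Longrightarrow> \<alpha> < 29/63 \<Longrightarrow> expands \<alpha> (- 1) (89/100) (runs [3,3] 0)"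
  by (rule expands_checkI[of 16 35 29 63 "- 1" 89 100 2 5]) (simp; fail | code_simp)+

lemma reflected_6_j: "16/35 \<le> \<alpha> \<Longrightarrow> \<alpha> < 29/63 \<Longrightarrow> expands \<alpha> (- 1) (844/1000) (runs [6] 0)"
  by (rule expands_checkI[of 16 35 29 63 "- 1" 844 1000 1 2]) (simp; fail | code_simp)+

text \<open>A common rate for all pieces. It has to be close to 1: for runs of length ten with
  \<alpha> up to 14/31 the estimate used, with c = 4313/10000, has a margin of less than one
  thousandth.\<close>

abbreviation gains :: "real \<Rightarrow> bool list \<Rightarrow> bool" where
  "gains \<alpha> w \<equiv> expands \<alpha> 0 (5001/5000) w"

lemma gains_append:
  assumes "expands \<alpha> 0 r w" "expands \<alpha> 0 s v" "w @ v = x" "\<alpha> < 1" "0 \<le> s" "5001/5000 \<le> r * s"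
  shows "gains \<alpha> x"
  using expands_mono[OF assms(4) expands_append[OF assms(1,2,5)] assms(6)] assms(3) by simp

lemma gains_change_last:
  assumes "gains \<alpha> x" "x \<noteq> []" "y \<noteq> []" "butlast x = butlast y"
  shows "gains \<alpha> y"
  using expands_change_last[of \<alpha> 0 "5001/5000" "butlast x" "last x" "last y"] assms
  by (metis append_butlast_last_id)

lemma gains_run_append:
  assumes "0 < \<alpha>" "\<alpha> \<le> a" "a < 1/2" "0 \<le> c" "c < 1" "a\<^sup>2 \<le> c\<^sup>2 * (2 * (1 - a))"
    "expands \<alpha> (-1) k w" "runs [m] 0 @ w = x" "0 \<le> k" "1 \<le> m"
    "5001/5000 \<le> k * (2 * (1 - a)) ^ m * (1 - c)"
  shows "gains \<alpha> x"
  using expands_run_append[OF assms(1-7,9-11)] assms(8) by simp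

section \<open>The eleven parameter intervals\<close>

lemma contracting_if_gains:
  assumes \<alpha>: "0 < \<alpha>" "\<alpha> \<le> a" "a < 1/2" and c: "0 \<le> c" "c < 1" "a\<^sup>2 \<le> c\<^sup>2 * (2 * (1 - a))"
    and T: "5001/5000 * (1 + c) \<le> (2 * (1 - a)) ^ Suc T * (1 - c)"
    and E: "\<forall>e \<in> set E. gains \<alpha> e" and X: "\<forall>x \<in> set X. excluded \<alpha> x"
    and three: "gains \<alpha> (runs [3] 0)"
    and cov: "covered T E X 30 [] (stops T E X [])"
  shows "contracting \<alpha>"
proof (rule contracting_if_covered)
  show "gains \<alpha> (runs [m] 0)" if "T < m" for m
    using expands_run[OF \<alpha> c, of "Suc T" m "5001/5000"] T that by simp
  show "gains \<alpha> (replicate 3 False)"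
    by (rule gains_change_last[OF three]) (simp_all add: runs_def numeral_eq_Suc)
  show "covered T E X 30 [] (stops T E X [])" by (rule cov)
qed (use \<alpha> E X in auto)

text \<open>Every single branch expands here, so the search is empty: with threshold 0 it stops at
  once and every run counts as long.\<close>

lemma contracting_1:
  assumes "0 < \<alpha>" "\<alpha> < 3/13"
  shows "contracting \<alpha>"
proof -
  have s: "expands \<alpha> 0 (26/25) [s]" for s
    using expands_change_last[of \<alpha> 0 "26/25" "[]" True s] expands_1_a[of \<alpha>] assms by (simp add: runs_def)
  have e: "expands \<alpha> 0 (26/25) (s # w)" for s w
  proof (induction w arbitrary: s)
    case (Cons t w)
    show ?case
      by (rule expands_mono[OF _ expands_append[OF s[of s] Cons[of t], simplified]]) (use assms in auto)
  qed (rule s)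
  have "expands \<alpha> 0 (26/25) w" if "w \<noteq> []" for w using e that by (metis list.exhaust)
  then show ?thesis
    using assms by (intro contracting_if_covered[of \<alpha> "26/25" "[]" "[]" 0 0]) (auto simp: runs_def stops_def)
qed

text \<open>A run of length two or three makes up for one or two preceding runs of length one, and
  no third one can follow an increasing branch. Words ending in decreasing branches, such as
  \<open>runs [1] 2\<close>, serve when a longer run follows: they expand already, and the rest of
  that run still shows \<open>T\<close> decreasing branches.\<close>

lemma contracting_2:
  assumes "3/13 \<le> \<alpha>" "\<alpha> < 2/7"
  shows "contracting \<alpha>"
proof -
  note r1 = expands_1_b[OF assms] and r2 = expands_2_b[OF assms] and r3 = expands_3_b[OF assms]
  have e_3: "gains \<alpha> (runs [3] 0)" by (rule expands_mono[OF _ r3]) (use assms in simp_all)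
  have r11: "expands \<alpha> 0 (85/100 * (85/100)) (runs [1,1] 0)" using expands_append[OF r1 r1] by (simp add: runs_def)
  have e_1_2: "gains \<alpha> (runs [1,2] 0)" by (rule gains_append[OF r1 r2]) (use assms in \<open>simp_all add: runs_def numeral_eq_Suc\<close>)
  have e_1_3: "gains \<alpha> (runs [1,3] 0)" by (rule gains_append[OF r1 r3]) (use assms in \<open>simp_all add: runs_def numeral_eq_Suc\<close>)
  have e_1_1_2: "gains \<alpha> (runs [1,1,2] 0)" by (rule gains_append[OF r11 r2]) (use assms in \<open>simp_all add: runs_def numeral_eq_Suc\<close>)
  have e_1_1_3: "gains \<alpha> (runs [1,1,3] 0)" by (rule gains_append[OF r11 r3]) (use assms in \<open>simp_all add: runs_def numeral_eq_Suc\<close>)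
  have e_1_m2: "gains \<alpha> (runs [1] 2)" by (rule gains_change_last[OF e_1_2]) (simp_all add: runs_def numeral_eq_Suc)
  have e_1_1_m2: "gains \<alpha> (runs [1,1] 2)" by (rule gains_change_last[OF e_1_1_2]) (simp_all add: runs_def numeral_eq_Suc)
  let ?E = "[runs [1,2] 0, runs [1,3] 0, runs [1,1,2] 0, runs [1,1,3] 0, runs [1] 2, runs [1,1]
    2]"
  let ?X = "[runs [1,1,1,1] 0]"
  show ?thesis
  proof (rule contracting_if_gains[of \<alpha> "2/7" "6/25" 1 ?E ?X])
    show "\<forall>e \<in> set ?E. gains \<alpha> e" using e_1_2 e_1_3 e_1_1_2 e_1_1_3 e_1_m2
    e_1_1_m2 by simp
    show "\<forall>x \<in> set ?X. excluded \<alpha> x" using assms excluded_1_1_1_1_0[of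
    \<alpha>] by simp
    show "gains \<alpha> (runs [3] 0)" by (rule e_3)
    show "covered 1 ?E ?X 30 [] (stops 1 ?E ?X [])" by code_simp
  qed (use assms in \<open>simp_all add: power_divide\<close>)
qed

lemma contracting_3:
  assumes "2/7 \<le> \<alpha>" "\<alpha> < 5/16"
  shows "contracting \<alpha>"
proof -
  note r1 = expands_1_c[OF assms] and r2 = expands_2_c[OF assms] and r3 = expands_3_c[OF assms]
  have e_3: "gains \<alpha> (runs [3] 0)" by (rule expands_mono[OF _ r3]) (use assms in simp_all)
  have e_1_2: "gains \<alpha> (runs [1,2] 0)" by (rule gains_append[OF r1 r2]) (use assms in \<open>simp_all add: runs_def numeral_eq_Suc\<close>)
  have e_1_3: "gains \<alpha> (runs [1,3] 0)" by (rule gains_append[OF r1 r3]) (use assms in \<open>simp_all add: runs_def numeral_eq_Suc\<close>)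
  have e_1_m2: "gains \<alpha> (runs [1] 2)" by (rule gains_change_last[OF e_1_2]) (simp_all add: runs_def numeral_eq_Suc)
  let ?E = "[runs [1,2] 0, runs [1,3] 0, runs [1] 2]"
  let ?X = "[runs [1,1,1] 0]"
  show ?thesis
  proof (rule contracting_if_gains[of \<alpha> "5/16" "267/1000" 1 ?E ?X])
    show "\<forall>e \<in> set ?E. gains \<alpha> e" using e_1_2 e_1_3 e_1_m2 by simp
    show "\<forall>x \<in> set ?X. excluded \<alpha> x" using assms excluded_1_1_1_0[of
    \<alpha>] by simp
    show "gains \<alpha> (runs [3] 0)" by (rule e_3)
    show "covered 1 ?E ?X 30 [] (stops 1 ?E ?X [])" by code_simp
  qed (use assms in \<open>simp_all add: power_divide\<close>)
qed

lemma contracting_4: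
  assumes "5/16 \<le> \<alpha>" "\<alpha> < 7/20"
  shows "contracting \<alpha>"
proof -
  note r1 = expands_1_d[OF assms] and r3 = expands_3_d[OF assms]
  have e_3: "gains \<alpha> (runs [3] 0)" by (rule expands_mono[OF _ r3]) (use assms in simp_all)
  have e_1_3: "gains \<alpha> (runs [1,3] 0)" by (rule gains_append[OF r1 r3]) (use assms in \<open>simp_all add: runs_def numeral_eq_Suc\<close>)
  have e_1_m3: "gains \<alpha> (runs [1] 3)" by (rule gains_change_last[OF e_1_3]) (simp_all add: runs_def numeral_eq_Suc)
  have r4: "expands \<alpha> 0 (3/2) (runs [m] 0)" if "4 \<le> m" for m
    by (rule expands_run[of \<alpha> "7/20" "307/1000" 4 m]) (use assms that in \<open>simp_all add: power_divide\<close>)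
  have e_1_4: "gains \<alpha> (runs [1,4] 0)" by (rule gains_append[OF r1 r4[of 4]]) (use assms in \<open>simp_all add: runs_def numeral_eq_Suc\<close>)
  have e_1_5: "gains \<alpha> (runs [1,5] 0)" by (rule gains_append[OF r1 r4[of 5]]) (use assms in \<open>simp_all add: runs_def numeral_eq_Suc\<close>)
  let ?E = "[runs [1,3] 0, runs [1,4] 0, runs [1,5] 0, runs [1] 3]"
  let ?X = "[runs [1,1,1] 0, runs [1,2] 0]"
  show ?thesis
  proof (rule contracting_if_gains[of \<alpha> "7/20" "307/1000" 2 ?E ?X])
    show "\<forall>e \<in> set ?E. gains \<alpha> e" using e_1_3 e_1_4 e_1_5 e_1_m3 by simp
    show "\<forall>x \<in> set ?X. excluded \<alpha> x" using assms excluded_1_1_1_0[of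
    \<alpha>] excluded_1_2_0[of \<alpha>] by simp
    show "gains \<alpha> (runs [3] 0)" by (rule e_3)
    show "covered 2 ?E ?X 30 [] (stops 2 ?E ?X [])" by code_simp
  qed (use assms in \<open>simp_all add: power_divide\<close>)
qed

text \<open>Runs of length one and two no longer follow an increasing branch, a run of three expands
  by its own certificate, and all longer runs expand by the adapted form.\<close>

lemma contracting_5:
  assumes "7/20 \<le> \<alpha>" "\<alpha> < 19/48"
  shows "contracting \<alpha>"
proof -
  have e_3: "gains \<alpha> (runs [3] 0)"
    by (rule expands_mono[OF _ expands_3_e]) (use assms in simp_all)
  let ?E = "[runs [3] 0]"
  let ?X = "[runs [1,1] 0, runs [1,2] 0]"
  show ?thesis
  proof (rule contracting_if_gains[of \<alpha> "19/48" "361/1000" 3 ?E ?X])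
    show "\<forall>e \<in> set ?E. gains \<alpha> e" using e_3 by simp
    show "\<forall>x \<in> set ?X. excluded \<alpha> x" using assms excluded_1_1_0[of \<alpha>]
    excluded_1_2_0[of \<alpha>] by simp
    show "gains \<alpha> (runs [3] 0)" by (rule e_3)
    show "covered 3 ?E ?X 30 [] (stops 3 ?E ?X [])" by code_simp
  qed (use assms in \<open>simp_all add: power_divide\<close>)
qed

text \<open>The run of length four needs a partner. Excluding \<open>runs [1,4] 3\<close> leaves at
  most three letters for the run after it, hence exactly three, and the two together expand.\<close>

lemma contracting_6:
  assumes "19/48 \<le> \<alpha>" "\<alpha> < 5/12"
  shows "contracting \<alpha>"
proof -
  have e_3: "gains \<alpha> (runs [3] 0)"
    by (rule expands_mono[OF _ expands_3_e]) (use assms in simp_all)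
  have e_4_3: "gains \<alpha> (runs [4,3] 0)"
    by (rule gains_run_append[OF _ _ _ _ _ _ reflected_3_f[of \<alpha>], of "5/12" "193/500" 4]) (use assms in \<open>simp_all add: runs_def power_divide\<close>)
  let ?E = "[runs [3] 0, runs [4,3] 0]"
  let ?X = "[runs [1,1] 0, runs [1,2] 0, runs [1,4] 3, runs [1,5] 0]"
  show ?thesis
  proof (rule contracting_if_gains[of \<alpha> "5/12" "193/500" 5 ?E ?X])
    show "\<forall>e \<in> set ?E. gains \<alpha> e" using e_3 e_4_3 by simp
    show "\<forall>x \<in> set ?X. excluded \<alpha> x" using assms excluded_1_1_0[of \<alpha>]
    excluded_1_2_0[of \<alpha>] excluded_1_4_3[of \<alpha>] excluded_1_5_0[of \<alpha>] by simp
    show "gains \<alpha> (runs [3] 0)" by (rule e_3)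
    show "covered 5 ?E ?X 30 [] (stops 5 ?E ?X [])" by code_simp
  qed (use assms in \<open>simp_all add: power_divide\<close>)
qed

text \<open>Runs of four and three now need a third run. Lengths 1, 2, 5, 8 are excluded after any
  increasing branch and 4, 7 after this pair, which leaves 3, 6, 9 and runs so long that six
  decreasing branches remain after three are split off.\<close>

lemma contracting_7:
  assumes "5/12 \<le> \<alpha>" "\<alpha> < 3/7"
  shows "contracting \<alpha>"
proof -
  have e_3: "gains \<alpha> (runs [3] 0)"
    by (rule expands_mono[OF _ expands_3_e]) (use assms in simp_all)
  have e_m3: "gains \<alpha> (runs [] 3)" by (rule gains_change_last[OF e_3]) (simp_all add: runs_def numeral_eq_Suc)
  have e_6: "gains \<alpha> (runs [6] 0)" by (rule gains_append[OF e_m3 e_3]) (use assms in \<open>simp_all add: runs_def numeral_eq_Suc\<close>)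
  have e_4_3_3: "gains \<alpha> (runs [4,3,3] 0)"
    by (rule gains_run_append[OF _ _ _ _ _ _ reflected_3_3_f[of \<alpha>], of "3/7" "401/1000" 4]) (use assms in \<open>simp_all add: runs_def power_divide\<close>)
  have e_4_3_m3: "gains \<alpha> (runs [4,3] 3)" by (rule gains_change_last[OF e_4_3_3]) (simp_all add: runs_def numeral_eq_Suc)
  have e_4_3_6: "gains \<alpha> (runs [4,3,6] 0)" by (rule gains_append[OF e_4_3_m3 e_3]) (use assms in \<open>simp_all add: runs_def numeral_eq_Suc\<close>)
  have e_4_3_9: "gains \<alpha> (runs [4,3,9] 0)" by (rule gains_append[OF e_4_3_m3 e_6]) (use assms in \<open>simp_all add: runs_def numeral_eq_Suc\<close>)
  let ?E = "[runs [3] 0, runs [6] 0, runs [4,3,3] 0, runs [4,3,6] 0, runs [4,3,9] 0, runs [4,3]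
    3]"
  let ?X = "[runs [1,1] 0, runs [1,2] 0, runs [1,4] 3, runs [1,5] 0, runs [1,8] 0, runs
    [1,4,3,4] 0, runs [1,4,3,7] 0]"
  show ?thesis
  proof (rule contracting_if_gains[of \<alpha> "3/7" "401/1000" 6 ?E ?X])
    show "\<forall>e \<in> set ?E. gains \<alpha> e" using e_3 e_6 e_4_3_3 e_4_3_6 e_4_3_9
    e_4_3_m3 by simp
    show "\<forall>x \<in> set ?X. excluded \<alpha> x" using assms excluded_1_1_0[of \<alpha>]
    excluded_1_2_0[of \<alpha>] excluded_1_4_3[of \<alpha>] excluded_1_5_0[of \<alpha>]
    excluded_1_8_0[of \<alpha>] excluded_1_4_3_4_0[of \<alpha>] excluded_1_4_3_7_0[of \<alpha>]
    by simp
    show "gains \<alpha> (runs [3] 0)" by (rule e_3)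
    show "covered 6 ?E ?X 30 [] (stops 6 ?E ?X [])" by code_simp
  qed (use assms in \<open>simp_all add: power_divide\<close>)
qed

text \<open>The run of seven takes over the role of the run of four, which can no longer occur after
  an increasing branch. Its possible successors are 3, 6, 9, 11 and longer runs.\<close>

lemma contracting_8:
  assumes "3/7 \<le> \<alpha>" "\<alpha> < 4/9"
  shows "contracting \<alpha>"
proof -
  have e_3: "gains \<alpha> (runs [3] 0)"
    by (rule expands_mono[OF _ expands_3_f]) (use assms in simp_all)
  have e_m3: "gains \<alpha> (runs [] 3)" by (rule gains_change_last[OF e_3]) (simp_all add: runs_def numeral_eq_Suc)
  have e_6: "gains \<alpha> (runs [6] 0)" by (rule gains_append[OF e_m3 e_3]) (use assms in \<open>simp_all add: runs_def numeral_eq_Suc\<close>)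
  \<comment> \<open>A run of eight is itself excluded after an increasing branch; the estimate is
    for the last eight letters of a run of eleven, once three have been split off.\<close>
  have e_8: "gains \<alpha> (runs [8] 0)"
    by (rule expands_mono[OF _ expands_8_g]) (use assms in simp_all)
  have e_7_3: "gains \<alpha> (runs [7,3] 0)"
    by (rule gains_run_append[OF _ _ _ _ _ _ reflected_3_g[of \<alpha>], of "4/9" "211/500" 7]) (use assms in \<open>simp_all add: runs_def power_divide\<close>)
  have e_7_m3: "gains \<alpha> (runs [7] 3)" by (rule gains_change_last[OF e_7_3]) (simp_all add: runs_def numeral_eq_Suc)
  have e_7_6: "gains \<alpha> (runs [7,6] 0)" by (rule gains_append[OF e_7_m3 e_3]) (use assms in \<open>simp_all add: runs_def numeral_eq_Suc\<close>)
  have e_7_9: "gains \<alpha> (runs [7,9] 0)" by (rule gains_append[OF e_7_m3 e_6]) (use assms in \<open>simp_all add: runs_def numeral_eq_Suc\<close>)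
  have e_7_11: "gains \<alpha> (runs [7,11] 0)" by (rule gains_append[OF e_7_m3 e_8]) (use assms in \<open>simp_all add: runs_def numeral_eq_Suc\<close>)
  let ?E = "[runs [3] 0, runs [6] 0, runs [7,3] 0, runs [7,6] 0, runs [7,9] 0, runs [7,11] 0,
    runs [7] 3]"
  let ?X = "[runs [1,1] 0, runs [1,2] 0, runs [1,4] 0, runs [1,5] 0, runs [1,8] 0, runs [1,7,7]
    0, runs [1,7,10] 0]"
  show ?thesis
  proof (rule contracting_if_gains[of \<alpha> "4/9" "211/500" 8 ?E ?X])
    show "\<forall>e \<in> set ?E. gains \<alpha> e" using e_3 e_6 e_7_3 e_7_6 e_7_9 e_7_11
    e_7_m3 by simp
    show "\<forall>x \<in> set ?X. excluded \<alpha> x" using assms excluded_1_1_0[of \<alpha>]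
    excluded_1_2_0[of \<alpha>] excluded_1_4_0[of \<alpha>] excluded_1_5_0[of \<alpha>]
    excluded_1_8_0[of \<alpha>] excluded_1_7_7_0[of \<alpha>] excluded_1_7_10_0[of \<alpha>] by
    simp
    show "gains \<alpha> (runs [3] 0)" by (rule e_3)
    show "covered 8 ?E ?X 30 [] (stops 8 ?E ?X [])" by code_simp
  qed (use assms in \<open>simp_all add: power_divide\<close>)
qed

text \<open>A run of seven can be followed only by a run of three here, and the pair is completed by
  a third run as in the case of four and three.\<close>

lemma contracting_9:
  assumes "4/9 \<le> \<alpha>" "\<alpha> < 14/31"
  shows "contracting \<alpha>"
proof -
  have e_3: "gains \<alpha> (runs [3] 0)"
    by (rule expands_mono[OF _ expands_3_f]) (use assms in simp_all)
  have e_m3: "gains \<alpha> (runs [] 3)" by (rule gains_change_last[OF e_3]) (simp_all add: runs_def numeral_eq_Suc)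
  have e_6: "gains \<alpha> (runs [6] 0)" by (rule gains_append[OF e_m3 e_3]) (use assms in \<open>simp_all add: runs_def numeral_eq_Suc\<close>)
  have e_9: "gains \<alpha> (runs [9] 0)" by (rule gains_append[OF e_m3 e_6]) (use assms in \<open>simp_all add: runs_def numeral_eq_Suc\<close>)
  have e_8: "gains \<alpha> (runs [8] 0)"
    by (rule expands_mono[OF _ expands_8_h]) (use assms in simp_all)
  have e_7_3_3: "gains \<alpha> (runs [7,3,3] 0)"
    by (rule gains_run_append[OF _ _ _ _ _ _ reflected_3_3_h[of \<alpha>], of "14/31" "4313/10000" 7]) (use assms in \<open>simp_all add: runs_def power_divide\<close>)
  have e_7_3_m3: "gains \<alpha> (runs [7,3] 3)" by (rule gains_change_last[OF e_7_3_3]) (simp_all add: runs_def numeral_eq_Suc)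
  have e_7_3_6: "gains \<alpha> (runs [7,3,6] 0)" by (rule gains_append[OF e_7_3_m3 e_3]) (use assms in \<open>simp_all add: runs_def numeral_eq_Suc\<close>)
  have e_7_3_9: "gains \<alpha> (runs [7,3,9] 0)" by (rule gains_append[OF e_7_3_m3 e_6]) (use assms in \<open>simp_all add: runs_def numeral_eq_Suc\<close>)
  have e_7_3_11: "gains \<alpha> (runs [7,3,11] 0)" by (rule gains_append[OF e_7_3_m3 e_8]) (use assms in \<open>simp_all add: runs_def numeral_eq_Suc\<close>)
  have e_7_3_12: "gains \<alpha> (runs [7,3,12] 0)" by (rule gains_append[OF e_7_3_m3 e_9]) (use assms in \<open>simp_all add: runs_def numeral_eq_Suc\<close>)
  let ?E = "[runs [3] 0, runs [6] 0, runs [9] 0, runs [7,3,3] 0, runs [7,3,6] 0, runs [7,3,9] 0,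
    runs [7,3,11] 0, runs [7,3,12] 0, runs [7,3] 3]"
  let ?X = "[runs [1,1] 0, runs [1,2] 0, runs [1,4] 0, runs [1,5] 0, runs [1,8] 0, runs [1,7] 3,
    runs [1,7,3,7] 0, runs [1,7,3,10] 0]"
  show ?thesis
  proof (rule contracting_if_gains[of \<alpha> "14/31" "4313/10000" 9 ?E ?X])
    show "\<forall>e \<in> set ?E. gains \<alpha> e" using e_3 e_6 e_9 e_7_3_3 e_7_3_6 e_7_3_9
    e_7_3_11 e_7_3_12 e_7_3_m3 by simp
    show "\<forall>x \<in> set ?X. excluded \<alpha> x" using assms excluded_1_1_0[of \<alpha>]
    excluded_1_2_0[of \<alpha>] excluded_1_4_0[of \<alpha>] excluded_1_5_0[of \<alpha>]
    excluded_1_8_0[of \<alpha>] excluded_1_7_3[of \<alpha>] excluded_1_7_3_7_0[of \<alpha>]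
    excluded_1_7_3_10_0[of \<alpha>] by simp
    show "gains \<alpha> (runs [3] 0)" by (rule e_3)
    show "covered 9 ?E ?X 30 [] (stops 9 ?E ?X [])" by code_simp
  qed (use assms in \<open>simp_all add: power_divide\<close>)
qed

text \<open>The exceptional lengths are 7 and 10. After 7 the exclusions leave only a run of three
  followed by a run of six, and after 10 only a run of three or of six.\<close>

lemma contracting_10:
  assumes "14/31 \<le> \<alpha>" "\<alpha> < 16/35"
  shows "contracting \<alpha>"
proof -
  have e_3: "gains \<alpha> (runs [3] 0)"
    by (rule expands_mono[OF _ expands_3_f]) (use assms in simp_all)
  have e_m3: "gains \<alpha> (runs [] 3)" by (rule gains_change_last[OF e_3]) (simp_all add: runs_def numeral_eq_Suc)
  have e_6: "gains \<alpha> (runs [6] 0)" by (rule gains_append[OF e_m3 e_3]) (use assms in \<open>simp_all add: runs_def numeral_eq_Suc\<close>)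
  have e_9: "gains \<alpha> (runs [9] 0)" by (rule gains_append[OF e_m3 e_6]) (use assms in \<open>simp_all add: runs_def numeral_eq_Suc\<close>)
  have e_7_3_6: "gains \<alpha> (runs [7,3,6] 0)"
    by (rule gains_run_append[OF _ _ _ _ _ _ reflected_3_6_i[of \<alpha>], of "16/35" "439/1000" 7]) (use assms in \<open>simp_all add: runs_def power_divide\<close>)
  have e_10_3: "gains \<alpha> (runs [10,3] 0)"
    by (rule gains_run_append[OF _ _ _ _ _ _ reflected_3_i[of \<alpha>], of "16/35" "439/1000" 10]) (use assms in \<open>simp_all add: runs_def power_divide\<close>)
  have e_10_m3: "gains \<alpha> (runs [10] 3)" by (rule gains_change_last[OF e_10_3]) (simp_all add: runs_def numeral_eq_Suc)
  have e_10_6: "gains \<alpha> (runs [10,6] 0)" by (rule gains_append[OF e_10_m3 e_3]) (use assms in \<open>simp_all add: runs_def numeral_eq_Suc\<close>)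
  let ?E = "[runs [3] 0, runs [6] 0, runs [9] 0, runs [7,3,6] 0, runs [10,3] 0, runs [10,6] 0]"
  let ?X = "[runs [1,1] 0, runs [1,2] 0, runs [1,4] 0, runs [1,5] 0, runs [1,8] 0, runs [1,11]
    0, runs [1,7] 3, runs [1,7,3,3] 0, runs [1,7,3] 6, runs [1,10] 6]"
  show ?thesis
  proof (rule contracting_if_gains[of \<alpha> "16/35" "439/1000" 11 ?E ?X])
    show "\<forall>e \<in> set ?E. gains \<alpha> e" using e_3 e_6 e_9 e_7_3_6 e_10_3 e_10_6 by
    simp
    show "\<forall>x \<in> set ?X. excluded \<alpha> x" using assms excluded_1_1_0[of \<alpha>]
    excluded_1_2_0[of \<alpha>] excluded_1_4_0[of \<alpha>] excluded_1_5_0[of \<alpha>]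
    excluded_1_8_0[of \<alpha>] excluded_1_11_0[of \<alpha>] excluded_1_7_3[of \<alpha>]
    excluded_1_7_3_3_0[of \<alpha>] excluded_1_7_3_6[of \<alpha>] excluded_1_10_6[of \<alpha>]
    by simp
    show "gains \<alpha> (runs [3] 0)" by (rule e_3)
    show "covered 11 ?E ?X 30 [] (stops 11 ?E ?X [])" by code_simp
  qed (use assms in \<open>simp_all add: power_divide\<close>)
qed

text \<open>Only the length 10 remains exceptional: the multiples of three up to 12 expand by
  cutting off decreasing triples, and the other lengths below 12 are excluded. After 10 only 3 or 6
  can follow, and after 10 and 3 again only 3 or 6.\<close>

lemma contracting_11:
  assumes "16/35 \<le> \<alpha>" "\<alpha> < 29/63"
  shows "contracting \<alpha>"
proof -
  have e_3: "gains \<alpha> (runs [3] 0)"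
    by (rule expands_mono[OF _ expands_3_f]) (use assms in simp_all)
  have e_m3: "gains \<alpha> (runs [] 3)" by (rule gains_change_last[OF e_3]) (simp_all add: runs_def numeral_eq_Suc)
  have e_6: "gains \<alpha> (runs [6] 0)" by (rule gains_append[OF e_m3 e_3]) (use assms in \<open>simp_all add: runs_def numeral_eq_Suc\<close>)
  have e_9: "gains \<alpha> (runs [9] 0)" by (rule gains_append[OF e_m3 e_6]) (use assms in \<open>simp_all add: runs_def numeral_eq_Suc\<close>)
  have e_12: "gains \<alpha> (runs [12] 0)" by (rule gains_append[OF e_m3 e_9]) (use assms in \<open>simp_all add: runs_def numeral_eq_Suc\<close>)
  have e_10_3_3: "gains \<alpha> (runs [10,3,3] 0)"
    by (rule gains_run_append[OF _ _ _ _ _ _ reflected_3_3_j[of \<alpha>], of "29/63" "111/250" 10]) (use assms in \<open>simp_all add: runs_def power_divide\<close>)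
  have e_10_6: "gains \<alpha> (runs [10,6] 0)"
    by (rule gains_run_append[OF _ _ _ _ _ _ reflected_6_j[of \<alpha>], of "29/63" "111/250" 10]) (use assms in \<open>simp_all add: runs_def power_divide\<close>)
  have e_10_3_m3: "gains \<alpha> (runs [10,3] 3)" by (rule gains_change_last[OF e_10_3_3]) (simp_all add: runs_def numeral_eq_Suc)
  have e_10_3_6: "gains \<alpha> (runs [10,3,6] 0)" by (rule gains_append[OF e_10_3_m3 e_3]) (use assms in \<open>simp_all add: runs_def numeral_eq_Suc\<close>)
  let ?E = "[runs [3] 0, runs [6] 0, runs [9] 0, runs [12] 0, runs [10,3,3] 0, runs [10,3,6] 0,
    runs [10,6] 0]"
  let ?X = "[runs [1,1] 0, runs [1,2] 0, runs [1,4] 0, runs [1,5] 0, runs [1,7] 0, runs [1,8] 0,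
    runs [1,11] 0, runs [1,10] 6, runs [1,10,3] 6]"
  show ?thesis
  proof (rule contracting_if_gains[of \<alpha> "29/63" "111/250" 12 ?E ?X])
    show "\<forall>e \<in> set ?E. gains \<alpha> e" using e_3 e_6 e_9 e_12 e_10_3_3 e_10_3_6
    e_10_6 by simp
    show "\<forall>x \<in> set ?X. excluded \<alpha> x" using assms excluded_1_1_0[of \<alpha>]
    excluded_1_2_0[of \<alpha>] excluded_1_4_0[of \<alpha>] excluded_1_5_0[of \<alpha>]
    excluded_1_7_0[of \<alpha>] excluded_1_8_0[of \<alpha>] excluded_1_11_0[of \<alpha>]
    excluded_1_10_6[of \<alpha>] excluded_1_10_3_6[of \<alpha>] by simp
    show "gains \<alpha> (runs [3] 0)" by (rule e_3)
    show "covered 12 ?E ?X 30 [] (stops 12 ?E ?X [])" by code_simp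
  qed (use assms in \<open>simp_all add: power_divide\<close>)
qed

lemma contracting_all:
  assumes "0 < \<alpha>" "\<alpha> \<le> 23/50"
  shows "contracting \<alpha>"
proof -
  \<comment> \<open>The right end 29/63 of the last interval lies just beyond 0.46.\<close>
  have "\<alpha> < 29/63" using assms by simp
  then consider "\<alpha> < 3/13" | "3/13 \<le> \<alpha>" "\<alpha> < 2/7" | "2/7 \<le> \<alpha>" "\<alpha> < 5/16" | "5/16 \<le> \<alpha>" "\<alpha> < 7/20"
    | "7/20 \<le> \<alpha>" "\<alpha> < 19/48" | "19/48 \<le> \<alpha>" "\<alpha> < 5/12" | "5/12 \<le> \<alpha>" "\<alpha> < 3/7"
    | "3/7 \<le> \<alpha>" "\<alpha> < 4/9" | "4/9 \<le> \<alpha>" "\<alpha> < 14/31" | "14/31 \<le> \<alpha>" "\<alpha> < 16/35"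
    | "16/35 \<le> \<alpha>" "\<alpha> < 29/63"
    by linarith
  then show ?thesis
    by cases (use assms contracting_1 contracting_2 contracting_3 contracting_4 contracting_5 contracting_6
        contracting_7 contracting_8 contracting_9 contracting_10 contracting_11 in auto)
qed

theorem theorem4:
  fixes \<alpha> :: real
  assumes "0 < \<alpha>" and "\<alpha> \<le> 0.46"
  shows "\<exists>\<mu> :: (real \<times> real) measure.
           sets \<mu> = sets leb_square \<and>
           prob_space \<mu> \<and>
           absolutely_continuous leb_square \<mu> \<and>
           Gmap \<alpha> \<in> measurable \<mu> \<mu> \<and>
           distr \<mu> \<mu> (Gmap \<alpha>) = \<mu>"
proof -
  have "contracting \<alpha>" using contracting_all[of \<alpha>] assms by simp
  then show ?thesis
    using acim_of_contraction[of \<alpha>] assms unfolding contracting_def by fastforce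
qed

end
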